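(* Let $t\ge 2$ be an integer, and let $G$ be a $K_{2,t}$-free planar graph with maximum degree $\Delta(G)$. Then $q_B(G)\le \Delta(G)+t-1$ whenever $t=2$ or $t\ge 35$, and also whenever $3\le t\le 34$ and $\Delta(G)\ge 13(t-1)$.
   Context: All graphs are finite, simple and undirected. An edge-coloring is proper if incident edges receive distinct colors. A B-coloring of a graph $G$ is a proper edge-coloring in which the four edges of every $4$-cycle (not necessarily induced) receive pairwise distinct colors. The B-coloring number $q_B(G)$ is the minimum number of colors in a B-coloring of $G$. For an integer $t\ge2$, a graph is $K_{2,t}$-free if any two distinct vertices have at most $t-1$ common neighbors. *)

theory Defs
  imports "HOL-Analysis.Analysis"
begin

text \<open>A finite simple graph is a pair of a vertex set and an edge set, an edge being the set of
  its two endpoints.\<close>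

definition simple_graph :: "'a set \<Rightarrow> 'a set set \<Rightarrow> bool" where
  "simple_graph V E \<longleftrightarrow> finite V \<and> (\<forall>e\<in>E. e \<subseteq> V \<and> card e = 2)"

definition neighbors :: "'a set set \<Rightarrow> 'a \<Rightarrow> 'a set" where
  "neighbors E u = {v. {u, v} \<in> E}"

definition vertex_degree :: "'a set set \<Rightarrow> 'a \<Rightarrow> nat" where
  "vertex_degree E u = card (neighbors E u)"

text \<open>The inserted 0 only matters for the graph without vertices, whose maximum degree is
  taken to be 0.\<close>

definition max_degree :: "'a set \<Rightarrow> 'a set set \<Rightarrow> nat" where
  "max_degree V E = Max (insert 0 (vertex_degree E ` V))"

definition K2t_free :: "nat \<Rightarrow> 'a set \<Rightarrow> 'a set set \<Rightarrow> bool" where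
  "K2t_free t V E \<longleftrightarrow>
     (\<forall>u\<in>V. \<forall>v\<in>V. u \<noteq> v \<longrightarrow> card (neighbors E u \<inter> neighbors E v) \<le> t - 1)"

text \<open>Planarity is the existence of a drawing without crossings in the Euclidean plane, here the
  type \<^typ>\<open>complex\<close>: \<open>p\<close> places the vertices at distinct points, and \<open>g e\<close> is a simple arc
  joining the endpoints of \<open>e\<close>, which passes through no other vertex and meets
  the other arcs at most in common endpoints.\<close>

definition plane_drawing ::
    "'a set \<Rightarrow> 'a set set \<Rightarrow> ('a \<Rightarrow> complex) \<Rightarrow> ('a set \<Rightarrow> real \<Rightarrow> complex) \<Rightarrow> bool" where
  "plane_drawing V E p g \<longleftrightarrow>
     inj_on p V \<and>
     (\<forall>e\<in>E. arc (g e) \<and> {pathstart (g e), pathfinish (g e)} = p ` e \<and>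
             path_image (g e) \<inter> p ` V = p ` e) \<and>
     (\<forall>e\<in>E. \<forall>f\<in>E. e \<noteq> f \<longrightarrow> path_image (g e) \<inter> path_image (g f) \<subseteq> p ` (e \<inter> f))"

definition planar :: "'a set \<Rightarrow> 'a set set \<Rightarrow> bool" where
  "planar V E \<longleftrightarrow> (\<exists>p g. plane_drawing V E p g)"

definition proper_edge_coloring :: "'a set set \<Rightarrow> ('a set \<Rightarrow> nat) \<Rightarrow> bool" where
  "proper_edge_coloring E c \<longleftrightarrow>
     (\<forall>e\<in>E. \<forall>f\<in>E. e \<noteq> f \<and> e \<inter> f \<noteq> {} \<longrightarrow> c e \<noteq> c f)"

definition four_cycle :: "'a set set \<Rightarrow> 'a \<Rightarrow> 'a \<Rightarrow> 'a \<Rightarrow> 'a \<Rightarrow> bool" where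
  "four_cycle E u v w x \<longleftrightarrow>
     distinct [u, v, w, x] \<and> {u, v} \<in> E \<and> {v, w} \<in> E \<and> {w, x} \<in> E \<and> {x, u} \<in> E"

definition B_coloring :: "'a set set \<Rightarrow> ('a set \<Rightarrow> nat) \<Rightarrow> bool" where
  "B_coloring E c \<longleftrightarrow>
     proper_edge_coloring E c \<and>
     (\<forall>u v w x. four_cycle E u v w x \<longrightarrow>
        distinct [c {u, v}, c {v, w}, c {w, x}, c {x, u}])"

definition B_coloring_number :: "'a set set \<Rightarrow> nat" where
  "B_coloring_number E = (LEAST k. \<exists>c. B_coloring E c \<and> card (c ` E) = k)"

end

theory Submission
  imports Defs "HOL-Complex_Analysis.Complex_Analysis"
begin

text \<open>
  Write \<open>s = t - 1\<close> for the bound on the number of common neighbors and \<open>D\<close> for the maximum degree.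
  Two edges are in conflict if they are incident or opposite in a 4-cycle, and the \<open>D + s\<close> colors
  have to be distributed without conflicts.

  For \<open>t = 2\<close> there are no 4-cycles, and Vizing's theorem gives \<open>D + 1\<close> colors
  (\<open>coloring_no_four_cycle\<close>).

  In the other cases the graph is colored by induction, deleting a set \<open>Y\<close> of vertices.
  Conflicts between surviving edges are not affected by this (\<open>conflict_delete\<close>), so a coloring of
  the smaller graph only has to be extended. Edges between vertices of small degree have few
  conflicts; they are erased and colored again at the very end. The set \<open>Y\<close> is chosen among the
  neighbors of one vertex \<open>a\<close> of large degree in such a way that essentially only the edges from
  \<open>a\<close> to \<open>Y\<close> remain to be colored. They form a star, and Hall's theorem applies. A violation of
  Hall's condition consists of many vertices \<open>y\<close> in \<open>Y\<close> which all see the same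
  large set of colors, none of them used at \<open>a\<close> (\<open>hall_violation\<close>). Each such color reaches \<open>y\<close> over
  a path from \<open>y\<close> through some \<open>v\<close> to a neighbor \<open>w\<close> of \<open>a\<close>, and a color occurs only once at each \<open>w\<close>.
  So the vertices \<open>v\<close> have many neighbors on both sides, which contradicts planarity.

  For \<open>s \<ge> 34\<close> the vertices of degree at least 12 count as large. A discharging argument finds a
  large \<open>a\<close> with at most eleven neighbors that are large or exceptional (\<open>exists_sparse_big\<close>), and
  \<open>hall_condition_big\<close> excludes violations; for \<open>D \<le> 25\<close> a vertex of degree at most five can
  simply be deleted. For \<open>D \<ge> 13 * s\<close> vertices are peeled off as long as they have degree
  less than \<open>D - 8 * s + 6\<close> and at most five neighbors left. Contracting the peeled vertices onto the core
  yields a core vertex \<open>a\<close> some of whose neighbors have no other neighbor in the core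
  (\<open>center_few_clusters\<close>, \<open>hall_condition_leaves\<close>).

  Planarity enters only through bounds on the number of edges, for subgraphs and for bipartite
  subgraphs, also after contracting disjoint stars (\<open>star_contraction_bound\<close>). They follow from
  a weighted form of Euler's inequality (\<open>euler_weighted\<close>), which is derived from the Jordan curve
  theorem and Janiszewski's theorem.
\<close>

section \<open>Forests and simple paths in edge sets\<close>

text \<open>Sets of edges without cycles. Comparing the number of edges with the number of covered vertices
  makes the two facts needed below short: a forest has a leaf, and a set that is not a forest contains
  a non-empty leafless set.\<close>

definition forest :: "'a set set \<Rightarrow> bool" where
  "forest A \<longleftrightarrow> (\<forall>B\<subseteq>A. B \<noteq> {} \<longrightarrow> card B < card (\<Union>B))"

definition leafless :: "'a set set \<Rightarrow> bool" where
  "leafless A \<longleftrightarrow> (\<forall>e\<in>A. \<forall>v\<in>e. \<exists>f\<in>A. f \<noteq> e \<and> v \<in> f)"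

lemma forest_subset: "forest A \<Longrightarrow> B \<subseteq> A \<Longrightarrow> forest B"
  unfolding forest_def by blast

lemma finite_vertices:
  assumes "finite A" "\<And>e. e \<in> A \<Longrightarrow> card e = 2"
  shows "finite (\<Union>A)"
proof (rule finite_Union[OF assms(1)])
  fix e assume "e \<in> A"
  then show "finite e" using assms(2) by (metis card.infinite zero_neq_numeral)
qed

lemma sum_if_card:
  "finite A \<Longrightarrow> (\<Sum>x\<in>A. if P x then 1 else 0) = card {x\<in>A. P x}"
  by (simp add: sum.inter_filter[symmetric])

lemma handshake:
  assumes "finite A" "\<And>e. e \<in> A \<Longrightarrow> card e = 2"
  shows "(\<Sum>v\<in>\<Union>A. card {e\<in>A. v \<in> e}) = 2 * card A"
proof -
  have fin: "finite (\<Union>A)"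
    by (rule finite_vertices[OF assms])
  have "(\<Sum>v\<in>\<Union>A. card {e\<in>A. v \<in> e}) = (\<Sum>v\<in>\<Union>A. \<Sum>e\<in>A. if v \<in> e then 1 else 0)"
    using assms(1) by (simp add: sum_if_card)
  also have "\<dots> = (\<Sum>e\<in>A. \<Sum>v\<in>\<Union>A. if v \<in> e then 1 else 0)"
    by (rule sum.swap)
  also have "\<dots> = (\<Sum>e\<in>A. card e)"
  proof (rule sum.cong[OF refl])
    fix e assume "e \<in> A"
    then have "{v \<in> \<Union>A. v \<in> e} = e" by blast
    then show "(\<Sum>v\<in>\<Union>A. if v \<in> e then 1 else 0) = card e"
      using fin by (simp add: sum_if_card)
  qed
  also have "\<dots> = 2 * card A" using assms(2) by simp
  finally show ?thesis .
qed

lemma forest_has_leaf: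
  assumes "finite A" "\<And>e. e \<in> A \<Longrightarrow> card e = 2" "forest A" "A \<noteq> {}"
  shows "\<exists>e v. e \<in> A \<and> v \<in> e \<and> (\<forall>f\<in>A. v \<in> f \<longrightarrow> f = e)"
proof (rule ccontr)
  assume "\<not> ?thesis"
  then have no: "\<And>e v. e \<in> A \<Longrightarrow> v \<in> e \<Longrightarrow> \<exists>f\<in>A. v \<in> f \<and> f \<noteq> e"
    by blast
  have ge: "card {e\<in>A. v \<in> e} \<ge> 2" if v: "v \<in> \<Union>A" for v
  proof -
    obtain e f where "e \<in> A" "v \<in> e" "f \<in> A" "v \<in> f" "f \<noteq> e" using no v by blast
    then have "{e,f} \<subseteq> {e\<in>A. v \<in> e}" "card {e,f} = 2" by auto
    then show ?thesis using assms(1) card_mono[of "{e\<in>A. v \<in> e}" "{e,f}"] by simp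
  qed
  have "(\<Sum>v\<in>\<Union>A. 2) \<le> (\<Sum>v\<in>\<Union>A. card {e\<in>A. v \<in> e})"
    by (rule sum_mono) (use ge in auto)
  then have "2 * card (\<Union>A) \<le> 2 * card A"
    using handshake[OF assms(1,2)] by simp
  moreover have "card A < card (\<Union>A)" using assms(3,4) unfolding forest_def by blast
  ultimately show False by simp
qed

text \<open>Take a smallest set that has at least as many edges as vertices. Removing a leaf together with
  its edge would give a smaller one.\<close>

lemma not_forest_leafless:
  assumes "finite A" "\<And>e. e \<in> A \<Longrightarrow> card e = 2" "\<not> forest A"
  obtains B where "B \<subseteq> A" "B \<noteq> {}" "leafless B"
proof -
  define P where "P B \<longleftrightarrow> B \<subseteq> A \<and> B \<noteq> {} \<and> card (\<Union>B) \<le> card B" for B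
  have "\<exists>B. P B" using assms(3) unfolding forest_def P_def by (meson not_le)
  then obtain B where B: "P B" and min: "\<And>C. P C \<Longrightarrow> card B \<le> card C"
    using ex_has_least_nat[of P _ card] by blast
  have fB: "finite B" using B assms(1) unfolding P_def by (meson finite_subset)
  have c2: "\<And>e. e \<in> B \<Longrightarrow> card e = 2" using B assms(2) unfolding P_def by blast
  have fUB: "finite (\<Union>B)" by (rule finite_vertices[OF fB c2])
  have "leafless B"
    unfolding leafless_def
  proof (intro ballI, rule ccontr)
    fix e v assume e: "e \<in> B" and v: "v \<in> e" and "\<not> (\<exists>f\<in>B. f \<noteq> e \<and> v \<in> f)"
    then have only: "\<And>f. f \<in> B \<Longrightarrow> v \<in> f \<Longrightarrow> f = e" by blast
    have sub: "\<Union>(B - {e}) \<subseteq> \<Union>B - {v}" using only by blast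
    have "card (\<Union>(B - {e})) \<le> card (\<Union>B - {v})"
      using sub fUB by (meson card_mono finite_Diff)
    also have "\<dots> = card (\<Union>B) - 1" using e v by (subst card_Diff_singleton) auto
    also have "\<dots> \<le> card B - 1" using B unfolding P_def by (intro diff_le_mono) blast
    also have "\<dots> = card (B - {e})" using e by simp
    finally have le: "card (\<Union>(B - {e})) \<le> card (B - {e})" .
    show False
    proof (cases "B - {e} = {}")
      case True
      then have "B = {e}" using e by blast
      then show False using B c2[OF e] unfolding P_def by simp
    next
      case False
      then have "P (B - {e})" using le B unfolding P_def by blast
      then have "card B \<le> card (B - {e})" by (rule min)
      then show False using e fB by (metis card_Diff1_less not_le)
    qed
  qed
  then show ?thesis using that B unfolding P_def by blast
qed

text \<open>A subset containing the new edge splits into the edges inside the component of \<open>x\<close> and the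
  others. Each part, together with its own endpoint of the new edge, covers more vertices than it
  has edges, and the two vertex sets are disjoint.\<close>

lemma forest_insert:
  assumes fin: "finite A" and c2: "\<And>e. e \<in> A \<Longrightarrow> card e = 2" and ac: "forest A"
    and xy: "x \<noteq> y" and nc: "(x, y) \<notin> {(u, v). {u, v} \<in> A}\<^sup>*"
  shows "forest (insert {x, y} A)"
  unfolding forest_def
proof (intro allI impI)
  fix B assume B: "B \<subseteq> insert {x, y} A" "B \<noteq> {}"
  have fB: "finite B" using B fin by (meson finite_insert finite_subset)
  show "card B < card (\<Union>B)"
  proof (cases "{x, y} \<in> B")
    case False
    then have "B \<subseteq> A" using B by blast
    then show ?thesis using ac B(2) unfolding forest_def by blast
  next
    case True
    let ?R = "{(u, v). {u, v} \<in> A}"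
    define X where "X = {z. (x, z) \<in> ?R\<^sup>*}"
    define B0 where "B0 = B - {{x, y}}"
    define B1 where "B1 = {e \<in> B0. e \<inter> X \<noteq> {}}"
    define B2 where "B2 = {e \<in> B0. e \<inter> X = {}}"
    have B0A: "B0 \<subseteq> A" using B unfolding B0_def by blast
    have closed: "e \<subseteq> X" if e1: "e \<in> B1" for e
    proof
      fix w assume w: "w \<in> e"
      have eA: "e \<in> A" using e1 B0A unfolding B1_def by blast
      obtain u where u: "u \<in> e" "u \<in> X" using e1 unfolding B1_def by blast
      obtain r r' where "e = {r, r'}" using c2[OF eA] by (meson card_2_iff)
      then have "w = u \<or> e = {u, w}" using u w by auto
      then show "w \<in> X"
      proof
        assume "w = u" then show ?thesis using u by simp
      next
        assume "e = {u, w}"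
        then have "(u, w) \<in> ?R" using eA by simp
        then show ?thesis using u unfolding X_def by (simp add: rtrancl.rtrancl_into_rtrancl)
      qed
    qed
    have xX: "x \<in> X" and yX: "y \<notin> X" using nc unfolding X_def by auto
    have bd: "card C + 1 \<le> card (\<Union>C \<union> {z})" if "C \<subseteq> A" for C z
    proof (cases "C = {}")
      case True then show ?thesis by simp
    next
      case False
      have "finite C" using that fin by (meson finite_subset)
      then have "finite (\<Union>C)" by (rule finite_vertices) (use c2 that in blast)
      moreover have "card C < card (\<Union>C)" using ac that False unfolding forest_def by blast
      moreover have "card (\<Union>C) \<le> card (\<Union>C \<union> {z})"
        by (rule card_mono) (use \<open>finite (\<Union>C)\<close> in auto)
      ultimately show ?thesis by linarith
    qed
    have U1: "\<Union>B1 \<union> {x} \<subseteq> X" using closed xX by blast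
    have U2: "(\<Union>B2 \<union> {y}) \<inter> X = {}" using yX unfolding B2_def by blast
    have UB: "\<Union>B = (\<Union>B1 \<union> {x}) \<union> (\<Union>B2 \<union> {y})"
      using True unfolding B1_def B2_def B0_def by blast
    have f1: "finite (\<Union>B)"
      by (rule finite_vertices[OF fB]) (use B c2 xy in auto)
    have "card (\<Union>B) = card (\<Union>B1 \<union> {x}) + card (\<Union>B2 \<union> {y})"
      unfolding UB
    proof (rule card_Un_disjoint)
      show "finite (\<Union>B1 \<union> {x})" using f1 UB by (metis finite_Un)
      show "finite (\<Union>B2 \<union> {y})" using f1 UB by (metis finite_Un)
      show "(\<Union>B1 \<union> {x}) \<inter> (\<Union>B2 \<union> {y}) = {}" using U1 U2 by blast
    qed
    moreover have "card B1 + 1 \<le> card (\<Union>B1 \<union> {x})" "card B2 + 1 \<le> card (\<Union>B2 \<union> {y})"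
      by (rule bd; use B0A in \<open>simp add: B1_def B2_def subset_iff\<close>)+
    moreover have "card B = card B0 + 1" using True fB unfolding B0_def
      by (metis Suc_eq_plus1 card.remove)
    moreover have "card B0 = card B1 + card B2"
    proof -
      have "B0 = B1 \<union> B2" "B1 \<inter> B2 = {}" "finite B0"
        unfolding B1_def B2_def B0_def using fB by auto
      then show ?thesis by (metis card_Un_disjoint finite_Un)
    qed
    ultimately show ?thesis by linarith
  qed
qed

text \<open>Simple paths, recorded together with their edge set because the drawing of a path is
  determined by its edges.\<close>

inductive gpath :: "'a set set \<Rightarrow> 'a \<Rightarrow> 'a \<Rightarrow> 'a set set \<Rightarrow> bool" for F x where
  gp_nil: "gpath F x x {}"
| gp_snoc: "gpath F x y Z \<Longrightarrow> {y, z} \<in> F \<Longrightarrow> z \<noteq> x \<Longrightarrow> z \<notin> \<Union>Z \<Longrightarrow> z \<noteq> y \<Longrightarrow> gpath F x z (insert {y, z} Z)"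

lemma gpath_sub: "gpath F x y Z \<Longrightarrow> Z \<subseteq> F"
  by (induction rule: gpath.induct) auto

lemma gpath_mono: "gpath F x y Z \<Longrightarrow> F \<subseteq> F' \<Longrightarrow> gpath F' x y Z"
  by (induction rule: gpath.induct) (auto intro: gpath.intros)

lemma gpath_end: "gpath F x y Z \<Longrightarrow> y = x \<and> Z = {} \<or> y \<in> \<Union>Z \<and> x \<in> \<Union>Z \<and> x \<noteq> y"
  by (induction rule: gpath.induct) auto

text \<open>Lets a walk be shortened as soon as it returns to a vertex, which is how reachability yields a
  simple path in the next lemma.\<close>

lemma gpath_prefix:
  "gpath F x y Z \<Longrightarrow> z \<in> insert x (\<Union>Z) \<Longrightarrow> \<exists>Z'. Z' \<subseteq> Z \<and> gpath F x z Z'"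
proof (induction rule: gpath.induct)
  case gp_nil
  then show ?case by (auto intro: gpath.gp_nil)
next
  case (gp_snoc y Z w)
  show ?case
  proof (cases "z = w")
    case True
    then show ?thesis using gpath.gp_snoc[OF gp_snoc(1-5)] by blast
  next
    case False
    have "y \<in> insert x (\<Union>Z)" using gpath_end[OF gp_snoc(1)] by blast
    then have "z \<in> insert x (\<Union>Z)" using gp_snoc.prems False by blast
    then show ?thesis using gp_snoc.IH by blast
  qed
qed

lemma rtrancl_gpath:
  assumes "(x, y) \<in> {(u, v). {u, v} \<in> F}\<^sup>*"
  shows "\<exists>Z. gpath F x y Z"
  using assms
proof (induction rule: rtrancl_induct)
  case base
  then show ?case by (auto intro: gpath.gp_nil)
next
  case (step y z)
  then obtain Z where Z: "gpath F x y Z" by blast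
  show ?case
  proof (cases "z \<in> insert x (\<Union>Z)")
    case True
    then show ?thesis using gpath_prefix[OF Z] by blast
  next
    case False
    moreover have "z \<noteq> y" using gpath_end[OF Z] False by blast
    ultimately show ?thesis using gpath.gp_snoc[OF Z, of z] step(2) by auto
  qed
qed

lemma gpath_append:
  assumes "gpath F y z Z'" "gpath F x y Z" "insert x (\<Union>Z) \<inter> (insert y (\<Union>Z')) \<subseteq> {y}" "y \<noteq> x \<or> Z = {}"
  shows "gpath F x z (Z \<union> Z')"
  using assms
proof (induction rule: gpath.induct)
  case gp_nil
  then show ?case by simp
next
  case (gp_snoc w Z' z)
  have wy: "w \<in> insert y (\<Union>Z')" using gpath_end[OF gp_snoc(1)] by blast
  have IH: "gpath F x w (Z \<union> Z')"
    using gp_snoc.IH gp_snoc.prems by blast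
  have zn: "z \<notin> insert x (\<Union>Z)" using gp_snoc(3) gp_snoc.prems(2) by blast
  have "gpath F x z (insert {w, z} (Z \<union> Z'))"
    by (rule gpath.gp_snoc[OF IH gp_snoc(2)]) (use zn gp_snoc(4,5) in auto)
  then show ?case by simp
qed

lemma gpath_split:
  assumes "gpath F x y Z" "e \<in> Z"
  shows "\<exists>a b Z1 Z2. e = {a, b} \<and> gpath F x a Z1 \<and> gpath F b y Z2 \<and> Z = insert e (Z1 \<union> Z2) \<and> e \<notin> Z1 \<union> Z2
     \<and> insert x (\<Union>Z1) \<inter> insert b (\<Union>Z2) = {}"
  using assms
proof (induction rule: gpath.induct)
  case gp_nil
  then show ?case by simp
next
  case (gp_snoc y Z z)
  show ?case
  proof (cases "e = {y, z}")
    case True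
    have "e \<notin> Z" using True gp_snoc(4) by blast
    have dis: "insert x (\<Union>Z) \<inter> insert z (\<Union>{}) = {}" using gp_snoc(3,4) by simp
    have "e = {y, z} \<and> gpath F x y Z \<and> gpath F z z {} \<and> insert {y, z} Z = insert e (Z \<union> {}) \<and>
      e \<notin> Z \<union> {} \<and> insert x (\<Union>Z) \<inter> insert z (\<Union>{}) = {}"
      using True \<open>e \<notin> Z\<close> gp_snoc(1) dis by (simp add: gpath.gp_nil)
    then show ?thesis by iprover
  next
    case False
    then have "e \<in> Z" using gp_snoc.prems by blast
    then obtain a b Z1 Z2 where 1: "e = {a, b}" "gpath F x a Z1" "gpath F b y Z2"
      "Z = insert e (Z1 \<union> Z2)" "e \<notin> Z1 \<union> Z2" "insert x (\<Union>Z1) \<inter> insert b (\<Union>Z2) = {}"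
      using gp_snoc.IH by blast
    have bz: "z \<noteq> b" "z \<notin> \<Union>Z2" "z \<notin> \<Union>Z1" using 1(1,4) gp_snoc(4) by auto
    have p2: "gpath F b z (insert {y, z} Z2)"
      by (rule gpath.gp_snoc[OF 1(3) gp_snoc(2)]) (use bz gp_snoc(5) in auto)
    have yb: "y \<in> insert b (\<Union>Z2)" using gpath_end[OF 1(3)] by blast
    have dis: "insert x (\<Union>Z1) \<inter> insert b (\<Union>(insert {y, z} Z2)) = {}"
      using 1(6) yb bz(3) gp_snoc(3) by auto
    have ne: "e \<notin> Z1 \<union> insert {y, z} Z2" using 1(5) False by auto
    have "e = {a, b} \<and> gpath F x a Z1 \<and> gpath F b z (insert {y, z} Z2) \<and>
      insert {y, z} Z = insert e (Z1 \<union> insert {y, z} Z2) \<and> e \<notin> Z1 \<union> insert {y, z} Z2 \<and>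
      insert x (\<Union>Z1) \<inter> insert b (\<Union>(insert {y, z} Z2)) = {}"
      using 1(1,2,4) p2 dis ne by (simp add: insert_commute)
    then show ?thesis by iprover
  qed
qed

text \<open>A path closed by one extra edge is symmetric in its edges: without any one of them it is again
  a path. Hence the chosen closing edge does not matter for the closed curve drawn by the cycle.\<close>

lemma gpath_cycle:
  assumes P: "gpath F x y P" and f: "{y, x} \<in> F" "{y, x} \<notin> P" "x \<noteq> y" and e: "e \<in> insert {y, x} P"
  shows "\<exists>a b. e = {a, b} \<and> a \<noteq> b \<and> gpath F b a (insert {y, x} P - {e})"
proof (cases "e = {y, x}")
  case True
  then have "insert {y, x} P - {e} = P" using f by auto
  then have "e = {y, x} \<and> y \<noteq> x \<and> gpath F x y (insert {y, x} P - {e})" using True P f(3) by simp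
  then show ?thesis by blast
next
  case False
  then have "e \<in> P" using e by simp
  then obtain a b Z1 Z2 where 1: "e = {a, b}" "gpath F x a Z1" "gpath F b y Z2"
      "P = insert e (Z1 \<union> Z2)" "e \<notin> Z1 \<union> Z2" "insert x (\<Union>Z1) \<inter> insert b (\<Union>Z2) = {}"
    using gpath_split[OF P \<open>e \<in> P\<close>] by (elim exE conjE)
  have ax: "a \<in> insert x (\<Union>Z1)" using gpath_end[OF 1(2)] by blast
  have yb: "y \<in> insert b (\<Union>Z2)" using gpath_end[OF 1(3)] by blast
  have ab: "a \<noteq> b" using ax 1(6) by blast
  have "gpath F b x (insert {y, x} Z2)"
    by (rule gpath.gp_snoc[OF 1(3) f(1)]) (use 1(6) f(3) in auto)
  then have "gpath F b a (insert {y, x} Z2 \<union> Z1)"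
    by (rule gpath_append[OF 1(2)]) (use 1(6) yb in auto)
  moreover have "insert {y, x} P - {e} = insert {y, x} Z2 \<union> Z1" using 1(4,5) False by auto
  ultimately have "e = {a, b} \<and> a \<noteq> b \<and> gpath F b a (insert {y, x} P - {e})" using 1(1) ab by simp
  then show ?thesis by blast
qed

section \<open>Curves and faces of a plane drawing\<close>

locale drawing =
  fixes V :: "'a set" and E :: "'a set set" and p :: "'a \<Rightarrow> complex" and g :: "'a set \<Rightarrow> real \<Rightarrow> complex"
  assumes sg: "simple_graph V E" and dr: "plane_drawing V E p g"
begin

definition drawn :: "'a set set \<Rightarrow> complex set" where "drawn A = (\<Union>e\<in>A. path_image (g e))"

definition open_arc :: "'a set \<Rightarrow> complex set" where "open_arc e = path_image (g e) - p ` e"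

lemma edge2: "e \<in> E \<Longrightarrow> card e = 2" and edgeV: "e \<in> E \<Longrightarrow> e \<subseteq> V" and finV: "finite V"
  using sg unfolding simple_graph_def by auto

lemma finE: "finite E"
  using edgeV finV by (meson Pow_iff finite_Pow_iff finite_subset subsetI)

lemma arc_g: "e \<in> E \<Longrightarrow> arc (g e)"
  and ends: "e \<in> E \<Longrightarrow> {pathstart (g e), pathfinish (g e)} = p ` e"
  and imgV: "e \<in> E \<Longrightarrow> path_image (g e) \<inter> p ` V = p ` e"
  and img_Int: "e \<in> E \<Longrightarrow> f \<in> E \<Longrightarrow> e \<noteq> f \<Longrightarrow> path_image (g e) \<inter> path_image (g f) \<subseteq> p ` (e \<inter> f)"
  using dr unfolding plane_drawing_def by auto

lemma drawn_mono: "A \<subseteq> B \<Longrightarrow> drawn A \<subseteq> drawn B"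
  unfolding drawn_def by blast

lemma drawn_Int:
  assumes "A \<subseteq> E" "e \<in> E" "e \<notin> A"
  shows "drawn A \<inter> path_image (g e) \<subseteq> p ` (e \<inter> \<Union>A)"
proof
  fix x assume "x \<in> drawn A \<inter> path_image (g e)"
  then obtain f where f: "f \<in> A" "x \<in> path_image (g f)" "x \<in> path_image (g e)"
    unfolding drawn_def by blast
  then have "x \<in> p ` (f \<inter> e)" using img_Int[of f e] assms by blast
  then show "x \<in> p ` (e \<inter> \<Union>A)" using f by blast
qed

lemma open_arc_disjoint: "A \<subseteq> E \<Longrightarrow> e \<in> E \<Longrightarrow> e \<notin> A \<Longrightarrow> open_arc e \<inter> drawn A = {}"
  using drawn_Int[of A e] unfolding open_arc_def by blast

lemma open_arc_subset: "e \<in> A \<Longrightarrow> open_arc e \<subseteq> drawn A"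
  unfolding drawn_def open_arc_def by blast

lemma compact_drawn: "A \<subseteq> E \<Longrightarrow> compact (drawn A)"
  unfolding drawn_def using finE finite_subset arc_g by (intro compact_UN) (auto intro!: compact_arc_image)

lemma closed_drawn: "A \<subseteq> E \<Longrightarrow> closed (drawn A)"
  by (simp add: compact_drawn compact_imp_closed)

lemma open_arc_eq: "e \<in> E \<Longrightarrow> open_arc e = path_image (g e) - {pathstart (g e), pathfinish (g e)}"
  unfolding open_arc_def using ends by simp

lemma open_arc_connected: "e \<in> E \<Longrightarrow> connected (open_arc e)"
  using open_arc_eq arc_g arc_imp_simple_path connected_simple_path_endless by metis

lemma open_arc_nonempty: "e \<in> E \<Longrightarrow> open_arc e \<noteq> {}"
  using open_arc_eq[of e] simple_path_endless[of "g e"] arc_g[of e] arc_imp_simple_path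
  by (metis empty_is_image greaterThanLessThan_empty_iff not_less zero_less_one)

text \<open>Remove a leaf edge. The arc of that edge meets the rest of the drawing in at most one point,
  and neither the arc nor, by induction, the rest separates the plane, so by Janiszewski's theorem
  their union does not separate it.\<close>

lemma forest_compl:
  assumes "A \<subseteq> E" "forest A"
  shows "connected (- drawn A)"
  using assms
proof (induction "card A" arbitrary: A rule: less_induct)
  case less
  have fA: "finite A" using less.prems finE finite_subset by blast
  show ?case
  proof (cases "A = {}")
    case True
    then have "- drawn A = UNIV" by (simp add: drawn_def)
    then show ?thesis by (metis connected_UNIV)
  next
    case False
    have c2: "\<And>f. f \<in> A \<Longrightarrow> card f = 2" using edge2 less.prems(1) by blast
    have "\<exists>e v. e \<in> A \<and> v \<in> e \<and> (\<forall>f\<in>A. v \<in> f \<longrightarrow> f = e)"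
      by (rule forest_has_leaf[OF fA c2 less.prems(2) False])
    then obtain e v where e: "e \<in> A" "v \<in> e" "\<forall>f\<in>A. v \<in> f \<longrightarrow> f = e" by (elim exE conjE)
    define B where "B = A - {e}"
    have eE: "e \<in> E" and BE: "B \<subseteq> E" using e(1) less.prems(1) unfolding B_def by blast+
    have "card B < card A" unfolding B_def by (rule card_Diff1_less[OF fA e(1)])
    then have cB: "connected (- drawn B)"
      using less.hyps BE forest_subset[OF less.prems(2)] unfolding B_def by blast
    obtain r s where rs: "e = {r, s}" using edge2[OF eE] by (metis card_2_iff)
    then obtain u where u: "e = {u, v}" using e(2) by (cases "v = r") auto
    have "v \<notin> \<Union>B" using e(3) unfolding B_def by blast
    moreover have "drawn B \<inter> path_image (g e) \<subseteq> p ` (e \<inter> \<Union>B)"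
      by (rule drawn_Int[OF BE eE]) (simp add: B_def)
    ultimately have "drawn B \<inter> path_image (g e) \<subseteq> {p u}" using u by blast
    then have ci: "connected (drawn B \<inter> path_image (g e))"
      by (metis connected_empty connected_sing subset_singletonD)
    have cg: "connected (- path_image (g e))"
      using connected_arc_complement[OF arc_g[OF eE]] by simp
    have DA: "drawn A = drawn B \<union> path_image (g e)" using e(1) unfolding B_def drawn_def by blast
    show ?thesis
      unfolding connected_iff_connected_component DA
    proof (intro ballI)
      fix x y assume "x \<in> - (drawn B \<union> path_image (g e))" "y \<in> - (drawn B \<union> path_image (g e))"
      then have "connected_component (- drawn B) x y" "connected_component (- path_image (g e)) x y"
        using cB cg unfolding connected_iff_connected_component by auto
      then show "connected_component (- (drawn B \<union> path_image (g e))) x y"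
        by (rule Janiszewski[OF compact_drawn[OF BE] closed_arc_image[OF arc_g[OF eE]] ci])
    qed
  qed
qed

lemma oriented_arc:
  assumes "{y, z} \<in> E"
  shows "\<exists>h. arc h \<and> path_image h = path_image (g {y, z}) \<and> pathstart h = p y \<and> pathfinish h = p z"
proof -
  have "{pathstart (g {y, z}), pathfinish (g {y, z})} = {p y, p z}" using ends[OF assms] by simp
  then consider "pathstart (g {y, z}) = p y" "pathfinish (g {y, z}) = p z"
    | "pathstart (g {y, z}) = p z" "pathfinish (g {y, z}) = p y"
    by (metis doubleton_eq_iff)
  then show ?thesis
  proof cases
    case 1
    then show ?thesis using arc_g[OF assms] by blast
  next
    case 2
    then show ?thesis using arc_g[OF assms]
      by (intro exI[of _ "reversepath (g {y, z})"]) (simp add: arc_reversepath)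
  qed
qed

lemma gpath_arc:
  "gpath E x y Z \<Longrightarrow> Z \<noteq> {} \<Longrightarrow>
    \<exists>h. arc h \<and> path_image h = drawn Z \<and> pathstart h = p x \<and> pathfinish h = p y"
proof (induction rule: gpath.induct)
  case gp_nil
  then show ?case by simp
next
  case (gp_snoc y Z z)
  obtain h where h: "arc h" "path_image h = path_image (g {y, z})" "pathstart h = p y" "pathfinish h = p z"
    using oriented_arc[OF gp_snoc(2)] by blast
  show ?case
  proof (cases "Z = {}")
    case True
    then have "y = x" using gpath_end[OF gp_snoc(1)] by auto
    then show ?thesis using h True by (intro exI[of _ h]) (simp add: drawn_def)
  next
    case False
    then obtain k where k: "arc k" "path_image k = drawn Z" "pathstart k = p x" "pathfinish k = p y"
      using gp_snoc.IH by blast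
    have "{y, z} \<notin> Z" using gp_snoc(4) by blast
    then have "drawn Z \<inter> path_image (g {y, z}) \<subseteq> p ` ({y, z} \<inter> \<Union>Z)"
      using drawn_Int[OF gpath_sub[OF gp_snoc(1)] gp_snoc(2)] by blast
    also have "\<dots> \<subseteq> {p y}" using gp_snoc(4) by blast
    finally have "path_image k \<inter> path_image h \<subseteq> {pathstart h}" using h k by simp
    then have "arc (k +++ h)" using arc_join[OF k(1) h(1)] k h by simp
    moreover have "path_image (k +++ h) = drawn (insert {y, z} Z)"
      using path_image_join[of k h] k h unfolding drawn_def by auto
    ultimately show ?thesis using k h by (intro exI[of _ "k +++ h"]) simp
  qed
qed

text \<open>The requirement is imposed for every edge, so that each edge of the cycle can serve as the
  starting arc of the Jordan curve that the cycle draws.\<close>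

definition is_cycle :: "'a set set \<Rightarrow> bool" where
  "is_cycle Z \<longleftrightarrow> Z \<subseteq> E \<and> (\<forall>e\<in>Z. \<exists>a b. e = {a, b} \<and> a \<noteq> b \<and> gpath E b a (Z - {e}))"

lemma cycle_curve:
  assumes "is_cycle Z" "e \<in> Z"
  obtains r where "arc r" "pathstart r = pathfinish (g e)" "pathfinish r = pathstart (g e)"
    "path_image r = drawn (Z - {e})" "simple_path (g e +++ r)" "path_image (g e +++ r) = drawn Z"
proof -
  obtain a b where ab: "e = {a, b}" "a \<noteq> b" "gpath E b a (Z - {e})"
    using assms unfolding is_cycle_def by blast
  have ZE: "Z \<subseteq> E" and eE: "e \<in> E" using assms unfolding is_cycle_def by auto
  have ne: "Z - {e} \<noteq> {}" using gpath_end[OF ab(3)] ab(2) by blast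
  obtain h where h: "arc h" "path_image h = drawn (Z - {e})" "pathstart h = p b" "pathfinish h = p a"
    using gpath_arc[OF ab(3) ne] by blast
  have "{pathstart (g e), pathfinish (g e)} = {p a, p b}" using ends[OF eE] ab(1) by simp
  then consider "pathstart (g e) = p a" "pathfinish (g e) = p b"
    | "pathstart (g e) = p b" "pathfinish (g e) = p a"
    by (metis doubleton_eq_iff)
  then obtain r where r: "arc r" "path_image r = drawn (Z - {e})" "pathstart r = pathfinish (g e)"
    "pathfinish r = pathstart (g e)"
  proof cases
    case 1
    then show ?thesis using that h by metis
  next
    case 2
    then show ?thesis using that[of "reversepath h"] h by (simp add: arc_reversepath)
  qed
  have "drawn (Z - {e}) \<inter> path_image (g e) \<subseteq> p ` (e \<inter> \<Union>(Z - {e}))"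
    by (rule drawn_Int) (use ZE eE in auto)
  also have "\<dots> \<subseteq> {pathstart (g e), pathfinish (g e)}" using ends[OF eE] by blast
  finally have "path_image (g e) \<inter> path_image r \<subseteq> {pathstart (g e), pathstart r}"
    using r by auto
  then have "simple_path (g e +++ r)"
    using simple_path_join_loop[OF arc_g[OF eE] r(1)] r by simp
  moreover have "path_image (g e +++ r) = drawn Z"
    using path_image_join[of "g e" r] r assms(2) unfolding drawn_def by auto
  ultimately show ?thesis using that r by blast
qed

text \<open>The face of the drawing that contains a given point.\<close>

definition face :: "'a set set \<Rightarrow> complex \<Rightarrow> complex set" where
  "face E0 u = connected_component_set (- drawn E0) u"

definition touches :: "'a set set \<Rightarrow> complex \<Rightarrow> 'a set \<Rightarrow> bool" where
  "touches E0 u e \<longleftrightarrow> closure (face E0 u) \<inter> open_arc e \<noteq> {}"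

text \<open>If the edges on the boundary of a face formed a forest, the complement of their arcs would be
  connected. The face could then be left without crossing its boundary.\<close>

lemma touched_not_forest:
  assumes E0: "E0 \<subseteq> E" "\<not> forest E0" and u: "u \<notin> drawn E0"
  shows "\<not> forest {e \<in> E0. touches E0 u e}"
proof
  let ?T = "{e \<in> E0. touches E0 u e}" and ?C = "face E0 u"
  assume ac: "forest ?T"
  have TE: "?T \<subseteq> E" using E0 by blast
  define S where "S = drawn ?T \<union> p ` V"
  have "connected (- drawn ?T - p ` V)"
    by (rule connected_open_delete_finite)
       (use forest_compl[OF TE ac] closed_drawn[OF TE] finV in \<open>auto simp: open_Compl\<close>)
  then have cS: "connected (- S)" unfolding S_def by (simp add: Diff_eq)
  have Copen: "open ?C" unfolding face_def
    by (simp add: closed_drawn[OF E0(1)] open_Compl open_connected_component)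
  have uC: "u \<in> ?C" using u unfolding face_def by simp
  have Csub: "?C \<subseteq> - drawn E0" unfolding face_def by (rule connected_component_subset)
  have "frontier ?C \<subseteq> frontier (- drawn E0)"
    unfolding face_def by (rule frontier_of_connected_component_subset)
  also have "\<dots> \<subseteq> drawn E0" using closed_drawn[OF E0(1)]
    by (simp add: frontier_complement frontier_subset_closed)
  finally have fr: "frontier ?C \<subseteq> drawn E0" .
  have frS: "frontier ?C \<subseteq> S"
  proof
    fix x assume x: "x \<in> frontier ?C"
    then obtain e where e: "e \<in> E0" "x \<in> path_image (g e)" using fr unfolding drawn_def by blast
    show "x \<in> S"
    proof (cases "x \<in> p ` e")
      case True
      then show ?thesis using edgeV e E0 unfolding S_def by blast
    next
      case False
      then have "x \<in> open_arc e" using e unfolding open_arc_def by blast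
      then have "touches E0 u e" using x unfolding touches_def frontier_def by blast
      then show ?thesis using e unfolding S_def drawn_def by blast
    qed
  qed
  obtain f where f: "f \<in> E0" "f \<notin> ?T" using E0(2) ac by (metis (no_types, lifting) mem_Collect_eq subsetI subset_antisym)
  have fE: "f \<in> E" using f E0 by blast
  have "open_arc f \<inter> drawn ?T = {}" by (rule open_arc_disjoint[OF TE fE f(2)])
  moreover have "open_arc f \<inter> p ` V = {}" using imgV[OF fE] unfolding open_arc_def by blast
  ultimately have IfS: "open_arc f \<inter> S = {}" unfolding S_def by blast
  have If: "open_arc f \<inter> ?C = {}" using open_arc_subset[OF f(1)] Csub by blast
  obtain x where x: "x \<in> open_arc f" using open_arc_nonempty[OF fE] by blast
  have inf: "infinite ?C" using Copen uC by (metis empty_iff not_open_singleton open_empty finite_imp_not_open)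
  then have "\<not> ?C \<subseteq> p ` V" using finV finite_subset by blast
  then obtain w where w: "w \<in> ?C" "w \<notin> p ` V" by blast
  have "drawn ?T \<subseteq> drawn E0" by (rule drawn_mono) blast
  then have wS: "w \<in> - S" using w Csub unfolding S_def by blast
  have "- S \<inter> ?C \<noteq> {}" "- S - ?C \<noteq> {}" using wS w x IfS If by blast+
  then have "- S \<inter> frontier ?C \<noteq> {}" using connected_Int_frontier[OF cS] by blast
  then show False using frS by blast
qed

text \<open>The two faces and the open arc of \<open>e\<close>, which both of them touch, form a connected set.\<close>

lemma sides_connected:
  assumes E0: "E0 \<subseteq> E" "e \<in> E0" and A: "A \<subseteq> E0" "e \<notin> A"
    and u: "u \<notin> drawn E0" "u' \<notin> drawn E0" "touches E0 u e" "touches E0 u' e"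
  obtains M where "connected M" "u \<in> M" "u' \<in> M" "M \<inter> drawn A = {}"
proof -
  have eE: "e \<in> E" and AE: "A \<subseteq> E" using E0 A by auto
  have cc: "connected (face E0 v \<union> open_arc e)" if t: "touches E0 v e" for v
  proof -
    obtain x where x: "x \<in> closure (face E0 v)" "x \<in> open_arc e" using t unfolding touches_def by blast
    have "connected (face E0 v)" unfolding face_def by simp
    then have "connected (insert x (face E0 v))"
      by (rule connected_intermediate_closure) (use x closure_subset in blast)+
    then have "connected (insert x (face E0 v) \<union> open_arc e)"
      by (rule connected_Un[OF _ open_arc_connected[OF eE]]) (use x in blast)
    moreover have "insert x (face E0 v) \<union> open_arc e = face E0 v \<union> open_arc e" using x by blast
    ultimately show ?thesis by simp
  qed
  have uu: "v \<in> face E0 v" if "v \<notin> drawn E0" for v using that unfolding face_def by simp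
  have csub: "face E0 v \<inter> drawn A = {}" for v
    using connected_component_subset[of "- drawn E0" v] drawn_mono[OF A(1)] unfolding face_def by blast
  let ?M = "(face E0 u \<union> open_arc e) \<union> (face E0 u' \<union> open_arc e)"
  have "connected ?M"
    by (rule connected_Un) (use cc u open_arc_nonempty[OF eE] in auto)
  moreover have "?M \<inter> drawn A = {}" using csub open_arc_disjoint[OF AE eE A(2)] by blast
  ultimately show ?thesis using that[of ?M] uu u by blast
qed

lemma inside_conn:
  assumes "connected M" "u \<in> M" "u' \<in> M" "M \<inter> S = {}"
  shows "u \<in> inside S \<longleftrightarrow> u' \<in> inside S"
proof -
  have "connected_component (- S) u u'" unfolding connected_component_def using assms by blast
  then show ?thesis using inside_same_component connected_component_sym by metis
qed

text \<open>Two points near the same edge \<open>e\<close>, on the same side of one cycle through \<open>e\<close>, are on the same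
  side of every cycle. This is clear for cycles that avoid \<open>e\<close>. If both cycles contain \<open>e\<close>, their
  other arcs form a loop that avoids \<open>e\<close>; its winding number is the same about both points, and it
  is the difference of the winding numbers of the two cycles.\<close>

lemma same_side:
  assumes E0: "E0 \<subseteq> E" and Z: "is_cycle Z" "Z \<subseteq> E0" and Z0: "is_cycle Z0" "Z0 \<subseteq> E0" "e \<in> Z0"
    and u: "u \<notin> drawn E0" "u' \<notin> drawn E0" "touches E0 u e" "touches E0 u' e"
    and same: "u \<in> inside (drawn Z0) \<longleftrightarrow> u' \<in> inside (drawn Z0)"
  shows "u \<in> inside (drawn Z) \<longleftrightarrow> u' \<in> inside (drawn Z)"
proof (cases "e \<in> Z")
  case False
  have "e \<in> E0" using Z0 by blast
  then show ?thesis
    using sides_connected[OF E0 _ Z(2) False u] inside_conn by metis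
next
  case True
  have eE0: "e \<in> E0" using Z0 by blast
  obtain r where r: "arc r" "pathstart r = pathfinish (g e)" "pathfinish r = pathstart (g e)"
    "path_image r = drawn (Z - {e})" "simple_path (g e +++ r)" "path_image (g e +++ r) = drawn Z"
    using cycle_curve[OF Z(1) True] by blast
  obtain r0 where r0: "arc r0" "pathstart r0 = pathfinish (g e)" "pathfinish r0 = pathstart (g e)"
    "path_image r0 = drawn (Z0 - {e})" "simple_path (g e +++ r0)" "path_image (g e +++ r0) = drawn Z0"
    using cycle_curve[OF Z0(1,3)] by blast
  have pe: "path (g e)" "path r" "path r0" using arc_g r r0 E0 eE0 arc_imp_path by blast+
  have nin: "v \<notin> path_image (g e)" "v \<notin> path_image r" "v \<notin> path_image r0" if "v \<notin> drawn E0" for v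
  proof -
    show "v \<notin> path_image (g e)" using that eE0 unfolding drawn_def by blast
    have "drawn (Z - {e}) \<subseteq> drawn E0" by (rule drawn_mono) (use Z(2) in blast)
    then show "v \<notin> path_image r" using that r(4) by blast
    have "drawn (Z0 - {e}) \<subseteq> drawn E0" by (rule drawn_mono) (use Z0(2) in blast)
    then show "v \<notin> path_image r0" using that r0(4) by blast
  qed
  let ?l = "r +++ reversepath r0"
  have pl: "path ?l" "pathfinish ?l = pathstart ?l" using pe r r0 by auto
  have il: "path_image ?l = drawn ((Z \<union> Z0) - {e})"
    using path_image_join[of r "reversepath r0"] r r0 unfolding drawn_def by auto
  obtain M where M: "connected M" "u \<in> M" "u' \<in> M" "M \<inter> drawn ((Z \<union> Z0) - {e}) = {}"
    by (rule sides_connected[OF E0 eE0 _ _ u, of "(Z \<union> Z0) - {e}"]) (use Z Z0 in auto)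
  have leq: "winding_number ?l u = winding_number ?l u'"
    by (rule winding_number_eq[OF pl M(2,3,1)]) (use M(4) il in simp)
  have wl: "winding_number (g e +++ r) v = winding_number ?l v + winding_number (g e +++ r0) v" if v: "v \<notin> drawn E0" for v
    using nin[OF v] pe r r0 by (simp add: winding_number_join winding_number_reversepath)
  have side: "(v \<in> inside (drawn Z')) = (winding_number c v \<noteq> 0) \<and>
     (v \<in> inside (drawn Z') \<longrightarrow> v' \<in> inside (drawn Z') \<longrightarrow> winding_number c v = winding_number c v') \<and>
     (v \<notin> inside (drawn Z') \<longrightarrow> winding_number c v = 0)"
    if c: "simple_path c" "path_image c = drawn Z'" "pathfinish c = pathstart c" "Z' \<subseteq> E0"
      and v: "v \<notin> drawn E0" "v' \<notin> drawn E0" for c Z' v v'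
  proof -
    have vn: "v \<notin> drawn Z'" using v(1) drawn_mono[OF c(4)] by blast
    have out: "winding_number c v = 0" if "v \<notin> inside (drawn Z')"
    proof (rule winding_number_zero_in_outside)
      show "path c" using c(1) by (rule simple_path_imp_path)
      have "v \<in> outside (drawn Z')" using that vn inside_Un_outside[of "drawn Z'"] by blast
      then show "v \<in> outside (path_image c)" using c(2) by simp
    qed (rule c(3))
    obtain s where s: "s \<noteq> 0" "\<And>z. z \<in> inside (path_image c) \<Longrightarrow> winding_number c z = s"
      by (rule simple_closed_path_winding_number_inside[OF c(1)]) (metis zero_neq_one zero_neq_neg_one)+
    show ?thesis
    proof (cases "v \<in> inside (drawn Z')")
      case True
      then have "winding_number c v = s" using s(2) c(2) by simp
      moreover have "v' \<in> inside (drawn Z') \<Longrightarrow> winding_number c v' = s" using s(2) c(2) by simp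
      ultimately show ?thesis using True s(1) by simp
    next
      case False
      then show ?thesis using out by simp
    qed
  qed
  have lr: "pathfinish (g e +++ r) = pathstart (g e +++ r)" "pathfinish (g e +++ r0) = pathstart (g e +++ r0)"
    using r r0 by auto
  have "winding_number (g e +++ r0) u = winding_number (g e +++ r0) u'"
    using side[OF r0(5,6) lr(2) Z0(2) u(1,2)] side[OF r0(5,6) lr(2) Z0(2) u(2,1)] same by metis
  then have "winding_number (g e +++ r) u = winding_number (g e +++ r) u'"
    using wl[OF u(1)] wl[OF u(2)] leq by simp
  then show ?thesis
    using side[OF r(5,6) lr(1) Z(2) u(1,2)] side[OF r(5,6) lr(1) Z(2) u(2,1)] by metis
qed

text \<open>Every cycle \<open>Z f\<close> contains an edge \<open>f\<close> that lies on no other of the cycles. Close to an inner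
  point of \<open>f\<close> there are points on both sides of \<open>Z f\<close> that no other cycle separates, so each
  additional cycle produces at least one more pattern of sides.\<close>

lemma many_profiles:
  assumes E0: "E0 \<subseteq> E" and fin: "finite A"
    and Z: "\<forall>f\<in>A. is_cycle (Z f) \<and> Z f \<subseteq> E0 \<and> f \<in> Z f"
    and excl: "\<forall>f\<in>A. \<forall>h\<in>A. h \<noteq> f \<longrightarrow> f \<notin> Z h"
  shows "\<exists>U. finite U \<and> card U = card A + 1 \<and> U \<inter> drawn E0 = {} \<and>
    (\<forall>u\<in>U. \<forall>u'\<in>U. u \<noteq> u' \<longrightarrow> (\<exists>f\<in>A. (u \<in> inside (drawn (Z f))) \<noteq> (u' \<in> inside (drawn (Z f)))))"
  using fin Z excl
proof (induction A rule: finite_induct)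
  case empty
  have "bounded (drawn E0)" by (rule compact_imp_bounded[OF compact_drawn[OF E0]])
  then have "drawn E0 \<noteq> UNIV" using not_bounded_UNIV[where 'a=complex] by auto
  then obtain u where "u \<notin> drawn E0" by blast
  then show ?case by (intro exI[of _ "{u}"]) auto
next
  case (insert f A)
  have "\<exists>U. finite U \<and> card U = card A + 1 \<and> U \<inter> drawn E0 = {} \<and>
    (\<forall>u\<in>U. \<forall>u'\<in>U. u \<noteq> u' \<longrightarrow> (\<exists>f\<in>A. (u \<in> inside (drawn (Z f))) \<noteq> (u' \<in> inside (drawn (Z f)))))"
    by (rule insert.IH) (use insert.prems in simp_all)
  then obtain U where U: "finite U" "card U = card A + 1" "U \<inter> drawn E0 = {}"
    "\<forall>u\<in>U. \<forall>u'\<in>U. u \<noteq> u' \<longrightarrow> (\<exists>f\<in>A. (u \<in> inside (drawn (Z f))) \<noteq> (u' \<in> inside (drawn (Z f))))"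
    by (elim exE conjE)
  have f: "is_cycle (Z f)" "Z f \<subseteq> E0" "f \<in> Z f" using insert.prems by auto
  have fE: "f \<in> E" using f E0 by blast
  obtain x where x: "x \<in> open_arc f" using open_arc_nonempty[OF fE] by blast
  have sub: "E0 - {f} \<subseteq> E" using E0 by blast
  have "x \<notin> drawn (E0 - {f})" using open_arc_disjoint[OF sub fE] x by blast
  then obtain r where r: "r > 0" "ball x r \<inter> drawn (E0 - {f}) = {}"
    using closed_drawn[OF sub] by (metis Compl_iff disjoint_eq_subset_Compl open_Compl open_contains_ball)
  obtain k where k: "pathstart k = pathfinish (g f)" "pathfinish k = pathstart (g f)"
    "simple_path (g f +++ k)" "path_image (g f +++ k) = drawn (Z f)"
    using cycle_curve[OF f(1,3)] by metis
  have xZ: "x \<in> drawn (Z f)" using open_arc_subset f(3) x by blast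
  have "frontier (inside (drawn (Z f))) = drawn (Z f)" "frontier (outside (drawn (Z f))) = drawn (Z f)"
    using Jordan_inside_outside[OF k(3)] k by auto
  then have cl: "x \<in> closure (inside (drawn (Z f)))" "x \<in> closure (outside (drawn (Z f)))"
    using xZ unfolding frontier_def by auto
  obtain u1 where u1: "u1 \<in> inside (drawn (Z f))" "u1 \<in> ball x r"
    using cl(1) r(1) by (metis closure_approachable dist_commute mem_ball)
  obtain u2 where u2: "u2 \<in> outside (drawn (Z f))" "u2 \<in> ball x r"
    using cl(2) r(1) by (metis closure_approachable dist_commute mem_ball)
  have u2n: "u2 \<notin> inside (drawn (Z f))" using u2 inside_Int_outside by blast
  have DE: "drawn E0 \<subseteq> drawn (E0 - {f}) \<union> drawn (Z f)" using f(3) unfolding drawn_def by blast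
  have off: "u1 \<notin> drawn E0" "u2 \<notin> drawn E0"
    using DE r(2) u1 u2 inside_no_overlap[of "drawn (Z f)"] outside_no_overlap[of "drawn (Z f)"] by blast+
  have same: "(u1 \<in> inside (drawn (Z h))) = (u2 \<in> inside (drawn (Z h)))" if h: "h \<in> A" for h
  proof -
    have "h \<noteq> f" using h insert.hyps by blast
    then have "f \<notin> Z h" using insert.prems(2) h by blast
    moreover have "Z h \<subseteq> E0" using insert.prems(1) h by blast
    ultimately have "drawn (Z h) \<subseteq> drawn (E0 - {f})" by (intro drawn_mono) blast
    then have "ball x r \<inter> drawn (Z h) = {}" using r(2) by blast
    then show ?thesis using inside_conn[OF _ u1(2) u2(2)] by simp
  qed
  let ?diff = "\<lambda>B u u'. \<exists>f\<in>B. (u \<in> inside (drawn (Z f))) \<noteq> (u' \<in> inside (drawn (Z f)))"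
  have d12: "u1 \<noteq> u2" using u1 u2n by blast
  have cA: "card (insert f A) = card A + 1" using insert.hyps by simp
  show ?case
  \<comment> \<open>If an old point has the same pattern as the two new points, it is replaced by them;
     otherwise one new point is added.\<close>
  proof (cases "\<exists>u\<in>U. \<not> ?diff A u u1")
    case True
    then obtain u where u: "u \<in> U" "\<not> ?diff A u u1" by blast
    have dw: "?diff A w u1" "?diff A w u2" if "w \<in> U - {u}" for w
    proof -
      have "?diff A w u" using U(4) that u(1) by blast
      then show "?diff A w u1" using u(2) by blast
      then show "?diff A w u2" using same by blast
    qed
    let ?U = "insert u1 (insert u2 (U - {u}))"
    have "u1 \<notin> U - {u}" "u2 \<notin> U - {u}" using dw by blast+
    then have "card ?U = card (U - {u}) + 2" using U(1) d12 by simp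
    also have "\<dots> = card A + 2" using U(1,2) u(1) by simp
    finally have c: "card ?U = card (insert f A) + 1" using cA by simp
    have "?diff (insert f A) w w'" if "w \<in> ?U" "w' \<in> ?U" "w \<noteq> w'" for w w'
    proof -
      consider "w \<in> U - {u}" "w' \<in> U - {u}" | "w \<in> U - {u}" "w' \<in> {u1, u2}"
        | "w \<in> {u1, u2}" "w' \<in> U - {u}" | "w \<in> {u1, u2}" "w' \<in> {u1, u2}" using \<open>w \<in> ?U\<close> \<open>w' \<in> ?U\<close> by blast
      then show ?thesis
      proof cases
        case 1 then show ?thesis using U(4) that(3) by blast
      next
        case 2 then show ?thesis using dw by blast
      next
        case 3 then show ?thesis using dw by blast
      next
        case 4 then show ?thesis using that(3) u1 u2n by blast
      qed
    qed
    then have dd: "\<forall>w\<in>?U. \<forall>w'\<in>?U. w \<noteq> w' \<longrightarrow> ?diff (insert f A) w w'" by blast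
    have "finite ?U" using U(1) by simp
    moreover have "?U \<inter> drawn E0 = {}" using U(3) off by blast
    ultimately show ?thesis using c dd by (intro exI[of _ ?U] conjI)
  next
    case False
    let ?U = "insert u1 U"
    have "u1 \<notin> U" using False by blast
    then have c: "card ?U = card (insert f A) + 1" using U(1,2) cA by simp
    have "?diff (insert f A) w w'" if "w \<in> ?U" "w' \<in> ?U" "w \<noteq> w'" for w w'
    proof -
      have n: "?diff A u u1" if "u \<in> U" for u using False that by blast
      consider "w \<in> U" "w' \<in> U" | "w \<in> U" "w' = u1" | "w = u1" "w' \<in> U" using \<open>w \<in> ?U\<close> \<open>w' \<in> ?U\<close> \<open>w \<noteq> w'\<close> by blast
      then show ?thesis
      proof cases
        case 1 then show ?thesis using U(4) \<open>w \<noteq> w'\<close> by blast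
      next
        case 2 then show ?thesis using n by blast
      next
        case 3 then show ?thesis using n by blast
      qed
    qed
    then have dd: "\<forall>w\<in>?U. \<forall>w'\<in>?U. w \<noteq> w' \<longrightarrow> ?diff (insert f A) w w'" by blast
    have "finite ?U" using U(1) by simp
    moreover have "?U \<inter> drawn E0 = {}" using U(3) off by blast
    ultimately show ?thesis using c dd by (intro exI[of _ ?U] conjI)
  qed
qed

end

context drawing
begin

text \<open>Euler's inequality with weights. For a spanning forest each further edge closes a cycle, and
  these cycles distinguish at least one point more than there are further edges. Around each of these
  points the touched edges are not a forest, hence contain at least \<open>k\<close> edges of \<open>L\<close>; but an
  edge is touched from at most two sides. Counting the incidences in both ways gives the bound. With
  \<open>L\<close> the whole edge set and \<open>k = 3\<close> this is the familiar bound on the number of edges; the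
  freedom to choose \<open>L\<close> is what makes contractions available.\<close>

theorem euler_weighted:
  assumes E0: "E0 \<subseteq> E" "\<not> forest E0" and L: "L \<subseteq> E0"
    and girth: "\<And>A. A \<subseteq> E0 \<Longrightarrow> A \<noteq> {} \<Longrightarrow> leafless A \<Longrightarrow> k \<le> card (A \<inter> L)"
  shows "k * (card E0 + 2) \<le> 2 * card L + k * card (\<Union>E0)"
proof -
  have fE0: "finite E0" using E0(1) finE finite_subset by blast
  have c2: "\<And>e. e \<in> E0 \<Longrightarrow> card e = 2" using E0(1) edge2 by blast
  have fL: "finite L" using L fE0 finite_subset by blast
  define Q where "Q F \<longleftrightarrow> F \<subseteq> E0 \<and> forest F" for F
  have "Q {}" unfolding Q_def forest_def by simp
  moreover have "\<forall>F. Q F \<longrightarrow> card F \<le> card E0" unfolding Q_def using fE0 card_mono by blast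
  ultimately have "\<exists>F0. Q F0 \<and> (\<forall>F. Q F \<longrightarrow> card F \<le> card F0)"
    by (intro ex_has_greatest_nat[of Q "{}" card "Suc (card E0)"]) (simp_all add: less_Suc_eq_le)
  then obtain F0 where F0: "Q F0" and mx: "\<forall>F. Q F \<longrightarrow> card F \<le> card F0" by (elim exE conjE)
  have F0s: "F0 \<subseteq> E0" "forest F0" using F0 unfolding Q_def by auto
  have fF0: "finite F0" using F0s fE0 finite_subset by blast
  let ?A = "E0 - F0"
  have "\<exists>Z. is_cycle Z \<and> Z \<subseteq> insert f F0 \<and> f \<in> Z" if f: "f \<in> ?A" for f
  proof -
    have fE: "f \<in> E" using f E0 by blast
    obtain x y where xy: "f = {y, x}" "x \<noteq> y" using edge2[OF fE] by (metis card_2_iff)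
    have "\<not> forest (insert f F0)"
    proof
      assume "forest (insert f F0)"
      then have "Q (insert f F0)" using f F0s unfolding Q_def by blast
      then have "card (insert f F0) \<le> card F0" using mx by blast
      then show False using f fF0 by simp
    qed
    then have "(x, y) \<in> {(u, v). {u, v} \<in> F0}\<^sup>*"
      using forest_insert[OF fF0 _ F0s(2) xy(2)] c2 F0s(1) xy(1) by (metis insert_commute subsetD)
    then obtain P where P: "gpath F0 x y P" using rtrancl_gpath by metis
    have PF0: "P \<subseteq> F0" by (rule gpath_sub[OF P])
    have PE: "gpath E x y P" by (rule gpath_mono[OF P]) (use F0s E0 in blast)
    have fP: "{y, x} \<notin> P" using PF0 f xy(1) by blast
    have "is_cycle (insert {y, x} P)"
      unfolding is_cycle_def
    proof (intro conjI ballI)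
      show "insert {y, x} P \<subseteq> E" using gpath_sub[OF PE] fE xy(1) by simp
      fix e assume e: "e \<in> insert {y, x} P"
      show "\<exists>a b. e = {a, b} \<and> a \<noteq> b \<and> gpath E b a (insert {y, x} P - {e})"
        by (rule gpath_cycle[OF PE _ fP xy(2) e]) (use fE xy in auto)
    qed
    then show ?thesis using PF0 xy(1) by (intro exI[of _ "insert {y, x} P"]) auto
  qed
  then have "\<forall>f\<in>?A. \<exists>Z. is_cycle Z \<and> Z \<subseteq> insert f F0 \<and> f \<in> Z" by blast
  then obtain Z where Z: "\<forall>f\<in>?A. is_cycle (Z f) \<and> Z f \<subseteq> insert f F0 \<and> f \<in> Z f"
    by (rule bchoice[THEN exE])
  have Z1: "\<forall>f\<in>?A. is_cycle (Z f) \<and> Z f \<subseteq> E0 \<and> f \<in> Z f" using Z F0s by blast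
  have Z2: "\<forall>f\<in>?A. \<forall>h\<in>?A. h \<noteq> f \<longrightarrow> f \<notin> Z h" using Z by blast
  have fA: "finite ?A" using fE0 by blast
  obtain U where U: "finite U" "card U = card ?A + 1" "U \<inter> drawn E0 = {}"
    "\<forall>u\<in>U. \<forall>u'\<in>U. u \<noteq> u' \<longrightarrow> (\<exists>f\<in>?A. (u \<in> inside (drawn (Z f))) \<noteq> (u' \<in> inside (drawn (Z f))))"
    using many_profiles[OF E0(1) fA Z1 Z2] by (elim exE conjE)
  \<comment> \<open>The edges around a point: at least \<open>k\<close> of them are in \<open>L\<close>.\<close>
  have lower: "k \<le> card {e \<in> L. touches E0 u e}" if u: "u \<in> U" for u
  proof -
    let ?T = "{e \<in> E0. touches E0 u e}"
    have "u \<notin> drawn E0" using u U(3) by blast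
    then have na: "\<not> forest ?T" by (rule touched_not_forest[OF E0])
    have "\<exists>B. B \<subseteq> ?T \<and> B \<noteq> {} \<and> leafless B"
      by (rule not_forest_leafless[OF _ _ na]) (use fE0 c2 in auto)
    then obtain B where B: "B \<subseteq> ?T" "B \<noteq> {}" "leafless B" by (elim exE conjE)
    have "B \<subseteq> E0" using B(1) by blast
    then have "k \<le> card (B \<inter> L)" using girth B by blast
    also have "\<dots> \<le> card {e \<in> L. touches E0 u e}"
      by (rule card_mono) (use fL B(1) in auto)
    finally show ?thesis .
  qed
  \<comment> \<open>The points around an edge: of three points two would be on the same side of the cycles.\<close>
  have upper: "card {u \<in> U. touches E0 u e} \<le> 2" if e: "e \<in> L" for e
  proof (rule ccontr)
    assume "\<not> card {u \<in> U. touches E0 u e} \<le> 2"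
    then have "3 \<le> card {u \<in> U. touches E0 u e}" by simp
    then obtain S where S: "S \<subseteq> {u \<in> U. touches E0 u e}" "card S = 3"
      using obtain_subset_with_card_n by metis
    then obtain u1 u2 u3 where uu: "S = {u1, u2, u3}" "u1 \<noteq> u2" "u1 \<noteq> u3" "u2 \<noteq> u3"
      using card_3_iff by metis
    have inU: "u1 \<in> U" "u2 \<in> U" "u3 \<in> U" and t: "touches E0 u1 e" "touches E0 u2 e" "touches E0 u3 e"
      using S uu by auto
    have off: "u1 \<notin> drawn E0" "u2 \<notin> drawn E0" "u3 \<notin> drawn E0" using inU U(3) by auto
    have eE0: "e \<in> E0" using e L by blast
    have key: "False" if v: "v \<in> U" "w \<in> U" "v \<noteq> w" "touches E0 v e" "touches E0 w e"
      and s: "\<forall>f\<in>?A. e \<in> Z f \<longrightarrow> (\<exists>h\<in>?A. e \<in> Z h \<and> (v \<in> inside (drawn (Z h))) = (w \<in> inside (drawn (Z h))))" for v w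
    proof -
      have o: "v \<notin> drawn E0" "w \<notin> drawn E0" using v U(3) by auto
      obtain f where f: "f \<in> ?A" "(v \<in> inside (drawn (Z f))) \<noteq> (w \<in> inside (drawn (Z f)))"
        using U(4) v(1-3) by blast
      have Zf: "is_cycle (Z f)" "Z f \<subseteq> E0" using Z1 f by auto
      show False
      proof (cases "e \<in> Z f")
        case True
        then obtain h where h: "h \<in> ?A" "e \<in> Z h" "(v \<in> inside (drawn (Z h))) = (w \<in> inside (drawn (Z h)))"
          using s f by blast
        have Zh: "is_cycle (Z h)" "Z h \<subseteq> E0" using Z1 h by auto
        show False using same_side[OF E0(1) Zf Zh h(2) o v(4,5) h(3)] f(2) by blast
      next
        case False
        obtain M where "connected M" "v \<in> M" "w \<in> M" "M \<inter> drawn (Z f) = {}"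
          by (rule sides_connected[OF E0(1) eE0 Zf(2) False o v(4,5)])
        then show False using inside_conn f(2) by blast
      qed
    qed
    show False
    proof (cases "\<exists>f\<in>?A. e \<in> Z f")
      case False
      then show False using key[OF inU(1,2) uu(2) t(1,2)] by blast
    next
      case True
      then obtain h where h: "h \<in> ?A" "e \<in> Z h" by blast
      let ?s = "\<lambda>u. u \<in> inside (drawn (Z h))"
      consider "?s u1 = ?s u2" | "?s u1 = ?s u3" | "?s u2 = ?s u3" by blast
      then show False
      proof cases
        case 1 then show False using key[OF inU(1,2) uu(2) t(1,2)] h by blast
      next
        case 2 then show False using key[OF inU(1,3) uu(3) t(1,3)] h by blast
      next
        case 3 then show False using key[OF inU(2,3) uu(4) t(2,3)] h by blast
      qed
    qed
  qed
  have "k * card U = (\<Sum>u\<in>U. k)" by simp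
  also have "\<dots> \<le> (\<Sum>u\<in>U. card {e \<in> L. touches E0 u e})" by (rule sum_mono) (rule lower)
  also have "\<dots> = (\<Sum>u\<in>U. \<Sum>e\<in>L. if touches E0 u e then 1 else 0)"
    using fL by (simp add: sum_if_card)
  also have "\<dots> = (\<Sum>e\<in>L. \<Sum>u\<in>U. if touches E0 u e then 1 else 0)" by (rule sum.swap)
  also have "\<dots> = (\<Sum>e\<in>L. card {u \<in> U. touches E0 u e})"
    using U(1) by (simp add: sum_if_card)
  also have "\<dots> \<le> (\<Sum>e\<in>L. 2)" by (rule sum_mono) (rule upper)
  also have "\<dots> = 2 * card L" by simp
  finally have kU: "k * (card ?A + 1) \<le> 2 * card L" using U(2) by simp
  have "card F0 + 1 \<le> card (\<Union>E0)"
  proof (cases "F0 = {}")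
    case True
    have "E0 \<noteq> {}" using E0(2) unfolding forest_def by blast
    then obtain e where e: "e \<in> E0" by blast
    then have "card e \<le> card (\<Union>E0)"
      using finite_vertices[OF fE0 c2] by (intro card_mono) auto
    then show ?thesis using True c2[OF e] by simp
  next
    case False
    then have "card F0 < card (\<Union>F0)" using F0s(2) unfolding forest_def by blast
    also have "\<dots> \<le> card (\<Union>E0)"
      using finite_vertices[OF fE0 c2] F0s(1) by (intro card_mono) auto
    finally show ?thesis by simp
  qed
  moreover have "card ?A + card F0 = card E0"
    using F0s(1) fF0 fE0 by (metis card_Diff_subset card_mono le_add_diff_inverse2)
  ultimately have "card E0 + 2 \<le> (card ?A + 1) + card (\<Union>E0)" by linarith
  then have "k * (card E0 + 2) \<le> k * ((card ?A + 1) + card (\<Union>E0))" by (rule mult_le_mono2)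
  also have "\<dots> = k * (card ?A + 1) + k * card (\<Union>E0)" by (simp add: algebra_simps)
  also have "\<dots> \<le> 2 * card L + k * card (\<Union>E0)" using kU by simp
  finally show ?thesis .
qed

end

section \<open>Edge bounds for planar graphs and their star contractions\<close>

lemma leafless_card3:
  assumes "finite A" "\<And>e. e \<in> A \<Longrightarrow> card e = 2" "A \<noteq> {}" "leafless A"
  shows "3 \<le> card A"
proof -
  obtain e where e: "e \<in> A" using assms(3) by blast
  obtain u v where uv: "e = {u, v}" "u \<noteq> v" using assms(2)[OF e] by (meson card_2_iff)
  obtain f where f: "f \<in> A" "f \<noteq> e" "u \<in> f" using assms(4) e uv(1) unfolding leafless_def by blast
  obtain h where h: "h \<in> A" "h \<noteq> e" "v \<in> h" using assms(4) e uv(1) unfolding leafless_def by blast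
  have "f \<noteq> h"
  proof
    assume "f = h"
    then have "e \<subseteq> f" using f h uv by blast
    moreover have "finite f" using assms(2)[OF f(1)] by (metis card.infinite zero_neq_numeral)
    ultimately have "e = f" using assms(2)[OF e] assms(2)[OF f(1)] by (metis card_subset_eq)
    then show False using f(2) by simp
  qed
  then have "card {e, f, h} = 3" using f(2) h(2) by auto
  moreover have "{e, f, h} \<subseteq> A" using e f h by blast
  ultimately show ?thesis using card_mono[OF assms(1), of "{e, f, h}"] by simp
qed

lemma leafless_bipartite_card4:
  assumes "finite A" "A \<noteq> {}" "leafless A" and PQ: "P \<inter> Q = {}"
    and bip: "\<And>e. e \<in> A \<Longrightarrow> \<exists>a\<in>P. \<exists>b\<in>Q. e = {a, b}"
  shows "4 \<le> card A"
proof -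
  obtain e where e: "e \<in> A" using assms(2) by blast
  obtain a b where ab: "a \<in> P" "b \<in> Q" "e = {a, b}" using bip[OF e] by blast
  obtain f where f: "f \<in> A" "f \<noteq> e" "a \<in> f" using assms(3) e ab(3) unfolding leafless_def by blast
  obtain h where h: "h \<in> A" "h \<noteq> e" "b \<in> h" using assms(3) e ab(3) unfolding leafless_def by blast
  obtain b' where b': "b' \<in> Q" "f = {a, b'}" using bip[OF f(1)] f(3) ab(1) PQ by blast
  obtain a' where a': "a' \<in> P" "h = {a', b}" using bip[OF h(1)] h(3) ab(2) PQ by blast
  obtain k where k: "k \<in> A" "k \<noteq> f" "b' \<in> k" using assms(3) f(1) b'(2) unfolding leafless_def by blast
  obtain a'' where a'': "a'' \<in> P" "k = {a'', b'}" using bip[OF k(1)] k(3) b'(1) PQ by blast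
  have n: "b' \<noteq> b" "a' \<noteq> a" "a'' \<noteq> a" using f(2) h(2) k(2) ab b' a' a'' by auto
  have x: "a \<noteq> b" "a \<noteq> b'" "a' \<noteq> b" "a' \<noteq> b'" "a'' \<noteq> b" "a'' \<noteq> b'" using ab b' a' a'' PQ by auto
  have "card {e, f, h, k} = 4"
    using n x unfolding ab(3) b'(2) a'(2) a''(2) by (auto simp: doubleton_eq_iff card_insert_if)
  moreover have "{e, f, h, k} \<subseteq> A" using e f h k by blast
  ultimately show ?thesis using card_mono[OF assms(1), of "{e, f, h, k}"] by simp
qed

locale planar_graph =
  fixes V :: "'a set" and E :: "'a set set"
  assumes sg: "simple_graph V E" and pl: "planar V E"
begin

lemma finV: "finite V"
  using sg unfolding simple_graph_def by blast

lemma edgeV: "e \<in> E \<Longrightarrow> e \<subseteq> V" and edge2: "e \<in> E \<Longrightarrow> card e = 2"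
  using sg unfolding simple_graph_def by auto

lemma finE: "finite E"
proof -
  have "E \<subseteq> Pow V" using edgeV by blast
  then show ?thesis using finV finite_subset by blast
qed

text \<open>Contracting stars of a planar graph gives a planar graph. Instead of drawing the contracted
  graph, one link edge is chosen for every pair \<open>q\<close> of adjacent clusters, and the weighted Euler
  inequality is applied to the star edges together with the links, with \<open>L\<close> the set of links. The
  star edges cancel from the count because each of them brings one new vertex. A leafless subset of
  the stars and links projects to a leafless set of pairs, so \<open>k\<close> may be taken from the contracted
  graph.\<close>

theorem star_contraction_bound:
  assumes S: "S \<subseteq> V"
    and r: "\<And>x. x \<in> S \<Longrightarrow> r x \<in> S \<and> r (r x) = r x \<and> (r x = x \<or> {x, r x} \<in> E)"
    and P: "\<And>q. q \<in> P \<Longrightarrow> card q = 2 \<and> (\<exists>l\<in>E. l \<subseteq> S \<and> r ` l = q)"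
    and girth: "\<And>A. A \<subseteq> P \<Longrightarrow> A \<noteq> {} \<Longrightarrow> leafless A \<Longrightarrow> k \<le> card A"
  shows "P = {} \<or> card P < card (r ` S) \<or> k * (card P + 2) \<le> 2 * card P + k * card (r ` S)"
proof -
  have fS: "finite S" using S finV finite_subset by blast
  have "\<forall>q\<in>P. \<exists>l. l \<in> E \<and> l \<subseteq> S \<and> r ` l = q" using P by blast
  then obtain lk where lk: "\<forall>q\<in>P. lk q \<in> E \<and> lk q \<subseteq> S \<and> r ` lk q = q"
    by (rule bchoice[THEN exE])
  have lkI: "lk q \<in> E" "lk q \<subseteq> S" "r ` lk q = q" if "q \<in> P" for q using lk that by auto
  have injl: "inj_on lk P" by (rule inj_onI) (metis lkI(3))
  define T where "T = (\<lambda>x. {x, r x}) ` {x \<in> S. r x \<noteq> x}"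
  define L where "L = lk ` P"
  have "P \<subseteq> (`) r ` E" using lkI by (metis image_eqI subsetI)
  then have fP: "finite P" using finE by (meson finite_imageI finite_subset)
  have fT: "finite T" and fL: "finite L" using fS fP unfolding T_def L_def by auto
  have TE: "T \<subseteq> E"
  proof
    fix e assume "e \<in> T"
    then obtain x where "x \<in> S" "r x \<noteq> x" "e = {x, r x}" unfolding T_def by blast
    then show "e \<in> E" using r[of x] by blast
  qed
  have LE: "L \<subseteq> E" using lkI(1) unfolding L_def by blast
  have injT: "inj_on (\<lambda>x. {x, r x}) {x \<in> S. r x \<noteq> x}"
  proof (rule inj_onI, rule ccontr)
    fix x y assume xy: "x \<in> {x \<in> S. r x \<noteq> x}" "y \<in> {x \<in> S. r x \<noteq> x}" "{x, r x} = {y, r y}" "x \<noteq> y"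
    then have "x = r y" by (auto simp: doubleton_eq_iff)
    then show False using xy r[of y] by auto
  qed
  have TL: "T \<inter> L = {}"
  proof -
    have False if q: "q \<in> P" and x: "x \<in> S" "lk q = {x, r x}" for q x
    proof -
      have "q = {r x}" using lkI(3)[OF q] r[OF x(1)] unfolding x(2) by simp
      then show False using P[OF q] by simp
    qed
    then show ?thesis unfolding T_def L_def by blast
  qed
  have cL: "card L = card P" unfolding L_def by (rule card_image[OF injl])
  have cT: "card T = card {x \<in> S. r x \<noteq> x}" unfolding T_def by (rule card_image[OF injT])
  have rS: "r ` S = {x \<in> S. r x = x}"
  proof
    show "r ` S \<subseteq> {x \<in> S. r x = x}" using r by auto
    show "{x \<in> S. r x = x} \<subseteq> r ` S" by (auto intro: image_eqI[where x=x for x, OF sym])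
  qed
  have "card S = card {x \<in> S. r x = x} + card {x \<in> S. r x \<noteq> x}"
  proof -
    have "S = {x \<in> S. r x = x} \<union> {x \<in> S. r x \<noteq> x}" by blast
    moreover have "card ({x \<in> S. r x = x} \<union> {x \<in> S. r x \<noteq> x}) = card {x \<in> S. r x = x} + card {x \<in> S. r x \<noteq> x}"
      by (rule card_Un_disjoint) (use fS in auto)
    ultimately show ?thesis by simp
  qed
  then have cS: "card S = card (r ` S) + card T" using cT rS by simp
  define E0 where "E0 = T \<union> L"
  have E0: "E0 \<subseteq> E" using TE LE unfolding E0_def by blast
  have cE0: "card E0 = card T + card P"
    unfolding E0_def using card_Un_disjoint[OF fT fL TL] cL by simp
  have "\<Union>E0 \<subseteq> S"
  proof -
    have "\<Union>T \<subseteq> S" using r unfolding T_def by auto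
    moreover have "\<Union>L \<subseteq> S" using lkI(2) unfolding L_def by blast
    ultimately show ?thesis unfolding E0_def by blast
  qed
  then have cU: "card (\<Union>E0) \<le> card S" by (rule card_mono[OF fS])
  show ?thesis
  proof (cases "forest E0")
    case True
    show ?thesis
    proof (cases "E0 = {}")
      case True
      then have "P = {}" unfolding E0_def L_def by blast
      then show ?thesis by blast
    next
      case False
      then have "card E0 < card (\<Union>E0)" using True unfolding forest_def by blast
      then show ?thesis using cE0 cU cS by linarith
    qed
  next
    case False
    have LE0: "L \<subseteq> E0" unfolding E0_def by blast
    have girth': "k \<le> card (A \<inter> L)" if A: "A \<subseteq> E0" "A \<noteq> {}" "leafless A" for A
    proof -
      define A' where "A' = {q \<in> P. lk q \<in> A}"
      have nx: "\<exists>f\<in>A. f \<noteq> e \<and> v \<in> f" if "e \<in> A" "v \<in> e" for e v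
        using A(3) that unfolding leafless_def by blast
      have dec: "(\<exists>z\<in>S. r z \<noteq> z \<and> f = {z, r z}) \<or> (\<exists>q\<in>A'. f = lk q)" if "f \<in> A" for f
        using that A(1) unfolding E0_def T_def L_def A'_def by blast
      \<comment> \<open>An outer vertex of a star lies on only one star edge, so it is left through a link.\<close>
      have star: "\<exists>q\<in>A'. x \<in> lk q" if x: "x \<in> S" "r x \<noteq> x" "{x, r x} \<in> A" for x
      proof -
        obtain f where f: "f \<in> A" "f \<noteq> {x, r x}" "x \<in> f" using nx[OF x(3)] by blast
        from dec[OF f(1)] show ?thesis
        proof
          assume "\<exists>z\<in>S. r z \<noteq> z \<and> f = {z, r z}"
          then obtain z where z: "z \<in> S" "r z \<noteq> z" "f = {z, r z}" by blast
          then have "x = r z" using f by blast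
          then show ?thesis using r[OF z(1)] x(2) by simp
        next
          assume "\<exists>q\<in>A'. f = lk q"
          then show ?thesis using f(3) by blast
        qed
      qed
      have ne: "A' \<noteq> {}"
      proof -
        obtain e where e: "e \<in> A" using A(2) by blast
        from dec[OF e] show ?thesis using star e by blast
      qed
      have lf: "leafless A'"
        unfolding leafless_def
      proof (intro ballI)
        fix q w assume q: "q \<in> A'" and w: "w \<in> q"
        have qP: "q \<in> P" and lA: "lk q \<in> A" using q unfolding A'_def by auto
        have "w \<in> r ` lk q" using w by (simp only: lkI(3)[OF qP])
        then obtain u where u: "u \<in> lk q" "r u = w" by (elim imageE) simp
        have two: "card (lk q) = 2" using edge2 lkI(1)[OF qP] by blast
        have other: "z \<notin> lk q" if "z \<noteq> u" "r z = w" for z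
        proof
          assume "z \<in> lk q"
          moreover obtain a b where "lk q = {a, b}" using two by (meson card_2_iff)
          ultimately have "lk q = {u, z}" using u(1) that(1) by auto
          then have "q = {w}" using lkI(3)[OF qP] u(2) that(2) by auto
          then show False using P[OF qP] by simp
        qed
        have uS: "u \<in> S" using u(1) lkI(2)[OF qP] by blast
        have wS: "w \<in> S" "r w = w" using r[OF uS] u(2) by auto
        have fin: "\<exists>q'\<in>A'. q' \<noteq> q \<and> w \<in> q'" if "q' \<in> A'" "z \<in> lk q'" "r z = w" "lk q' \<noteq> lk q" for q' z
        proof -
          have "q' \<in> P" using that(1) unfolding A'_def by blast
          moreover have "r z \<in> r ` lk q'" using that(2) by (rule imageI)
          ultimately have "w \<in> q'" using that(3) by (simp add: lkI(3))
          then show ?thesis using that(1,4) by (intro bexI[of _ q']) auto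
        qed
        have finz: "\<exists>q'\<in>A'. q' \<noteq> q \<and> w \<in> q'" if z: "z \<in> S" "r z \<noteq> z" "{z, r z} \<in> A" "r z = w" "z \<noteq> u" for z
        proof -
          obtain q' where q': "q' \<in> A'" "z \<in> lk q'" using star[OF z(1-3)] by blast
          have "lk q' \<noteq> lk q" using q' other[OF z(5,4)] by auto
          then show ?thesis using fin[OF q' z(4)] by blast
        qed
        obtain f where f: "f \<in> A" "f \<noteq> lk q" "u \<in> f" using nx[OF lA u(1)] by blast
        from dec[OF f(1)] show "\<exists>f\<in>A'. f \<noteq> q \<and> w \<in> f"
        proof
          assume "\<exists>q'\<in>A'. f = lk q'"
          then show ?thesis using fin f u(2) by blast
        next
          assume "\<exists>z\<in>S. r z \<noteq> z \<and> f = {z, r z}"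
          then obtain z where z: "z \<in> S" "r z \<noteq> z" "f = {z, r z}" by blast
          have rz: "r z = w" using f(3) z(3) u(2) r[OF z(1)] by auto
          show ?thesis
          proof (cases "z = u")
            case False
            then show ?thesis using finz z f(1) rz by blast
          next
            case True
            have "w \<in> f" using z rz by simp
            then obtain f' where f': "f' \<in> A" "f' \<noteq> f" "w \<in> f'" using nx[OF f(1)] by blast
            from dec[OF f'(1)] show ?thesis
            proof
              assume "\<exists>q'\<in>A'. f' = lk q'"
              then obtain q' where q': "q' \<in> A'" "f' = lk q'" by blast
              have "w \<noteq> u" using True z(2) rz by simp
              then have "w \<notin> lk q" using other wS(2) by blast
              then have "lk q' \<noteq> lk q" using q'(2) f'(3) by auto
              then show ?thesis using fin[OF q'(1) _ wS(2)] q'(2) f'(3) by blast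
            next
              assume "\<exists>z\<in>S. r z \<noteq> z \<and> f' = {z, r z}"
              then obtain z' where z': "z' \<in> S" "r z' \<noteq> z'" "f' = {z', r z'}" by blast
              have "w \<noteq> z'" using wS(2) z'(2) by auto
              then have rz': "r z' = w" using f'(3) z'(3) by simp
              have "z' \<noteq> u" using f'(2) z'(3) rz' z(3) rz True by auto
              then show ?thesis using finz z' f'(1) rz' by blast
            qed
          qed
        qed
      qed
      have A'P: "A' \<subseteq> P" unfolding A'_def by blast
      have "k \<le> card A'" by (rule girth[OF A'P ne lf])
      also have "\<dots> = card (lk ` A')"
        by (rule card_image[symmetric]) (rule inj_on_subset[OF injl A'P])
      also have "\<dots> \<le> card (A \<inter> L)"
        by (rule card_mono) (use fL in \<open>auto simp: A'_def L_def\<close>)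
      finally show ?thesis .
    qed
    obtain p g where "plane_drawing V E p g" using pl unfolding planar_def by blast
    then interpret d: drawing V E p g using sg by unfold_locales
    have "k * (card E0 + 2) \<le> 2 * card L + k * card (\<Union>E0)"
      by (rule d.euler_weighted[OF E0 False LE0 girth'])
    moreover have "k * card (\<Union>E0) \<le> k * (card (r ` S) + card T)"
      by (rule mult_le_mono2) (use cU cS in simp)
    ultimately have "k * (card T + card P + 2) \<le> 2 * card P + k * (card (r ` S) + card T)"
      unfolding cE0 cL by linarith
    then show ?thesis by (simp add: algebra_simps)
  qed
qed

text \<open>A leafless set of edges contains at least three edges.\<close>

corollary contraction_edges:
  assumes S: "S \<subseteq> V"
    and r: "\<And>x. x \<in> S \<Longrightarrow> r x \<in> S \<and> r (r x) = r x \<and> (r x = x \<or> {x, r x} \<in> E)"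
    and P: "\<And>q. q \<in> P \<Longrightarrow> card q = 2 \<and> (\<exists>l\<in>E. l \<subseteq> S \<and> r ` l = q)"
  shows "card (r ` S) \<ge> 1 \<Longrightarrow> card P + 3 \<le> 3 * card (r ` S)"
    and "card (r ` S) \<ge> 3 \<Longrightarrow> card P + 6 \<le> 3 * card (r ` S)"
proof -
  have "P \<subseteq> (`) r ` E" using P by blast
  then have fP: "finite P" using finE by (meson finite_imageI finite_subset)
  have "P = {} \<or> card P < card (r ` S) \<or> 3 * (card P + 2) \<le> 2 * card P + 3 * card (r ` S)"
  proof (rule star_contraction_bound[OF S r P])
    fix A assume A: "A \<subseteq> P" "A \<noteq> {}" "leafless A"
    show "3 \<le> card A"
    proof (rule leafless_card3)
      show "finite A" using A(1) fP finite_subset by blast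
      show "card e = 2" if "e \<in> A" for e using A(1) P that by blast
    qed (use A in auto)
  qed
  then show "card (r ` S) \<ge> 1 \<Longrightarrow> card P + 3 \<le> 3 * card (r ` S)"
    and "card (r ` S) \<ge> 3 \<Longrightarrow> card P + 6 \<le> 3 * card (r ` S)" by auto
qed

text \<open>A leafless set of edges between two disjoint classes contains at least four edges.\<close>

corollary contraction_bipartite:
  assumes S: "S \<subseteq> V"
    and r: "\<And>x. x \<in> S \<Longrightarrow> r x \<in> S \<and> r (r x) = r x \<and> (r x = x \<or> {x, r x} \<in> E)"
    and PQ: "P \<inter> Q = {}" "finite P" "finite Q"
    and R: "\<And>a b. (a, b) \<in> R \<Longrightarrow> a \<in> P \<and> b \<in> Q \<and> (\<exists>u\<in>S. \<exists>v\<in>S. {u, v} \<in> E \<and> r u = a \<and> r v = b)"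
  shows "card P + card Q \<ge> 1 \<Longrightarrow> card R + 2 \<le> 2 * (card P + card Q)"
    and "card P + card Q \<ge> 3 \<Longrightarrow> card R + 4 \<le> 2 * (card P + card Q)"
proof -
  define S' where "S' = {x \<in> S. r x \<in> P \<union> Q}"
  define M where "M = (\<lambda>(a, b). {a, b}) ` R"
  have "R \<subseteq> P \<times> Q" using R by auto
  then have fR: "finite R" using PQ finite_subset by blast
  have "inj_on (\<lambda>(a, b). {a, b}) R"
  proof (rule inj_onI, clarify)
    fix a b c d assume "(a, b) \<in> R" "(c, d) \<in> R" "{a, b} = {c, d}"
    then show "a = c \<and> b = d" using R[of a b] R[of c d] PQ(1) by (auto simp: doubleton_eq_iff)
  qed
  then have cM: "card M = card R" unfolding M_def by (rule card_image)
  have "card (r ` S') \<le> card (P \<union> Q)"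
    by (rule card_mono) (use PQ in \<open>auto simp: S'_def\<close>)
  then have cS: "card (r ` S') \<le> card P + card Q" using card_Un_disjoint[OF PQ(2,3,1)] by simp
  have "M = {} \<or> card M < card (r ` S') \<or> 4 * (card M + 2) \<le> 2 * card M + 4 * card (r ` S')"
  proof (rule star_contraction_bound)
    show "S' \<subseteq> V" using S unfolding S'_def by blast
    show "r x \<in> S' \<and> r (r x) = r x \<and> (r x = x \<or> {x, r x} \<in> E)" if "x \<in> S'" for x
      using r[of x] that unfolding S'_def by auto
    show "card q = 2 \<and> (\<exists>l\<in>E. l \<subseteq> S' \<and> r ` l = q)" if q: "q \<in> M" for q
    proof -
      obtain a b where ab: "(a, b) \<in> R" "q = {a, b}" using q unfolding M_def by auto
      obtain u v where uv: "u \<in> S" "v \<in> S" "{u, v} \<in> E" "r u = a" "r v = b" using R[OF ab(1)] by blast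
      have "a \<noteq> b" using R[OF ab(1)] PQ(1) by blast
      then have "card q = 2" using ab(2) by simp
      moreover have "{u, v} \<subseteq> S'" using uv R[OF ab(1)] unfolding S'_def by auto
      moreover have "r ` {u, v} = q" using uv ab by simp
      ultimately show ?thesis using uv(3) by blast
    qed
    fix A assume A: "A \<subseteq> M" "A \<noteq> {}" "leafless A"
    show "4 \<le> card A"
    proof (rule leafless_bipartite_card4[OF _ A(2,3) PQ(1)])
      show "finite A" using A(1) fR unfolding M_def by (meson finite_imageI finite_subset)
      show "\<exists>a\<in>P. \<exists>b\<in>Q. e = {a, b}" if "e \<in> A" for e
      proof -
        have "e \<in> M" using A(1) that by blast
        then obtain a b where "(a, b) \<in> R" "e = {a, b}" unfolding M_def by auto
        then show ?thesis using R by blast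
      qed
    qed
  qed
  then show "card P + card Q \<ge> 1 \<Longrightarrow> card R + 2 \<le> 2 * (card P + card Q)"
    and "card P + card Q \<ge> 3 \<Longrightarrow> card R + 4 \<le> 2 * (card P + card Q)"
    using cM cS by auto
qed

corollary planar_edges:
  assumes S: "S \<subseteq> V" and P: "P \<subseteq> {e \<in> E. e \<subseteq> S}"
  shows "S \<noteq> {} \<Longrightarrow> card P + 3 \<le> 3 * card S"
    and "card S \<ge> 3 \<Longrightarrow> card P + 6 \<le> 3 * card S"
proof -
  have P': "card q = 2 \<and> (\<exists>l\<in>E. l \<subseteq> S \<and> (\<lambda>x. x) ` l = q)" if "q \<in> P" for q
    using P that edge2 by auto
  have "finite S" using S finV finite_subset by blast
  then show "S \<noteq> {} \<Longrightarrow> card P + 3 \<le> 3 * card S"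
    using contraction_edges(1)[of S "\<lambda>x. x" P] S P' by (auto simp: Suc_le_eq card_gt_0_iff)
  show "card S \<ge> 3 \<Longrightarrow> card P + 6 \<le> 3 * card S"
    using contraction_edges(2)[of S "\<lambda>x. x" P] S P' by auto
qed

corollary planar_bipartite:
  assumes P: "P \<subseteq> V" "Q \<subseteq> V" "P \<inter> Q = {}"
  shows "P \<union> Q \<noteq> {} \<Longrightarrow> (\<Sum>p\<in>P. card (neighbors E p \<inter> Q)) + 2 \<le> 2 * (card P + card Q)"
    and "card P + card Q \<ge> 3 \<Longrightarrow> (\<Sum>p\<in>P. card (neighbors E p \<inter> Q)) + 4 \<le> 2 * (card P + card Q)"
proof -
  have fin: "finite P" "finite Q"
    using finite_subset[OF P(1) finV] finite_subset[OF P(2) finV] by auto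
  define R where "R = Sigma P (\<lambda>p. neighbors E p \<inter> Q)"
  have cR: "card R = (\<Sum>p\<in>P. card (neighbors E p \<inter> Q))"
    unfolding R_def by (rule card_SigmaI) (use fin in auto)
  have R: "a \<in> P \<and> b \<in> Q \<and> (\<exists>u\<in>V. \<exists>v\<in>V. {u, v} \<in> E \<and> u = a \<and> v = b)" if "(a, b) \<in> R" for a b
    using that P unfolding R_def neighbors_def by auto
  have c: "card P + card Q \<ge> 1 \<Longrightarrow> card R + 2 \<le> 2 * (card P + card Q)"
    "card P + card Q \<ge> 3 \<Longrightarrow> card R + 4 \<le> 2 * (card P + card Q)"
    using contraction_bipartite[of V "\<lambda>x. x" P Q R] P(3) fin R by auto
  show "P \<union> Q \<noteq> {} \<Longrightarrow> (\<Sum>p\<in>P. card (neighbors E p \<inter> Q)) + 2 \<le> 2 * (card P + card Q)"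
  proof -
    assume "P \<union> Q \<noteq> {}"
    then have "card P + card Q \<ge> 1" using fin by (metis One_nat_def Suc_leI add_gr_0 card_gt_0_iff sup_bot.right_neutral sup_bot.left_neutral)
    then show ?thesis using c(1) cR by auto
  qed
  show "card P + card Q \<ge> 3 \<Longrightarrow> (\<Sum>p\<in>P. card (neighbors E p \<inter> Q)) + 4 \<le> 2 * (card P + card Q)"
    using c(2) cR by auto
qed

text \<open>A complete bipartite graph on three plus three vertices has nine edges, one too many.\<close>

lemma no_K33:
  assumes P: "P \<subseteq> V" "Q \<subseteq> V" "P \<inter> Q = {}" and c: "card P \<ge> 3" "card Q \<ge> 3"
  shows "\<exists>p\<in>P. \<exists>q\<in>Q. {p, q} \<notin> E"
proof (rule ccontr)
  assume no: "\<not> ?thesis"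
  obtain P' where P': "P' \<subseteq> P" "card P' = 3" using c(1) obtain_subset_with_card_n by metis
  obtain Q' where Q': "Q' \<subseteq> Q" "card Q' = 3" using c(2) obtain_subset_with_card_n by metis
  have "(\<Sum>p\<in>P'. card (neighbors E p \<inter> Q')) = (\<Sum>p\<in>P'. 3)"
  proof (rule sum.cong[OF refl])
    fix p assume "p \<in> P'"
    then have "neighbors E p \<inter> Q' = Q'" using no P' Q' unfolding neighbors_def by blast
    then show "card (neighbors E p \<inter> Q') = 3" using Q' by simp
  qed
  moreover have "(\<Sum>p\<in>P'. card (neighbors E p \<inter> Q')) + 4 \<le> 2 * (card P' + card Q')"
    by (rule planar_bipartite(2)) (use P P' Q' in auto)
  ultimately show False using P' Q' by simp
qed

end

section \<open>Systems of distinct representatives\<close>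

text \<open>The argument of Halmos and Vaughan. If some proper non-empty part \<open>I\<close> of the index set is tight,
  solve \<open>I\<close> and then the rest without the elements used by \<open>I\<close>. Otherwise any element may be given
  to any one index, since every other union has one element to spare.\<close>

theorem hall_marriage:
  assumes "finite J" "\<forall>i\<in>J. finite (A i)" "\<forall>I\<subseteq>J. card I \<le> card (\<Union>(A ` I))"
  shows "\<exists>g. inj_on g J \<and> (\<forall>i\<in>J. g i \<in> A i)"
  using assms
proof (induction "card J" arbitrary: J A rule: less_induct)
  case less
  note fJ = less.prems(1)
  have fU: "finite (\<Union>(A ` I))" if "I \<subseteq> J" for I
    using that less.prems(2) finite_subset[OF that fJ] by blast
  show ?case
  proof (cases "\<exists>I. I \<subseteq> J \<and> I \<noteq> {} \<and> I \<noteq> J \<and> card (\<Union>(A ` I)) = card I")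
    case True
    then obtain I where I: "I \<subseteq> J" "I \<noteq> {}" "I \<noteq> J" "card (\<Union>(A ` I)) = card I" by blast
    have fI: "finite I" using I(1) fJ finite_subset by blast
    have lt: "card I < card J" using I fJ by (simp add: psubset_card_mono psubsetI)
    have "\<exists>g. inj_on g I \<and> (\<forall>i\<in>I. g i \<in> A i)"
      by (rule less.hyps[OF lt fI]) (use less.prems I(1) in auto)
    then obtain g where g: "inj_on g I" "\<forall>i\<in>I. g i \<in> A i" by blast
    define A' where "A' j = A j - \<Union>(A ` I)" for j
    have "0 < card I" using I(2) fI by (simp add: card_gt_0_iff)
    moreover have "card I + card (J - I) = card J"
      using I(1) fI fJ by (simp add: card_Diff_subset card_mono)
    ultimately have lt': "card (J - I) < card J" by linarith
    have "\<exists>h. inj_on h (J - I) \<and> (\<forall>i\<in>J - I. h i \<in> A' i)"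
    proof (rule less.hyps[OF lt'])
      show "finite (J - I)" using fJ by simp
      show "\<forall>i\<in>J - I. finite (A' i)" using less.prems(2) unfolding A'_def by blast
      show "\<forall>K\<subseteq>J - I. card K \<le> card (\<Union>(A' ` K))"
      proof (intro allI impI)
        fix K assume K: "K \<subseteq> J - I"
        have fK: "finite K" using K fJ finite_subset by blast
        have KI: "K \<union> I \<subseteq> J" using K I(1) by blast
        have "card K + card I = card (K \<union> I)"
          by (rule card_Un_disjoint[symmetric]) (use K fK fI in auto)
        also have "\<dots> \<le> card (\<Union>(A ` (K \<union> I)))" using less.prems(3) KI by blast
        also have "\<Union>(A ` (K \<union> I)) = \<Union>(A' ` K) \<union> \<Union>(A ` I)" unfolding A'_def by blast
        also have "card \<dots> \<le> card (\<Union>(A' ` K)) + card (\<Union>(A ` I))" by (rule card_Un_le)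
        finally show "card K \<le> card (\<Union>(A' ` K))" using I(4) by simp
      qed
    qed
    then obtain h where h: "inj_on h (J - I)" "\<forall>i\<in>J - I. h i \<in> A' i" by blast
    let ?f = "\<lambda>i. if i \<in> I then g i else h i"
    have "inj_on ?f J"
    proof (rule inj_onI)
      fix x y assume xy: "x \<in> J" "y \<in> J" "?f x = ?f y"
      have cross: False if "u \<in> I" "v \<in> J - I" "g u = h v" for u v
      proof -
        have "h v \<notin> \<Union>(A ` I)" using h(2) that(2) unfolding A'_def by blast
        moreover have "g u \<in> \<Union>(A ` I)" using g(2) that(1) by blast
        ultimately show False using that(3) by simp
      qed
      show "x = y"
        using xy cross[of x y] cross[of y x] inj_onD[OF g(1), of x y] inj_onD[OF h(1), of x y]
        by (auto split: if_splits)
    qed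
    moreover have "\<forall>i\<in>J. ?f i \<in> A i" using g(2) h(2) unfolding A'_def by auto
    ultimately show ?thesis by blast
  next
    case False
    show ?thesis
    proof (cases "J = {}")
      case True
      then show ?thesis by simp
    next
      case ne: False
      then obtain i where i: "i \<in> J" by blast
      have "card {i} \<le> card (\<Union>(A ` {i}))" using less.prems(3) i by blast
      then have "A i \<noteq> {}" by auto
      then obtain x where x: "x \<in> A i" by blast
      define A' where "A' j = A j - {x}" for j
      have lt: "card (J - {i}) < card J" by (rule card_Diff1_less[OF fJ i])
      have "\<exists>g. inj_on g (J - {i}) \<and> (\<forall>j\<in>J - {i}. g j \<in> A' j)"
      proof (rule less.hyps[OF lt])
        show "finite (J - {i})" using fJ by simp
        show "\<forall>j\<in>J - {i}. finite (A' j)" using less.prems(2) unfolding A'_def by blast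
        show "\<forall>K\<subseteq>J - {i}. card K \<le> card (\<Union>(A' ` K))"
        proof (intro allI impI)
          fix K assume K: "K \<subseteq> J - {i}"
          show "card K \<le> card (\<Union>(A' ` K))"
          proof (cases "K = {}")
            case True then show ?thesis by simp
          next
            case False
            have KJ: "K \<subseteq> J" "K \<noteq> J" using K i by auto
            then have "card K \<le> card (\<Union>(A ` K))" using less.prems(3) by blast
            moreover have "card (\<Union>(A ` K)) \<noteq> card K"
              using \<open>\<not> (\<exists>I. I \<subseteq> J \<and> I \<noteq> {} \<and> I \<noteq> J \<and> card (\<Union>(A ` I)) = card I)\<close> KJ False by blast
            moreover have "\<Union>(A' ` K) = \<Union>(A ` K) - {x}" unfolding A'_def by blast
            moreover have "card (\<Union>(A ` K)) \<le> card (\<Union>(A ` K) - {x}) + 1"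
              using card_Diff1_le[of "\<Union>(A ` K)" x] card_Suc_Diff1[OF fU[OF KJ(1)], of x]
              by (cases "x \<in> \<Union>(A ` K)") auto
            ultimately show ?thesis by simp
          qed
        qed
      qed
      then obtain g where g: "inj_on g (J - {i})" "\<forall>j\<in>J - {i}. g j \<in> A' j" by blast
      let ?f = "g(i := x)"
      have "inj_on ?f (insert i (J - {i}))"
        using g by (subst inj_on_insert) (auto simp: A'_def inj_on_def)
      then have "inj_on ?f J" using i by (simp add: insert_absorb)
      moreover have "\<forall>j\<in>J. ?f j \<in> A j" using g(2) x unfolding A'_def by auto
      ultimately show ?thesis by blast
    qed
  qed
qed

section \<open>Conflicts between edges and partial colorings\<close>

text \<open>The edges opposite to \<open>{u, v}\<close> in 4-cycles. The vertices \<open>x\<close> and \<open>w\<close> are the other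
  neighbors of \<open>u\<close> and of \<open>v\<close> on the cycle.\<close>

definition opposite :: "'a set set \<Rightarrow> 'a \<Rightarrow> 'a \<Rightarrow> 'a set set" where
  "opposite E u v = {{x, w} | x w. x \<in> neighbors E u - {v} \<and> w \<in> neighbors E v - {u} \<and> {x, w} \<in> E}"

definition conflict :: "'a set set \<Rightarrow> 'a set \<Rightarrow> 'a set \<Rightarrow> bool" where
  "conflict E e f \<longleftrightarrow> e \<noteq> f \<and> (e \<inter> f \<noteq> {} \<or> (\<exists>u v. e = {u, v} \<and> f \<in> opposite E u v))"

text \<open>A coloring of the edges in \<open>F\<close> with the colors below \<open>k\<close>. Conflicts are taken in the whole
  graph \<open>E\<close>, so that a partial coloring can be extended without looking back.\<close>

definition coloring :: "'a set set \<Rightarrow> 'a set set \<Rightarrow> nat \<Rightarrow> ('a set \<Rightarrow> nat) \<Rightarrow> bool" where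
  "coloring E F k c \<longleftrightarrow> (\<forall>e\<in>F. c e < k) \<and> (\<forall>e\<in>F. \<forall>f\<in>F. conflict E e f \<longrightarrow> c e \<noteq> c f)"

lemma neighbors_sym: "v \<in> neighbors E u \<longleftrightarrow> u \<in> neighbors E v"
  by (simp add: neighbors_def insert_commute)

lemma oppositeI:
  "{u, x} \<in> E \<Longrightarrow> {v, w} \<in> E \<Longrightarrow> {x, w} \<in> E \<Longrightarrow> x \<noteq> v \<Longrightarrow> w \<noteq> u \<Longrightarrow> {x, w} \<in> opposite E u v"
  unfolding opposite_def neighbors_def mem_Collect_eq by (intro exI[of _ x] exI[of _ w]) simp

lemma oppositeD:
  assumes "f \<in> opposite E u v"
  shows "\<exists>x w. f = {x, w} \<and> {u, x} \<in> E \<and> {v, w} \<in> E \<and> {x, w} \<in> E \<and> x \<noteq> v \<and> w \<noteq> u"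
proof -
  obtain x w where "f = {x, w}" "x \<in> neighbors E u - {v}" "w \<in> neighbors E v - {u}" "{x, w} \<in> E"
    using assms unfolding opposite_def mem_Collect_eq by (elim exE conjE)
  then show ?thesis by (intro exI[of _ x] exI[of _ w]) (simp add: neighbors_def)
qed

lemma opposite_commute: "opposite E u v = opposite E v u"
proof -
  have "f \<in> opposite E v u" if o: "f \<in> opposite E u v" for u v f
  proof -
    obtain x w where f: "f = {x, w}" "{u, x} \<in> E" "{v, w} \<in> E" "{x, w} \<in> E" "x \<noteq> v" "w \<noteq> u"
      using oppositeD[OF o] by (elim exE conjE)
    have "{w, x} \<in> opposite E v u"
      by (rule oppositeI) (use f in \<open>simp_all add: insert_commute\<close>)
    then show ?thesis using f(1) by (simp add: insert_commute)
  qed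
  then show ?thesis by (intro subset_antisym subsetI)
qed

lemma opposite_sym:
  assumes "f \<in> opposite E u v" "{u, v} \<in> E" "u \<noteq> v"
  shows "\<exists>x w. f = {x, w} \<and> {u, v} \<in> opposite E x w"
proof -
  obtain x w where f: "f = {x, w}" "{u, x} \<in> E" "{v, w} \<in> E" "{x, w} \<in> E" "x \<noteq> v" "w \<noteq> u"
    using oppositeD[OF assms(1)] by (elim exE conjE)
  have "{u, v} \<in> opposite E x w"
    by (rule oppositeI) (use f assms in \<open>simp_all add: insert_commute\<close>)
  then show ?thesis using f by blast
qed

lemma conflict_sym:
  assumes "conflict E e f" "e \<in> E" "card e = 2"
  shows "conflict E f e"
proof -
  have ne: "e \<noteq> f" using assms(1) unfolding conflict_def by blast
  from assms(1) have "e \<inter> f \<noteq> {} \<or> (\<exists>u v. e = {u, v} \<and> f \<in> opposite E u v)" unfolding conflict_def by blast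
  then show ?thesis
  proof
    assume "e \<inter> f \<noteq> {}" then show ?thesis using ne unfolding conflict_def by blast
  next
    assume "\<exists>u v. e = {u, v} \<and> f \<in> opposite E u v"
    then obtain u v where uv: "e = {u, v}" "f \<in> opposite E u v" by blast
    then have "u \<noteq> v" using assms(3) by auto
    then have "\<exists>x w. f = {x, w} \<and> e \<in> opposite E x w"
      using opposite_sym[OF uv(2)] assms(2) uv(1) by simp
    then show ?thesis using ne unfolding conflict_def by blast
  qed
qed

lemma conflict_edge:
  "conflict E {u, v} f \<longleftrightarrow> f \<noteq> {u, v} \<and> (u \<in> f \<or> v \<in> f \<or> f \<in> opposite E u v)"
proof -
  have 1: "(\<exists>x y. {u, v} = {x, y} \<and> f \<in> opposite E x y) \<longleftrightarrow> f \<in> opposite E u v"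
    using opposite_commute[of E u v] by (auto simp: doubleton_eq_iff)
  have 2: "{u, v} \<inter> f \<noteq> {} \<longleftrightarrow> u \<in> f \<or> v \<in> f" by simp
  have 3: "{u, v} \<noteq> f \<longleftrightarrow> f \<noteq> {u, v}" by (rule neq_commute)
  show ?thesis unfolding conflict_def 1 2 3 disj_assoc by (rule refl)
qed

lemma coloring_subset: "coloring E F k c \<Longrightarrow> F' \<subseteq> F \<Longrightarrow> coloring E F' k c"
  by (auto simp: coloring_def)

lemma coloring_B_coloring:
  assumes "coloring E E k c" "simple_graph V E"
  shows "B_coloring_number E \<le> k"
proof -
  have c: "\<And>e f. e \<in> E \<Longrightarrow> f \<in> E \<Longrightarrow> conflict E e f \<Longrightarrow> c e \<noteq> c f"
    by (rule assms(1)[unfolded coloring_def, THEN conjunct2, rule_format])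
  have opp: "c {u, v} \<noteq> c {w, x}" if "four_cycle E u v w x" for u v w x
  proof (rule c)
    have fc: "u \<noteq> v" "u \<noteq> w" "u \<noteq> x" "v \<noteq> w" "v \<noteq> x" "w \<noteq> x" "{u, v} \<in> E" "{v, w} \<in> E" "{w, x} \<in> E" "{x, u} \<in> E"
      using that unfolding four_cycle_def by auto
    show "{u, v} \<in> E" "{w, x} \<in> E" using fc by auto
    have "{x, w} \<in> opposite E u v"
      by (rule oppositeI) (use fc in \<open>simp_all add: insert_commute\<close>)
    moreover have "{x, w} \<noteq> {u, v}" using fc(2,3) by (simp add: doubleton_eq_iff)
    ultimately show "conflict E {u, v} {w, x}"
      unfolding conflict_edge insert_commute[of w x "{}"] by (intro conjI disjI2)
  qed
  have adj: "c {u, v} \<noteq> c {v, w}" if "{u, v} \<in> E" "{v, w} \<in> E" "u \<noteq> w" for u v w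
  proof (rule c[OF that(1,2)])
    show "conflict E {u, v} {v, w}" using that(3) unfolding conflict_edge by (simp add: doubleton_eq_iff)
  qed
  have "B_coloring E c"
    unfolding B_coloring_def
  proof (intro conjI allI impI)
    show "proper_edge_coloring E c"
      unfolding proper_edge_coloring_def
    proof (intro ballI impI)
      fix e f assume "e \<in> E" "f \<in> E" "e \<noteq> f \<and> e \<inter> f \<noteq> {}"
      then show "c e \<noteq> c f" by (intro c) (simp_all only: conflict_def simp_thms)
    qed
    fix u v w x assume f: "four_cycle E u v w x"
    then have f': "four_cycle E v w x u" unfolding four_cycle_def by auto
    have fc: "u \<noteq> w" "v \<noteq> x" "{u, v} \<in> E" "{v, w} \<in> E" "{w, x} \<in> E" "{x, u} \<in> E"
      using f unfolding four_cycle_def by auto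
    show "distinct [c {u, v}, c {v, w}, c {w, x}, c {x, u}]"
      using opp[OF f] opp[OF f'] adj[OF fc(3,4,1)] adj[OF fc(4,5,2)] adj[OF fc(5,6) fc(1)[symmetric]]
        adj[OF fc(6,3) fc(2)[symmetric], symmetric] by simp
  qed
  then have "B_coloring_number E \<le> card (c ` E)"
    unfolding B_coloring_number_def by (intro Least_le exI[of _ c] conjI) simp_all
  also have "\<dots> \<le> card {..<k}"
    by (rule card_mono) (use assms(1) in \<open>simp_all add: coloring_def image_subset_iff\<close>)
  finally show ?thesis by simp
qed

definition delete :: "'a set set \<Rightarrow> 'a set \<Rightarrow> 'a set set" where
  "delete E Y = {e \<in> E. e \<inter> Y = {}}"

text \<open>All four vertices of a 4-cycle lie on two opposite edges of it. So deleting vertices does not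
  remove conflicts between the surviving edges, and a coloring of the smaller graph is a partial
  coloring of the larger one. Deleting single edges would not have this property.\<close>

lemma conflict_delete:
  assumes "e \<in> delete E Y" "f \<in> delete E Y"
  shows "conflict (delete E Y) e f = conflict E e f"
proof -
  have "f \<in> opposite (delete E Y) u v \<longleftrightarrow> f \<in> opposite E u v" if e: "e = {u, v}" for u v
  proof
    assume o: "f \<in> opposite (delete E Y) u v"
    obtain x w where f: "f = {x, w}" "{u, x} \<in> delete E Y" "{v, w} \<in> delete E Y"
      "{x, w} \<in> delete E Y" "x \<noteq> v" "w \<noteq> u"
      using oppositeD[OF o] by (elim exE conjE)
    show "f \<in> opposite E u v"
      unfolding f(1) by (rule oppositeI) (use f in \<open>simp_all add: delete_def\<close>)
  next
    assume o: "f \<in> opposite E u v"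
    then obtain x w where f: "f = {x, w}" "{u, x} \<in> E" "{v, w} \<in> E" "{x, w} \<in> E" "x \<noteq> v" "w \<noteq> u"
      using oppositeD[OF o] by (elim exE conjE)
    have "x \<notin> Y" "w \<notin> Y" "u \<notin> Y" "v \<notin> Y" using assms unfolding e f(1) delete_def by simp_all
    then show "f \<in> opposite (delete E Y) u v"
      unfolding f(1) using f(2-6) by (intro oppositeI) (simp_all add: delete_def)
  qed
  then have "(\<exists>u v. e = {u, v} \<and> f \<in> opposite (delete E Y) u v) \<longleftrightarrow>
      (\<exists>u v. e = {u, v} \<and> f \<in> opposite E u v)"
    by (intro iff_exI conj_cong refl)
  then show ?thesis unfolding conflict_def by simp
qed

lemma coloring_delete:
  "coloring (delete E Y) (delete E Y) k c \<Longrightarrow> coloring E (delete E Y) k c"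
  unfolding coloring_def by (simp add: conflict_delete)

lemma coloring_extend:
  assumes c: "coloring E F k c" and F: "F \<subseteq> E" and c2: "\<And>e. e \<in> E \<Longrightarrow> card e = 2" and e: "e \<in> E"
    and x: "x < k" "\<And>f. f \<in> F \<Longrightarrow> conflict E e f \<Longrightarrow> c f \<noteq> x"
  shows "coloring E (insert e F) k (c(e := x))"
  unfolding coloring_def
proof (intro conjI ballI impI)
  fix f assume "f \<in> insert e F"
  then show "(c(e := x)) f < k" using c x(1) by (simp add: coloring_def) blast
next
  fix f h assume fh: "f \<in> insert e F" "h \<in> insert e F" "conflict E f h"
  have ne: "f \<noteq> h" using fh(3) unfolding conflict_def by blast
  have hf: "conflict E h f"
    by (rule conflict_sym[OF fh(3)]) (use fh F e c2 in auto)
  show "(c(e := x)) f \<noteq> (c(e := x)) h"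
  proof (cases "f = e")
    case True
    then show ?thesis using x(2)[of h] fh ne by auto
  next
    case f: False
    show ?thesis
    proof (cases "h = e")
      case True
      then show ?thesis using x(2)[of f] hf fh f by auto
    next
      case False
      then show ?thesis using c fh f unfolding coloring_def by auto
    qed
  qed
qed

lemma coloring_greedy:
  assumes c: "coloring E F k c" and F: "F \<subseteq> E" "finite E" and c2: "\<And>e. e \<in> E \<Longrightarrow> card e = 2" and e: "e \<in> E"
    and less: "card {f \<in> F. conflict E e f} < k"
  shows "\<exists>x. coloring E (insert e F) k (c(e := x))"
proof -
  have fin: "finite {f \<in> F. conflict E e f}" using F finite_subset by fastforce
  have "card (c ` {f \<in> F. conflict E e f}) < card {..<k}"
    using card_image_le[OF fin, of c] less by simp
  then have "\<not> {..<k} \<subseteq> c ` {f \<in> F. conflict E e f}"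
    using card_mono[OF finite_imageI[OF fin], of "{..<k}" c] by linarith
  then obtain x where "x < k" "x \<notin> c ` {f \<in> F. conflict E e f}" by blast
  then have "coloring E (insert e F) k (c(e := x))"
    by (intro coloring_extend[OF c F(1) c2 e]) auto
  then show ?thesis by blast
qed

text \<open>Coloring the edges of \<open>M\<close> by increasing rank: when \<open>e\<close> is reached, only edges of \<open>F\<close> and edges
  of at most its rank have colors.\<close>

lemma coloring_greedy_ranked:
  fixes rank :: "'a set \<Rightarrow> nat"
  assumes c: "coloring E F k c" and F: "F \<subseteq> E" "M \<subseteq> E" "finite E"
    and c2: "\<And>e. e \<in> E \<Longrightarrow> card e = 2"
    and less: "\<And>e. e \<in> M \<Longrightarrow> card {f \<in> F \<union> M. conflict E e f \<and> (f \<in> F \<or> rank f \<le> rank e)} < k"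
  shows "\<exists>c'. coloring E (F \<union> M) k c'"
proof -
  have "finite M" using F finite_subset by blast
  then show ?thesis
    using F(2) less
  proof (induction M rule: finite_ranking_induct[where f = rank])
    case empty
    then show ?case using c by auto
  next
    case (insert e M)
    have fin: "finite (F \<union> insert e M)" using F(1,3) insert.prems(1) finite_subset by (meson Un_least)
    have "\<exists>c'. coloring E (F \<union> M) k c'"
    proof (rule insert.IH)
      show "M \<subseteq> E" using insert.prems by blast
      fix h assume h: "h \<in> M"
      have "card {f \<in> F \<union> M. conflict E h f \<and> (f \<in> F \<or> rank f \<le> rank h)}
        \<le> card {f \<in> F \<union> insert e M. conflict E h f \<and> (f \<in> F \<or> rank f \<le> rank h)}"
        by (rule card_mono) (use fin in auto)
      also have "\<dots> < k" by (rule insert.prems(2)) (use h in simp)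
      finally show "card {f \<in> F \<union> M. conflict E h f \<and> (f \<in> F \<or> rank f \<le> rank h)} < k" .
    qed
    then obtain c' where c': "coloring E (F \<union> M) k c'" by blast
    have "card {f \<in> F \<union> M. conflict E e f}
        \<le> card {f \<in> F \<union> insert e M. conflict E e f \<and> (f \<in> F \<or> rank f \<le> rank e)}"
      by (rule card_mono) (use fin insert.hyps in auto)
    also have "\<dots> < k" by (rule insert.prems(2)) simp
    finally have l: "card {f \<in> F \<union> M. conflict E e f} < k" .
    have "\<exists>x. coloring E (insert e (F \<union> M)) k (c'(e := x))"
      by (rule coloring_greedy[OF c' _ F(3) c2 _ l]) (use F(1) insert.prems(1) in auto)
    then show ?case by auto
  qed
qed

lemma coloring_greedy_set:
  assumes c: "coloring E F k c" and F: "F \<subseteq> E" "M \<subseteq> E" "finite E"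
    and c2: "\<And>e. e \<in> E \<Longrightarrow> card e = 2"
    and less: "\<And>e. e \<in> M \<Longrightarrow> card {f \<in> F \<union> M. conflict E e f} < k"
  shows "\<exists>c'. coloring E (F \<union> M) k c'"
  by (rule coloring_greedy_ranked[where rank = "\<lambda>_. 0", OF c F c2]) (use less in simp_all)

text \<open>The edges at \<open>a\<close> that are still uncolored conflict pairwise, so they need distinct
  representatives of their sets of available colors. The condition of Hall's theorem is expressed by
  the colors that are forbidden for all members of \<open>I\<close> at once.\<close>

lemma coloring_star:
  assumes c: "coloring E F k c" and F: "F \<subseteq> E" "finite E"
    and c2: "\<And>e. e \<in> E \<Longrightarrow> card e = 2"
    and Y: "finite Y" "\<And>y. y \<in> Y \<Longrightarrow> {a, y} \<in> E" "\<And>y. y \<in> Y \<Longrightarrow> {a, y} \<notin> F"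
    and hall: "\<And>I. I \<subseteq> Y \<Longrightarrow> I \<noteq> {} \<Longrightarrow>
      card {x. x < k \<and> (\<forall>y\<in>I. \<exists>f\<in>F. conflict E {a, y} f \<and> c f = x)} + card I \<le> k"
  shows "\<exists>c'. coloring E (F \<union> (\<lambda>y. {a, y}) ` Y) k c'"
proof -
  define A where "A y = {x. x < k \<and> (\<forall>f\<in>F. conflict E {a, y} f \<longrightarrow> c f \<noteq> x)}" for y
  have "\<exists>g. inj_on g Y \<and> (\<forall>y\<in>Y. g y \<in> A y)"
  proof (rule hall_marriage[OF Y(1)])
    show "\<forall>i\<in>Y. finite (A i)" unfolding A_def by simp
    show "\<forall>I\<subseteq>Y. card I \<le> card (\<Union> (A ` I))"
    proof (intro allI impI)
      fix I assume I: "I \<subseteq> Y"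
      let ?C = "{x. x < k \<and> (\<forall>y\<in>I. \<exists>f\<in>F. conflict E {a, y} f \<and> c f = x)}"
      show "card I \<le> card (\<Union> (A ` I))"
      proof (cases "I = {}")
        case False
        have "{..<k} \<subseteq> ?C \<union> \<Union> (A ` I)"
        proof
          fix x assume x: "x \<in> {..<k}"
          show "x \<in> ?C \<union> \<Union> (A ` I)"
          proof (cases "\<exists>y\<in>I. x \<in> A y")
            case False
            then have "\<forall>y\<in>I. \<exists>f\<in>F. conflict E {a, y} f \<and> c f = x" using x unfolding A_def by simp
            then show ?thesis using x by simp
          qed simp
        qed
        then have "card {..<k} \<le> card (?C \<union> \<Union> (A ` I))"
          by (rule card_mono[rotated]) (use finite_subset[OF I Y(1)] in \<open>simp add: A_def\<close>)
        then have "k \<le> card ?C + card (\<Union> (A ` I))" using card_Un_le[of ?C "\<Union> (A ` I)"] by simp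
        then show ?thesis using hall[OF I False] by linarith
      qed simp
    qed
  qed
  then obtain g where g: "inj_on g Y" "\<forall>y\<in>Y. g y \<in> A y" by blast
  define c' where "c' f = (if f \<in> F then c f else g (THE y. f = {a, y}))" for f
  have the: "(THE z. {a, y} = {a, z}) = y" for y
    by (rule the_equality) (auto simp: doubleton_eq_iff)
  have cF: "c' f = c f" if "f \<in> F" for f using that unfolding c'_def by simp
  have cY: "c' {a, y} = g y" if "y \<in> Y" for y using Y(3)[OF that] unfolding c'_def by (simp add: the)
  have "coloring E (F \<union> (\<lambda>y. {a, y}) ` Y) k c'"
    unfolding coloring_def
  proof (intro conjI ballI impI)
    fix f assume "f \<in> F \<union> (\<lambda>y. {a, y}) ` Y"
    then show "c' f < k"
      using c g(2) cF cY unfolding coloring_def A_def by fastforce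
  next
    fix f h assume f: "f \<in> F \<union> (\<lambda>y. {a, y}) ` Y" and h: "h \<in> F \<union> (\<lambda>y. {a, y}) ` Y" and fh: "conflict E f h"
    have fE: "f \<in> E" using f F(1) Y(2) by blast
    have hf: "conflict E h f" by (rule conflict_sym[OF fh fE c2[OF fE]])
    have ne: "f \<noteq> h" using fh unfolding conflict_def by blast
    have cross: "c' p \<noteq> g y" if "y \<in> Y" "p \<in> F" "conflict E {a, y} p" for y p
      using g(2) that cF unfolding A_def by auto
    from f show "c' f \<noteq> c' h"
    proof
      assume f: "f \<in> F"
      from h show ?thesis
      proof
        assume "h \<in> F" then show ?thesis using c f fh cF unfolding coloring_def by simp
      next
        assume "h \<in> (\<lambda>y. {a, y}) ` Y"
        then obtain y where "y \<in> Y" "h = {a, y}" by blast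
        then show ?thesis using cross[of y f] f hf cY by simp
      qed
    next
      assume "f \<in> (\<lambda>y. {a, y}) ` Y"
      then obtain y where y: "y \<in> Y" "f = {a, y}" by blast
      from h show ?thesis
      proof
        assume "h \<in> F" then show ?thesis using cross[of y h] y fh cY by force
      next
        assume "h \<in> (\<lambda>y. {a, y}) ` Y"
        then obtain z where z: "z \<in> Y" "h = {a, z}" by blast
        have "y \<noteq> z" using ne y z by blast
        then show ?thesis using inj_onD[OF g(1)] y z cY by metis
      qed
    qed
  qed
  then show ?thesis by blast
qed

section \<open>Vizing's theorem\<close>

definition proper :: "'a set set \<Rightarrow> nat \<Rightarrow> ('a set \<Rightarrow> nat) \<Rightarrow> bool" where
  "proper F k c \<longleftrightarrow> (\<forall>e\<in>F. c e < k) \<and> (\<forall>e\<in>F. \<forall>f\<in>F. e \<noteq> f \<longrightarrow> e \<inter> f \<noteq> {} \<longrightarrow> c e \<noteq> c f)"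

definition free :: "'a set set \<Rightarrow> ('a set \<Rightarrow> nat) \<Rightarrow> 'a \<Rightarrow> nat \<Rightarrow> bool" where
  "free F c v \<gamma> \<longleftrightarrow> (\<forall>e\<in>F. v \<in> e \<longrightarrow> c e \<noteq> \<gamma>)"

lemma properD: "proper F k c \<Longrightarrow> e \<in> F \<Longrightarrow> f \<in> F \<Longrightarrow> e \<noteq> f \<Longrightarrow> v \<in> e \<Longrightarrow> v \<in> f \<Longrightarrow> c e \<noteq> c f"
  unfolding proper_def by (metis IntI empty_iff)

lemma freeD: "free F c v \<gamma> \<Longrightarrow> e \<in> F \<Longrightarrow> v \<in> e \<Longrightarrow> c e \<noteq> \<gamma>"
  unfolding free_def by simp

lemma free_color:
  assumes "finite F" "card {e \<in> F. v \<in> e} < k"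
  shows "\<exists>\<gamma><k. free F c v \<gamma>"
proof (rule ccontr)
  assume no: "\<not> ?thesis"
  have "{..<k} \<subseteq> c ` {e \<in> F. v \<in> e}"
  proof
    fix \<gamma> assume "\<gamma> \<in> {..<k}"
    then have "\<not> free F c v \<gamma>" using no by simp
    then show "\<gamma> \<in> c ` {e \<in> F. v \<in> e}" unfolding free_def by auto
  qed
  then have "card {..<k} \<le> card (c ` {e \<in> F. v \<in> e})" by (intro card_mono) (use assms in auto)
  also have "\<dots> \<le> card {e \<in> F. v \<in> e}" by (rule card_image_le) (use assms in auto)
  finally show False using assms(2) by simp
qed

lemma proper_insert:
  assumes "proper F k c" "e = {x, y}" "\<gamma> < k" "free F c x \<gamma>" "free F c y \<gamma>" "e \<notin> F"
  shows "proper (insert e F) k (c(e := \<gamma>))"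
proof -
  have *: "c f \<noteq> \<gamma>" if f: "f \<in> F" "e \<inter> f \<noteq> {}" for f
  proof -
    have "x \<in> f \<or> y \<in> f" using f(2) unfolding assms(2) by simp
    then show ?thesis using freeD[OF assms(4) f(1)] freeD[OF assms(5) f(1)] by blast
  qed
  show ?thesis
    unfolding proper_def
  proof (intro conjI ballI impI)
    fix f assume "f \<in> insert e F"
    then show "(c(e := \<gamma>)) f < k" using assms(1,3) unfolding proper_def by (cases "f = e") simp_all
  next
    fix f h assume f: "f \<in> insert e F" "h \<in> insert e F" "f \<noteq> h" "f \<inter> h \<noteq> {}"
    show "(c(e := \<gamma>)) f \<noteq> (c(e := \<gamma>)) h"
    proof (cases "f = e")
      case True
      then show ?thesis using *[of h] f by simp
    next
      case fe: False
      show ?thesis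
      proof (cases "h = e")
        case True
        then show ?thesis using *[of f] f fe by (simp add: Int_commute)
      next
        case False
        then show ?thesis using assms(1) f fe unfolding proper_def by simp
      qed
    qed
  qed
qed

lemma proper_mono: "proper F k c \<Longrightarrow> F' \<subseteq> F \<Longrightarrow> proper F' k c"
  unfolding proper_def by (simp add: subset_iff)

text \<open>A fan at \<open>x\<close> starts with the uncolored edge to \<open>y 0\<close>; each further edge has a color that is
  missing at the preceding vertex, so the colors can be shifted one place towards \<open>y 0\<close>.\<close>

definition fan :: "'a set set \<Rightarrow> ('a set \<Rightarrow> nat) \<Rightarrow> 'a \<Rightarrow> (nat \<Rightarrow> 'a) \<Rightarrow> nat \<Rightarrow> bool" where
  "fan F c x y m \<longleftrightarrow> inj_on y {..m} \<and> x \<notin> y ` {..m} \<and> {x, y 0} \<notin> F \<and>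
     (\<forall>i<m. {x, y (Suc i)} \<in> F \<and> free F c (y i) (c {x, y (Suc i)}))"

text \<open>Shift the color of the first fan edge to the uncolored edge. The remaining fan, for the edge
  that has now lost its color, is shorter by one. A color missing at both ends finishes the process.\<close>

lemma fan_rotate:
  assumes "proper F k c" "fan F c x y m" "\<gamma> < k" "free F c x \<gamma>" "free F c (y m) \<gamma>"
  shows "\<exists>c'. proper (insert {x, y 0} F) k c'"
  using assms
proof (induction m arbitrary: F c y)
  case 0
  have "{x, y 0} \<notin> F" using 0(2) unfolding fan_def by blast
  then have "proper (insert {x, y 0} F) k (c({x, y 0} := \<gamma>))"
    by (rule proper_insert[OF 0(1) refl 0(3-5)])
  then show ?case by blast
next
  case (Suc m)
  note fn = Suc.prems(2)[unfolded fan_def]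
  let ?e0 = "{x, y 0}" and ?e1 = "{x, y 1}"
  have e0: "?e0 \<notin> F" and e1: "?e1 \<in> F" and fr1: "free F c (y 0) (c ?e1)" using fn by auto
  have inj: "inj_on y {..Suc m}" and xy: "x \<notin> y ` {..Suc m}" using fn by auto
  have y01: "y i \<noteq> y 0" if "i \<le> m" "0 < i" for i using inj_onD[OF inj, of i 0] that by auto
  have ysn: "y (Suc i) \<noteq> y 0" "x \<noteq> y (Suc i)" if "i \<le> m" for i
    using inj_onD[OF inj, of "Suc i" 0] that xy by auto
  have x0: "x \<noteq> y 0" using xy by auto
  have ys1: "y (Suc i) \<noteq> y 1" if "i \<le> m" "0 < i" for i
    using inj_onD[OF inj, of "Suc i" 1] that by auto
  define F' where "F' = insert ?e0 (F - {?e1})"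
  define c' where "c' = c(?e0 := c ?e1)"
  have c'F: "c' e = c e" if "e \<in> F" for e using that e0 unfolding c'_def by auto
  have c'0: "c' ?e0 = c ?e1" unfolding c'_def by simp
  have ne: "?e0 \<noteq> ?e1" using e0 e1 by auto
  have "proper F' k c'"
    unfolding F'_def c'_def
  proof (rule proper_insert[OF _ refl])
    show "proper (F - {?e1}) k c" by (rule proper_mono[OF Suc.prems(1)]) auto
    show "c ?e1 < k" using Suc.prems(1) e1 unfolding proper_def by simp
    show "free (F - {?e1}) c x (c ?e1)"
      unfolding free_def using properD[OF Suc.prems(1) _ e1, of _ x] by auto
    show "free (F - {?e1}) c (y 0) (c ?e1)" using fr1 unfolding free_def by simp
    show "?e0 \<notin> F - {?e1}" using e0 by simp
  qed
  moreover have "fan F' c' x (\<lambda>i. y (Suc i)) m"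
    unfolding fan_def
  proof (intro conjI allI impI)
    show "inj_on (\<lambda>i. y (Suc i)) {..m}"
      using inj by (auto simp: inj_on_def)
    show "x \<notin> (\<lambda>i. y (Suc i)) ` {..m}" using xy by auto
    show "{x, y (Suc 0)} \<notin> F'" using ne unfolding F'_def by simp
    fix i assume i: "i < m"
    have "{x, y (Suc (Suc i))} \<in> F" and fr: "free F c (y (Suc i)) (c {x, y (Suc (Suc i))})"
      using fn i by auto
    moreover have "{x, y (Suc (Suc i))} \<noteq> ?e1" using ys1[of "Suc i"] i by (auto simp: doubleton_eq_iff)
    ultimately show m1: "{x, y (Suc (Suc i))} \<in> F'" unfolding F'_def by simp
    have inF: "{x, y (Suc (Suc i))} \<in> F" using fn i by auto
    have "y (Suc i) \<notin> ?e0" using ysn[of i] i by auto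
    then show "free F' c' (y (Suc i)) (c' {x, y (Suc (Suc i))})"
      using fr c'F inF unfolding F'_def free_def by auto
  qed
  moreover have "free F' c' x \<gamma>"
    using Suc.prems(4) e1 c'F c'0 unfolding F'_def free_def by auto
  moreover have "free F' c' (y (Suc m)) \<gamma>"
  proof -
    have "y (Suc m) \<notin> ?e0" using ysn[of m] by auto
    then show ?thesis using Suc.prems(5) c'F unfolding F'_def free_def by auto
  qed
  ultimately have "\<exists>c'. proper (insert {x, y (Suc 0)} F') k c'"
    by (intro Suc.IH[of F' c' "\<lambda>i. y (Suc i)"]) (use Suc.prems(3) in auto)
  moreover have "insert {x, y (Suc 0)} F' = insert {x, y 0} F" using e1 unfolding F'_def by auto
  ultimately show ?case by simp
qed

text \<open>A largest part of the component that satisfies the bound cannot be left along any edge.\<close>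

lemma component_edges:
  assumes fin: "finite S" "finite A" and S: "S = {(u, v). {u, v} \<in> A}\<^sup>* `` {x}"
  shows "card S \<le> card {e \<in> A. e \<subseteq> S} + 1"
proof -
  let ?R = "{(u, v). {u, v} \<in> A}"
  define P where "P T \<longleftrightarrow> T \<subseteq> S \<and> x \<in> T \<and> card T \<le> card {e \<in> A. e \<subseteq> T} + 1" for T
  have "P {x}" unfolding P_def S by auto
  moreover have "\<forall>T. P T \<longrightarrow> card T < Suc (card S)"
    unfolding P_def using fin(1) by (simp add: card_mono less_Suc_eq_le)
  ultimately obtain T where T: "P T" and mx: "\<forall>T'. P T' \<longrightarrow> card T' \<le> card T"
    using ex_has_greatest_nat[of P "{x}" card "Suc (card S)"] by blast
  have TS: "T \<subseteq> S" "x \<in> T" "card T \<le> card {e \<in> A. e \<subseteq> T} + 1" using T unfolding P_def by auto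
  have fT: "finite T" using TS(1) fin(1) finite_subset by blast
  have "v \<in> T" if "(x, v) \<in> ?R\<^sup>*" for v
    using that
  proof (induction rule: rtrancl_induct)
    case base
    show ?case by (rule TS(2))
  next
    case (step u v)
    have uv: "{u, v} \<in> A" using step.hyps(2) by simp
    show ?case
    proof (rule ccontr)
      assume v: "v \<notin> T"
      have vS: "v \<in> S" using step.hyps unfolding S by (auto intro: rtrancl_into_rtrancl)
      have "{u, v} \<notin> {e \<in> A. e \<subseteq> T}" using v by simp
      then have "Suc (card {e \<in> A. e \<subseteq> T}) = card (insert {u, v} {e \<in> A. e \<subseteq> T})"
        using fin(2) by simp
      also have "\<dots> \<le> card {e \<in> A. e \<subseteq> insert v T}"
        by (rule card_mono) (use fin(2) uv step.IH in auto)
      finally have "card (insert v T) \<le> card {e \<in> A. e \<subseteq> insert v T} + 1" using TS(3) v fT by simp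
      then have "P (insert v T)" unfolding P_def using TS(1,2) vS by simp
      then have "card (insert v T) \<le> card T" using mx by blast
      then show False using v fT by simp
    qed
  qed
  then have "S \<subseteq> T" unfolding S by auto
  then show ?thesis using TS by (metis subset_antisym)
qed

text \<open>A component of maximum degree two is a path or a cycle, so at most two of its vertices have
  degree at most one.\<close>

lemma component_ends:
  assumes fA: "finite A" and c2: "\<And>e. e \<in> A \<Longrightarrow> card e = 2"
    and deg: "\<And>v. card {e \<in> A. v \<in> e} \<le> 2"
    and S: "S = {(u, v). {u, v} \<in> A}\<^sup>* `` {x}"
    and in_S: "{x, y, z} \<subseteq> S" and dist: "x \<noteq> y" "x \<noteq> z" "y \<noteq> z"
    and ends: "\<And>v. v \<in> {x, y, z} \<Longrightarrow> card {e \<in> A. v \<in> e} \<le> 1"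
  shows False
proof -
  have "S \<subseteq> insert x (\<Union>A)"
  proof
    fix v assume "v \<in> S"
    then have "(x, v) \<in> {(u, v). {u, v} \<in> A}\<^sup>*" unfolding S by simp
    then show "v \<in> insert x (\<Union>A)" by (induction rule: rtrancl_induct) auto
  qed
  then have fS: "finite S" using finite_vertices[OF fA c2] finite_subset by blast
  let ?B = "{e \<in> A. e \<subseteq> S}"
  have "2 * card ?B = (\<Sum>v\<in>\<Union>?B. card {e \<in> ?B. v \<in> e})"
    by (rule handshake[symmetric]) (use fA c2 in auto)
  also have "\<dots> \<le> (\<Sum>v\<in>S. card {e \<in> ?B. v \<in> e})"
    by (rule sum_mono2) (use fS in auto)
  also have "\<dots> \<le> (\<Sum>v\<in>S. card {e \<in> A. v \<in> e})"
    by (intro sum_mono card_mono) (use fA in auto)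
  also have "\<dots> = (\<Sum>v\<in>S - {x, y, z}. card {e \<in> A. v \<in> e}) + (\<Sum>v\<in>{x, y, z}. card {e \<in> A. v \<in> e})"
    by (rule sum.subset_diff[OF in_S fS])
  also have "\<dots> \<le> (\<Sum>v\<in>S - {x, y, z}. 2) + (\<Sum>v\<in>{x, y, z}. 1)"
    by (intro add_mono sum_mono) (use deg ends in auto)
  also have "\<dots> = 2 * card (S - {x, y, z}) + 3" using dist by simp
  finally have "2 * card ?B \<le> 2 * card (S - {x, y, z}) + 3" .
  moreover have "card (S - {x, y, z}) + 3 = card S"
    using card_Diff_subset[of "{x, y, z}" S] in_S card_mono[OF fS in_S] dist by simp
  moreover have "card S \<le> card ?B + 1" by (rule component_edges[OF fS fA S])
  ultimately show False by linarith
qed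

text \<open>Exchanging two colors on a union \<open>S\<close> of components of the two-colored subgraph changes missing
  colors only at vertices of \<open>S\<close>, and there only by exchanging the two.\<close>

lemma kempe_swap:
  assumes c: "proper F k c" and ab: "\<alpha> < k" "\<beta> < k"
    and cl: "\<And>e. e \<in> F \<Longrightarrow> c e = \<alpha> \<or> c e = \<beta> \<Longrightarrow> e \<inter> S \<noteq> {} \<Longrightarrow> e \<subseteq> S"
  shows "\<exists>c'. proper F k c' \<and> (\<forall>e\<in>F. (e \<inter> S = {} \<or> c e \<noteq> \<alpha> \<and> c e \<noteq> \<beta>) \<longrightarrow> c' e = c e) \<and>
    (\<forall>v \<gamma>. (v \<notin> S \<or> \<gamma> \<noteq> \<alpha> \<and> \<gamma> \<noteq> \<beta>) \<longrightarrow> free F c v \<gamma> \<longrightarrow> free F c' v \<gamma>) \<and>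
    (\<forall>v\<in>S. free F c v \<beta> \<longrightarrow> free F c' v \<alpha>)"
proof -
  define c' where "c' e = (if e \<inter> S \<noteq> {} then if c e = \<alpha> then \<beta> else if c e = \<beta> then \<alpha> else c e else c e)" for e
  have pr: "c e \<noteq> c f" if "e \<in> F" "f \<in> F" "e \<noteq> f" "e \<inter> f \<noteq> {}" for e f
    using c that unfolding proper_def by simp
  have "proper F k c'"
    unfolding proper_def
  proof (intro conjI ballI impI)
    fix e assume "e \<in> F"
    then have "c e < k" using c unfolding proper_def by simp
    then show "c' e < k" using ab unfolding c'_def by simp
  next
    fix e f assume ef: "e \<in> F" "f \<in> F" "e \<noteq> f" "e \<inter> f \<noteq> {}"
    have n: "c e \<noteq> c f" by (rule pr[OF ef])
    have 1: "f \<inter> S \<noteq> {}" if "e \<inter> S \<noteq> {}" "c e = \<alpha> \<or> c e = \<beta>"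
      using cl[OF ef(1) that(2,1)] ef(4) by blast
    have 2: "e \<inter> S \<noteq> {}" if "f \<inter> S \<noteq> {}" "c f = \<alpha> \<or> c f = \<beta>"
      using cl[OF ef(2) that(2,1)] ef(4) by blast
    show "c' e \<noteq> c' f"
      using n 1 2 unfolding c'_def by (simp split: if_splits) metis
  qed
  moreover have "\<forall>e\<in>F. (e \<inter> S = {} \<or> c e \<noteq> \<alpha> \<and> c e \<noteq> \<beta>) \<longrightarrow> c' e = c e"
    unfolding c'_def by simp
  moreover have "free F c' v \<gamma>" if v: "v \<notin> S \<or> \<gamma> \<noteq> \<alpha> \<and> \<gamma> \<noteq> \<beta>" and fr: "free F c v \<gamma>" for v \<gamma>
    unfolding free_def
  proof (intro ballI impI)
    fix e assume e: "e \<in> F" "v \<in> e"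
    have n: "c e \<noteq> \<gamma>" by (rule freeD[OF fr e])
    from v show "c' e \<noteq> \<gamma>"
    proof
      assume "v \<notin> S"
      then have "\<not> e \<subseteq> S" using e(2) by blast
      then have "e \<inter> S = {} \<or> \<not> (c e = \<alpha> \<or> c e = \<beta>)" using cl[OF e(1)] by blast
      then show ?thesis using n unfolding c'_def by auto
    next
      assume "\<gamma> \<noteq> \<alpha> \<and> \<gamma> \<noteq> \<beta>"
      then show ?thesis using n unfolding c'_def by simp
    qed
  qed
  moreover have "free F c' v \<alpha>" if v: "v \<in> S" and fr: "free F c v \<beta>" for v
    unfolding free_def
  proof (intro ballI impI)
    fix e assume e: "e \<in> F" "v \<in> e"
    have n: "c e \<noteq> \<beta>" by (rule freeD[OF fr e])
    have "e \<inter> S \<noteq> {}" using e(2) v by blast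
    then show "c' e \<noteq> \<alpha>" using n unfolding c'_def by auto
  qed
  ultimately show ?thesis by blast
qed

text \<open>Take a maximal fan, a color \<open>\<alpha>\<close> missing at its center \<open>x\<close> and a color \<open>\<beta>\<close> missing at its last
  vertex. By maximality the edge at \<open>x\<close> of color \<open>\<beta>\<close> belongs to the fan, say it follows \<open>y j\<close>. The
  three vertices \<open>x\<close>, \<open>y j\<close> and \<open>y m\<close> each miss one of the two colors, so they are not all in one
  component of the subgraph of these colors. Swapping colors in the component of \<open>y j\<close> or of \<open>y m\<close>
  makes \<open>\<alpha>\<close> missing at both ends of a fan.\<close>

lemma vizing_extend:
  assumes fF: "finite F" and c2: "\<And>e. e \<in> F \<Longrightarrow> card e = 2"
    and deg: "\<And>v. card {e \<in> F. v \<in> e} < k"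
    and c: "proper F k c" and x: "{x, y0} \<notin> F" "x \<noteq> y0"
  shows "\<exists>c'. proper (insert {x, y0} F) k c'"
proof (rule ccontr)
  assume no: "\<not> ?thesis"
  define Q where "Q m \<longleftrightarrow> (\<exists>y. fan F c x y m \<and> y 0 = y0)" for m
  have "fan F c x (\<lambda>_. y0) 0" unfolding fan_def using x by auto
  then have "Q 0" unfolding Q_def by blast
  moreover have "m < Suc (card F)" if Qm: "Q m" for m
  proof -
    obtain y where y: "fan F c x y m" using Qm unfolding Q_def by blast
    have inj: "inj_on (\<lambda>i. {x, y (Suc i)}) {..<m}"
    proof (rule inj_onI)
      fix i j assume ij: "i \<in> {..<m}" "j \<in> {..<m}" "{x, y (Suc i)} = {x, y (Suc j)}"
      have "y (Suc i) = y (Suc j)" using ij(3) by (auto simp: doubleton_eq_iff)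
      then show "i = j" using y ij(1,2) inj_onD[of y "{..m}" "Suc i" "Suc j"] unfolding fan_def by simp
    qed
    have "(\<lambda>i. {x, y (Suc i)}) ` {..<m} \<subseteq> F" using y unfolding fan_def by auto
    then have "card {..<m} \<le> card F" by (rule card_inj_on_le[OF inj _ fF])
    then show ?thesis by simp
  qed
  ultimately have "\<exists>m. Q m \<and> (\<forall>n. Q n \<longrightarrow> n \<le> m)"
    using ex_has_greatest_nat[of Q 0 "\<lambda>x. x" "Suc (card F)"] by simp
  then obtain m where m: "Q m" "\<forall>n. Q n \<longrightarrow> n \<le> m" by blast
  obtain y where y: "fan F c x y m" "y 0 = y0" using m(1) unfolding Q_def by blast
  note fn = y(1)[unfolded fan_def]
  have inj: "inj_on y {..m}" and xy: "x \<notin> y ` {..m}" using fn by auto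
  have prefix: "fan F c x y n" if "n \<le> m" for n
    using fn that unfolding fan_def by (auto intro: inj_on_subset)
  have norot: False if "proper F k c'" "fan F c' x y n" "\<gamma> < k" "free F c' x \<gamma>" "free F c' (y n) \<gamma>" for c' n \<gamma>
    using fan_rotate[OF that] no y(2) by simp
  obtain \<alpha> where a: "\<alpha> < k" "free F c x \<alpha>" using free_color[OF fF deg] by blast
  obtain \<beta> where b: "\<beta> < k" "free F c (y m) \<beta>" using free_color[OF fF deg] by blast
  have "\<not> free F c x \<beta>" using norot[OF c y(1) b(1) _ b(2)] by blast
  then obtain e where e: "e \<in> F" "x \<in> e" "c e = \<beta>" unfolding free_def by blast
  obtain p q where pq: "e = {p, q}" "p \<noteq> q" using c2[OF e(1)] by (meson card_2_iff)
  then obtain z where z: "e = {x, z}" "z \<noteq> x" using e(2) by (cases "p = x") auto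
  have ab: "\<alpha> \<noteq> \<beta>" using freeD[OF a(2) e(1,2)] e(3) by simp
  have "z \<in> y ` {..m}"
  proof (rule ccontr)
    assume zn: "z \<notin> y ` {..m}"
    let ?y = "y(Suc m := z)"
    have "fan F c x ?y (Suc m)"
      unfolding fan_def
    proof (intro conjI allI impI)
      show "inj_on ?y {..Suc m}"
      proof (rule inj_onI)
        fix i j assume ij: "i \<in> {..Suc m}" "j \<in> {..Suc m}" "?y i = ?y j"
        have z: "y l \<noteq> z" if "l \<le> m" for l using zn that by auto
        show "i = j" using ij z[of i] z[of j] inj_onD[OF inj, of i j]
          by (auto split: if_splits simp: le_Suc_eq)
      qed
      show "x \<notin> ?y ` {..Suc m}" using xy z(2) by (auto simp: le_Suc_eq)
      show "{x, ?y 0} \<notin> F" using fn by simp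
      fix i assume i: "i < Suc m"
      show "{x, ?y (Suc i)} \<in> F" using fn i e(1) z(1) by (cases "i = m") auto
      show "free F c (?y i) (c {x, ?y (Suc i)})"
        using fn i e(3) z(1) b(2) by (cases "i = m") auto
    qed
    then have "Q (Suc m)" unfolding Q_def using y(2) by (intro exI[of _ ?y]) simp
    then show False using m(2) by fastforce
  qed
  then obtain j' where j': "j' \<le> m" "z = y j'" by auto
  have "j' \<noteq> 0"
  proof
    assume "j' = 0"
    then have "{x, y0} \<in> F" using j'(2) e(1) z(1) y(2) by simp
    then show False using x(1) by simp
  qed
  then obtain j where j: "j' = Suc j" by (cases j') auto
  have jm: "j < m" and zj: "z = y (Suc j)" using j' j by auto
  have cj: "c {x, y (Suc j)} = \<beta>" using e(3) z(1) zj by simp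
  have bj: "free F c (y j) \<beta>" using fn jm cj by auto
  have onlyj: "c {x, y (Suc i)} \<noteq> \<beta>" "c {x, y (Suc i)} \<noteq> \<alpha>" if i: "i < m" "i \<noteq> j" for i
  proof -
    have iF: "{x, y (Suc i)} \<in> F" using fn i by blast
    have "y (Suc i) \<noteq> y (Suc j)" using inj_onD[OF inj, of "Suc i" "Suc j"] i jm by auto
    then have "{x, y (Suc i)} \<noteq> e" using z(1) zj by (auto simp: doubleton_eq_iff)
    then show "c {x, y (Suc i)} \<noteq> \<beta>" using properD[OF c iF e(1) _ _ e(2)] e(3) by simp
    show "c {x, y (Suc i)} \<noteq> \<alpha>" using freeD[OF a(2) iF] by simp
  qed
  define A where "A = {e \<in> F. c e = \<alpha> \<or> c e = \<beta>}"
  define comp where "comp v = {(u, v). {u, v} \<in> A}\<^sup>* `` {v}" for v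
  have fA: "finite A" and cA: "\<And>e. e \<in> A \<Longrightarrow> card e = 2" using fF c2 unfolding A_def by auto
  have symR: "sym ({(u, v). {u, v} \<in> A}\<^sup>*)"
    by (rule sym_rtrancl) (simp add: sym_def insert_commute)
  have compsym: "u \<in> comp v \<longleftrightarrow> v \<in> comp u" for u v
    unfolding comp_def using symD[OF symR] by auto
  have comptrans: "w \<in> comp u" if "v \<in> comp u" "w \<in> comp v" for u v w
    using that unfolding comp_def by (auto intro: rtrancl_trans)
  have self: "v \<in> comp v" for v unfolding comp_def by simp
  have closed: "f \<subseteq> comp v" if f: "f \<in> F" "c f = \<alpha> \<or> c f = \<beta>" "f \<inter> comp v \<noteq> {}" for f v
  proof -
    have fA: "f \<in> A" using f unfolding A_def by simp
    obtain p q where pq: "f = {p, q}" using cA[OF fA] by (meson card_2_iff)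
    have "p \<in> comp q" "q \<in> comp p" using fA unfolding pq comp_def by (auto simp: insert_commute)
    then show ?thesis using f(3) comptrans[of _ v] unfolding pq by blast
  qed
  have degA: "card {e \<in> A. v \<in> e} \<le> 2" for v
  proof -
    have "inj_on c {e \<in> A. v \<in> e}"
      by (rule inj_onI) (use properD[OF c, of _ _ v] in \<open>auto simp: A_def\<close>)
    moreover have "c ` {e \<in> A. v \<in> e} \<subseteq> {\<alpha>, \<beta>}" unfolding A_def by auto
    ultimately have "card {e \<in> A. v \<in> e} \<le> card {\<alpha>, \<beta>}" by (intro card_inj_on_le) auto
    then show ?thesis using ab by simp
  qed
  have degA1: "card {e \<in> A. v \<in> e} \<le> 1" if "free F c v \<gamma>" "\<gamma> = \<alpha> \<or> \<gamma> = \<beta>" for v \<gamma>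
  proof -
    have "inj_on c {e \<in> A. v \<in> e}"
      by (rule inj_onI) (use properD[OF c, of _ _ v] in \<open>auto simp: A_def\<close>)
    moreover have "c ` {e \<in> A. v \<in> e} \<subseteq> {\<alpha>, \<beta>} - {\<gamma>}" using freeD[OF that(1)] unfolding A_def by auto
    ultimately have "card {e \<in> A. v \<in> e} \<le> card ({\<alpha>, \<beta>} - {\<gamma>})" by (intro card_inj_on_le) auto
    then show ?thesis using that(2) ab by auto
  qed
  have dist: "x \<noteq> y j" "x \<noteq> y m" "y j \<noteq> y m"
    using xy jm inj_onD[OF inj, of j m] by auto
  have fj: "free F c (y i) (c {x, y (Suc i)})" "{x, y (Suc i)} \<in> F" if "i < m" for i using fn that by auto
  \<comment> \<open>If \<open>y j\<close> is not in the component of \<open>x\<close>, the fan is cut off at \<open>y j\<close>; otherwise \<open>y m\<close> is not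
     in it, and the full fan survives the exchange.\<close>
  show False
  proof (cases "y j \<in> comp x")
    case False
    define S where "S = comp (y j)"
    have xS: "x \<notin> S" using False compsym unfolding S_def by blast
    have "\<exists>c'. proper F k c' \<and> (\<forall>e\<in>F. (e \<inter> S = {} \<or> c e \<noteq> \<alpha> \<and> c e \<noteq> \<beta>) \<longrightarrow> c' e = c e) \<and>
      (\<forall>v \<gamma>. (v \<notin> S \<or> \<gamma> \<noteq> \<alpha> \<and> \<gamma> \<noteq> \<beta>) \<longrightarrow> free F c v \<gamma> \<longrightarrow> free F c' v \<gamma>) \<and>
      (\<forall>v\<in>S. free F c v \<beta> \<longrightarrow> free F c' v \<alpha>)"
      by (rule kempe_swap[OF c a(1) b(1)]) (use closed in \<open>simp add: S_def\<close>)
    then obtain c' where c': "proper F k c'"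
      "\<forall>e\<in>F. (e \<inter> S = {} \<or> c e \<noteq> \<alpha> \<and> c e \<noteq> \<beta>) \<longrightarrow> c' e = c e"
      "\<forall>v \<gamma>. (v \<notin> S \<or> \<gamma> \<noteq> \<alpha> \<and> \<gamma> \<noteq> \<beta>) \<longrightarrow> free F c v \<gamma> \<longrightarrow> free F c' v \<gamma>"
      "\<forall>v\<in>S. free F c v \<beta> \<longrightarrow> free F c' v \<alpha>" by (elim exE conjE)
    have "fan F c' x y j"
      unfolding fan_def
    proof (intro conjI allI impI)
      show "inj_on y {..j}" "x \<notin> y ` {..j}" "{x, y 0} \<notin> F" using prefix[of j] jm unfolding fan_def by auto
      fix i assume i: "i < j"
      then have im: "i < m" "i \<noteq> j" using jm by auto
      show iF: "{x, y (Suc i)} \<in> F" by (rule fj(2)[OF im(1)])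
      have "c' {x, y (Suc i)} = c {x, y (Suc i)}" using c'(2) iF onlyj[OF im] by blast
      then show "free F c' (y i) (c' {x, y (Suc i)})" using c'(3) onlyj[OF im] fj(1)[OF im(1)] by simp
    qed
    moreover have "free F c' x \<alpha>" using c'(3) xS a(2) by blast
    moreover have "free F c' (y j) \<alpha>" using c'(4) bj self unfolding S_def by blast
    ultimately show False using norot[OF c'(1) _ a(1)] by blast
  next
    case True
    have ym: "y m \<notin> comp x"
    proof
      assume "y m \<in> comp x"
      then have sub: "{x, y j, y m} \<subseteq> comp x" using True self by simp
      have ends: "card {e \<in> A. v \<in> e} \<le> 1" if "v \<in> {x, y j, y m}" for v
        using that degA1[OF a(2)] degA1[OF b(2)] degA1[OF bj] by auto
      show False
        by (rule component_ends[OF fA cA degA comp_def sub dist ends])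
    qed
    define S where "S = comp (y m)"
    have xS: "x \<notin> S" using ym compsym unfolding S_def by blast
    have jS: "y j \<notin> S"
    proof
      assume "y j \<in> S"
      then have "y m \<in> comp (y j)" using compsym unfolding S_def by blast
      then show False using comptrans[OF True] ym by blast
    qed
    have "\<exists>c'. proper F k c' \<and> (\<forall>e\<in>F. (e \<inter> S = {} \<or> c e \<noteq> \<alpha> \<and> c e \<noteq> \<beta>) \<longrightarrow> c' e = c e) \<and>
      (\<forall>v \<gamma>. (v \<notin> S \<or> \<gamma> \<noteq> \<alpha> \<and> \<gamma> \<noteq> \<beta>) \<longrightarrow> free F c v \<gamma> \<longrightarrow> free F c' v \<gamma>) \<and>
      (\<forall>v\<in>S. free F c v \<beta> \<longrightarrow> free F c' v \<alpha>)"
      by (rule kempe_swap[OF c a(1) b(1)]) (use closed in \<open>simp add: S_def\<close>)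
    then obtain c' where c': "proper F k c'"
      "\<forall>e\<in>F. (e \<inter> S = {} \<or> c e \<noteq> \<alpha> \<and> c e \<noteq> \<beta>) \<longrightarrow> c' e = c e"
      "\<forall>v \<gamma>. (v \<notin> S \<or> \<gamma> \<noteq> \<alpha> \<and> \<gamma> \<noteq> \<beta>) \<longrightarrow> free F c v \<gamma> \<longrightarrow> free F c' v \<gamma>"
      "\<forall>v\<in>S. free F c v \<beta> \<longrightarrow> free F c' v \<alpha>" by (elim exE conjE)
    have same: "c' {x, y (Suc i)} = c {x, y (Suc i)}" if i: "i < m" for i
    proof (cases "c {x, y (Suc i)} = \<alpha> \<or> c {x, y (Suc i)} = \<beta>")
      case True
      have "{x, y (Suc i)} \<inter> S = {}"
        using closed[OF fj(2)[OF i] True, of "y m"] xS unfolding S_def by blast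
      then show ?thesis using c'(2) fj(2)[OF i] by blast
    next
      case False
      then show ?thesis using c'(2) fj(2)[OF i] by blast
    qed
    have "fan F c' x y m"
      unfolding fan_def
    proof (intro conjI allI impI)
      show "inj_on y {..m}" "x \<notin> y ` {..m}" "{x, y 0} \<notin> F" using fn by auto
      fix i assume i: "i < m"
      show iF: "{x, y (Suc i)} \<in> F" by (rule fj(2)[OF i])
      show "free F c' (y i) (c' {x, y (Suc i)})"
      proof (cases "i = j")
        case True
        then show ?thesis using c'(3) jS fj(1)[OF i] same[OF i] by simp
      next
        case False
        then show ?thesis using c'(3) onlyj[OF i False] fj(1)[OF i] same[OF i] by simp
      qed
    qed
    moreover have "free F c' x \<alpha>" using c'(3) xS a(2) by blast
    moreover have "free F c' (y m) \<alpha>" using c'(4) b(2) self unfolding S_def by blast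
    ultimately show False using norot[OF c'(1) _ a(1)] by blast
  qed
qed

theorem vizing:
  assumes "finite F" "\<And>e. e \<in> F \<Longrightarrow> card e = 2" "\<And>v. card {e \<in> F. v \<in> e} \<le> D"
  shows "\<exists>c. proper F (Suc D) c"
  using assms
proof (induction F rule: finite_induct)
  case empty
  show ?case by (simp add: proper_def)
next
  case (insert e F)
  have deg: "card {e \<in> F. v \<in> e} \<le> D" for v
  proof -
    have "card {e \<in> F. v \<in> e} \<le> card {f \<in> insert e F. v \<in> f}"
      by (rule card_mono) (use insert.hyps in auto)
    then show ?thesis using insert.prems(2)[of v] by linarith
  qed
  have "\<exists>c. proper F (Suc D) c" by (rule insert.IH) (use insert.prems deg in simp_all)
  then obtain c where c: "proper F (Suc D) c" by blast
  obtain x y where xy: "e = {x, y}" "x \<noteq> y" using insert.prems(1)[of e] by (metis card_2_iff insertI1)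
  show ?case
    unfolding xy(1)
    by (rule vizing_extend[OF insert.hyps(1) _ _ c _ xy(2)])
      (use insert.prems(1) insert.hyps(2) xy(1) deg in \<open>auto simp: less_Suc_eq_le\<close>)
qed

lemma edges_at_vertex:
  assumes "\<And>e. e \<in> E \<Longrightarrow> card e = 2"
  shows "{e \<in> E. v \<in> e} = (\<lambda>w. {v, w}) ` neighbors E v" and "card {e \<in> E. v \<in> e} = card (neighbors E v)"
proof -
  show *: "{e \<in> E. v \<in> e} = (\<lambda>w. {v, w}) ` neighbors E v"
  proof (intro equalityI subsetI)
    fix e assume e: "e \<in> {e \<in> E. v \<in> e}"
    then have "card e = 2" using assms by simp
    then obtain p q where pq: "e = {p, q}" by (meson card_2_iff)
    then have "e = {v, p} \<or> e = {v, q}" using e by auto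
    then show "e \<in> (\<lambda>w. {v, w}) ` neighbors E v" using e unfolding neighbors_def by blast
  qed (auto simp: neighbors_def)
  have "inj_on (\<lambda>w. {v, w}) (neighbors E v)" by (rule inj_onI) (auto simp: doubleton_eq_iff)
  then show "card {e \<in> E. v \<in> e} = card (neighbors E v)" unfolding * by (rule card_image)
qed

text \<open>If any two vertices have at most one common neighbor, there are no 4-cycles, and only incident
  edges are in conflict.\<close>

theorem coloring_no_four_cycle:
  assumes "simple_graph V E" and deg: "\<And>v. card (neighbors E v) \<le> D"
    and codeg: "\<And>u v. u \<noteq> v \<Longrightarrow> card (neighbors E u \<inter> neighbors E v) \<le> 1"
  shows "\<exists>c. coloring E E (D + 1) c"
proof -
  have c2: "\<And>e. e \<in> E \<Longrightarrow> card e = 2" and EV: "\<And>e. e \<in> E \<Longrightarrow> e \<subseteq> V" and fV: "finite V"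
    using assms(1) unfolding simple_graph_def by auto
  have "E \<subseteq> Pow V" using EV by blast
  then have fE: "finite E" using fV finite_subset by blast
  have "\<exists>c. proper E (Suc D) c"
    by (rule vizing[OF fE c2]) (use deg edges_at_vertex(2)[OF c2] in auto)
  then obtain c where c: "proper E (Suc D) c" by blast
  have empty: "opposite E u v = {}" if "u \<noteq> v" "{u, v} \<in> E" for u v
  proof (rule ccontr)
    assume "opposite E u v \<noteq> {}"
    then obtain f where f: "f \<in> opposite E u v" by blast
    obtain x w where xw: "{u, x} \<in> E" "{v, w} \<in> E" "{x, w} \<in> E" "x \<noteq> v" "w \<noteq> u"
      using oppositeD[OF f] by (elim exE conjE)
    have "{u, w} \<subseteq> neighbors E v \<inter> neighbors E x"
      using xw that unfolding neighbors_def by (simp add: insert_commute)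
    moreover have "finite (neighbors E v \<inter> neighbors E x)"
      by (rule finite_subset[OF _ fV]) (use EV in \<open>auto simp: neighbors_def\<close>)
    ultimately have "card {u, w} \<le> 1" using codeg[OF xw(4)[symmetric]] card_mono le_trans by blast
    then show False using xw(5) by simp
  qed
  have "coloring E E (Suc D) c"
    unfolding coloring_def
  proof (intro conjI ballI impI)
    fix e assume "e \<in> E" then show "c e < Suc D" using c unfolding proper_def by simp
  next
    fix e f assume ef: "e \<in> E" "f \<in> E" "conflict E e f"
    obtain u v where uv: "e = {u, v}" "u \<noteq> v" using c2[OF ef(1)] by (meson card_2_iff)
    have "opposite E u v = {}" by (rule empty) (use uv ef in auto)
    then have "f \<noteq> e \<and> e \<inter> f \<noteq> {}" using ef(3) unfolding uv(1) conflict_edge by auto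
    then show "c e \<noteq> c f" using c ef(1,2) unfolding proper_def by auto
  qed
  then show ?thesis by auto
qed

section \<open>Counting conflicts in a planar graph with few common neighbors\<close>

lemma card_UN_image_le:
  assumes "finite A" "\<And>x. x \<in> A \<Longrightarrow> finite (B x)" "M \<subseteq> (\<Union>x\<in>A. h x ` B x)"
  shows "card M \<le> (\<Sum>x\<in>A. card (B x))"
proof -
  have "card M \<le> card (\<Union>x\<in>A. h x ` B x)"
    by (rule card_mono[OF _ assms(3)]) (use assms(1,2) in auto)
  also have "\<dots> \<le> (\<Sum>x\<in>A. card (h x ` B x))" by (rule card_UN_le[OF assms(1)])
  also have "\<dots> \<le> (\<Sum>x\<in>A. card (B x))" by (intro sum_mono card_image_le assms(2))
  finally show ?thesis .
qed

lemma planar_subset: "planar V E \<Longrightarrow> E' \<subseteq> E \<Longrightarrow> planar V E'"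
proof -
  assume "planar V E" and sub: "E' \<subseteq> E"
  then obtain p g where "plane_drawing V E p g" unfolding planar_def by blast
  then have "plane_drawing V E' p g" using sub unfolding plane_drawing_def by (simp add: subset_iff)
  then show "planar V E'" unfolding planar_def by blast
qed

locale bounded_graph = planar_graph V E for V :: "'a set" and E +
  fixes D s :: nat
  assumes deg: "card (neighbors E v) \<le> D"
    and codeg: "u \<noteq> v \<Longrightarrow> card (neighbors E u \<inter> neighbors E v) \<le> s"

context bounded_graph
begin

abbreviation N where "N \<equiv> neighbors E"

lemma N_V: "N v \<subseteq> V"
  using edgeV unfolding neighbors_def by auto

lemma finN: "finite (N v)"
  by (rule finite_subset[OF N_V finV])

lemma N_irrefl: "v \<notin> N v"
  using edge2[of "{v}"] unfolding neighbors_def by auto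

lemma N_sym: "u \<in> N v \<Longrightarrow> v \<in> N u"
  by (simp add: neighbors_sym)

lemma edge_neq: "{u, v} \<in> E \<Longrightarrow> u \<noteq> v"
  using edge2 by force

lemma subgraph: "E' \<subseteq> E \<Longrightarrow> bounded_graph V E' D s"
proof
  assume sub: "E' \<subseteq> E"
  show "simple_graph V E'" using sg sub unfolding simple_graph_def by blast
  show "planar V E'" by (rule planar_subset[OF pl sub])
  have N': "neighbors E' v \<subseteq> N v" for v using sub unfolding neighbors_def by blast
  show "card (neighbors E' v) \<le> D" for v
    using card_mono[OF finN N'] deg le_trans by blast
  show "card (neighbors E' u \<inter> neighbors E' v) \<le> s" if "u \<noteq> v" for u v
  proof -
    have "card (neighbors E' u \<inter> neighbors E' v) \<le> card (N u \<inter> N v)"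
      by (rule card_mono) (use finN N' in auto)
    then show ?thesis using codeg[OF that] by linarith
  qed
qed

lemma card_edges_at: "card {e \<in> E. v \<in> e} = card (N v)"
  by (rule edges_at_vertex(2)[OF edge2])

lemma conflict_split:
  "{f \<in> F. conflict E {u, v} f} \<subseteq>
    {f \<in> F. u \<in> f \<and> f \<noteq> {u, v}} \<union> {f \<in> F. v \<in> f \<and> f \<noteq> {u, v}} \<union> (F \<inter> opposite E u v)"
  unfolding conflict_edge by blast

lemma edge_at:
  assumes "e \<in> E" "v \<in> e"
  shows "\<exists>w. e = {v, w} \<and> w \<in> N v"
proof -
  have "e \<in> (\<lambda>w. {v, w}) ` N v" using assms by (simp add: edges_at_vertex(1)[OF edge2, symmetric])
  then show ?thesis by blast
qed

lemma card_star_le: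
  assumes "F \<subseteq> E" "\<And>w. {u, w} \<in> F \<Longrightarrow> w \<noteq> v \<Longrightarrow> w \<in> B" "finite B"
  shows "card {f \<in> F. u \<in> f \<and> f \<noteq> {u, v}} \<le> card B"
proof -
  have "{f \<in> F. u \<in> f \<and> f \<noteq> {u, v}} \<subseteq> (\<lambda>w. {u, w}) ` B"
  proof
    fix f assume f: "f \<in> {f \<in> F. u \<in> f \<and> f \<noteq> {u, v}}"
    then have "f \<in> E" "u \<in> f" using assms(1) by auto
    then obtain w where w: "f = {u, w}" using edge_at by blast
    then show "f \<in> (\<lambda>w. {u, w}) ` B" using f assms(2)[of w] by blast
  qed
  then have "card {f \<in> F. u \<in> f \<and> f \<noteq> {u, v}} \<le> card ((\<lambda>w. {u, w}) ` B)"
    by (intro card_mono) (use assms(3) in auto)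
  also have "\<dots> \<le> card B" by (rule card_image_le[OF assms(3)])
  finally show ?thesis .
qed

lemma card_star_full:
  assumes "F \<subseteq> E" "{u, v} \<in> E"
  shows "card {f \<in> F. u \<in> f \<and> f \<noteq> {u, v}} \<le> card (N u) - 1"
proof -
  have "card {f \<in> F. u \<in> f \<and> f \<noteq> {u, v}} \<le> card (N u - {v})"
    by (rule card_star_le[OF assms(1)]) (use assms(1) finN in \<open>auto simp: neighbors_def\<close>)
  then show ?thesis using assms(2) by (simp add: neighbors_def)
qed

lemma opposite_subset:
  assumes "F \<subseteq> E" "\<And>x w. {x, w} \<in> F \<Longrightarrow> x \<in> N u - {v} \<Longrightarrow> w \<in> N v - {u} \<Longrightarrow> x \<in> A \<and> w \<in> B x"
  shows "F \<inter> opposite E u v \<subseteq> (\<Union>x\<in>A. (\<lambda>w. {x, w}) ` B x)"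
proof
  fix f assume f: "f \<in> F \<inter> opposite E u v"
  then have "f \<in> opposite E u v" by blast
  then obtain x w where xw: "f = {x, w}" "x \<in> N u - {v}" "w \<in> N v - {u}"
    unfolding opposite_def by auto
  have "x \<in> A \<and> w \<in> B x" by (rule assms(2)[OF _ xw(2,3)]) (use f xw(1) in simp)
  then show "f \<in> (\<Union>x\<in>A. (\<lambda>w. {x, w}) ` B x)" using xw(1) by blast
qed

lemma conflict_card:
  assumes "F \<subseteq> E" "{u, v} \<in> E"
  shows "card {f \<in> F. conflict E {u, v} f} \<le>
    card {f \<in> F. u \<in> f \<and> f \<noteq> {u, v}} + card {f \<in> F. v \<in> f \<and> f \<noteq> {u, v}} + card (F \<inter> opposite E u v)"
proof -
  have fF: "finite F" using assms(1) finE finite_subset by blast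
  let ?A = "{f \<in> F. u \<in> f \<and> f \<noteq> {u, v}}" and ?B = "{f \<in> F. v \<in> f \<and> f \<noteq> {u, v}}"
  have "card {f \<in> F. conflict E {u, v} f} \<le> card (?A \<union> ?B \<union> (F \<inter> opposite E u v))"
    by (rule card_mono[OF _ conflict_split]) (use fF in auto)
  also have "\<dots> \<le> card (?A \<union> ?B) + card (F \<inter> opposite E u v)" by (rule card_Un_le)
  also have "\<dots> \<le> card ?A + card ?B + card (F \<inter> opposite E u v)" using card_Un_le[of ?A ?B] by simp
  finally show ?thesis .
qed

text \<open>The edges between \<open>A\<close> and \<open>B\<close>, together with all edges from \<open>a\<close> to \<open>B\<close>, from \<open>u\<close> to \<open>A\<close> and
  the edge \<open>{u, a}\<close>, form a bipartite planar graph.\<close>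

lemma two_apex_bound:
  assumes "{u, a} \<in> E" "A \<subseteq> N u" "B \<subseteq> N a" "A \<inter> B = {}" "u \<notin> B" "a \<notin> A" "A \<noteq> {}"
  shows "(\<Sum>p\<in>A. card (N p \<inter> B)) + 1 \<le> card A + card B"
proof -
  have fin: "finite A" "finite B" using assms(2,3) finN finite_subset by blast+
  have uA: "u \<notin> A" and aB: "a \<notin> B" and ua: "u \<noteq> a" using assms N_irrefl edge_neq by blast+
  have V: "insert a A \<subseteq> V" "insert u B \<subseteq> V" using assms(1-3) N_V edgeV by blast+
  have "(\<Sum>p\<in>insert a A. card (N p \<inter> insert u B)) + 4 \<le> 2 * (card (insert a A) + card (insert u B))"
  proof (rule planar_bipartite(2)[OF V])
    show "insert a A \<inter> insert u B = {}" using assms uA aB ua by blast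
    have "card A \<ge> 1" using fin assms(7) by (simp add: Suc_le_eq card_gt_0_iff)
    then show "3 \<le> card (insert a A) + card (insert u B)" using assms fin by simp
  qed
  moreover have "card (N p \<inter> insert u B) = card (N p \<inter> B) + 1" if "p \<in> A" for p
  proof -
    have "u \<in> N p" using that assms(2) N_sym by blast
    then have "N p \<inter> insert u B = insert u (N p \<inter> B)" by blast
    then show ?thesis using assms(5) fin by simp
  qed
  moreover have "card (N a \<inter> insert u B) = card B + 1"
  proof -
    have "u \<in> N a" using assms(1) by (simp add: neighbors_def insert_commute)
    then have "N a \<inter> insert u B = insert u B" using assms(3) by blast
    then show ?thesis using assms(5) fin by simp
  qed
  ultimately have "(\<Sum>p\<in>A. card (N p \<inter> B) + 1) + (card B + 1) + 4 \<le> 2 * (card A + 1 + (card B + 1))"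
    using fin assms(5,6) by simp
  moreover have "(\<Sum>p\<in>A. card (N p \<inter> B) + 1) = (\<Sum>p\<in>A. card (N p \<inter> B)) + card A"
    using sum_Suc[of "\<lambda>p. card (N p \<inter> B)" A] by simp
  ultimately show ?thesis by presburger
qed

lemma low_degree_vertex:
  assumes "E \<noteq> {}"
  shows "\<exists>u. N u \<noteq> {} \<and> card (N u) \<le> 5"
proof (rule ccontr)
  assume no: "\<not> ?thesis"
  let ?S = "\<Union>E"
  have S: "?S \<subseteq> V" by (rule Union_least) (rule edgeV)
  have fS: "finite ?S" by (rule finite_subset[OF S finV])
  have ne: "?S \<noteq> {}"
  proof -
    obtain e where e: "e \<in> E" using assms by blast
    have "e \<noteq> {}" using edge2[OF e] by (metis card.empty zero_neq_numeral)
    then show ?thesis using e by blast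
  qed
  have six: "6 \<le> card {e \<in> E. v \<in> e}" if "v \<in> ?S" for v
  proof -
    have "N v \<noteq> {}" using that edge_at by blast
    then have "\<not> card (N v) \<le> 5" using no by blast
    then show ?thesis using card_edges_at by simp
  qed
  have "(\<Sum>v\<in>?S. 6) \<le> (\<Sum>v\<in>?S. card {e \<in> E. v \<in> e})" by (rule sum_mono) (rule six)
  also have "\<dots> = 2 * card E" by (rule handshake[OF finE edge2])
  finally have "6 * card ?S \<le> 2 * card E" by simp
  moreover have "card E + 3 \<le> 3 * card ?S" by (rule planar_edges(1)[OF S _ ne]) blast
  ultimately show False by linarith
qed

text \<open>Let \<open>A\<close> and \<open>B\<close> be the other neighbors of \<open>u\<close> and of \<open>a\<close>. Edges from \<open>A\<close> to a vertex outside
  \<open>A\<close> are bounded by the bipartite estimate. The remaining opposite edges lie inside \<open>A\<close> and meet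
  \<open>C = A \<inter> B\<close>; there are at most \<open>3 * card C\<close> of them since \<open>A\<close> has at most four vertices, and at
  most five because \<open>A\<close> together with the common neighbor \<open>u\<close> is planar. Since the vertices of \<open>C\<close>
  are not counted in the first estimate, the two bounds combine to \<open>D + 5\<close>.\<close>

lemma opposite_low_degree:
  assumes e: "{u, a} \<in> E" and d: "card (N u) \<le> 5"
  shows "card (opposite E u a) \<le> D + 5"
proof -
  define A where "A = N u - {a}"
  define B where "B = N a - {u}"
  define B' where "B' = B - A"
  define C where "C = A \<inter> B"
  have fin: "finite A" "finite B" "finite B'" "finite C" unfolding A_def B_def B'_def C_def using finN by auto
  have aN: "a \<in> N u" "u \<in> N a" using e by (simp_all add: neighbors_def insert_commute)
  have cA: "card A \<le> 4" using d aN finN unfolding A_def by simp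
  have cB: "card B + 1 \<le> D"
    using deg[of a] aN finN card_gt_0_iff[of "N a"] unfolding B_def by (auto simp: Suc_le_eq)
  have "B = B' \<union> C" "B' \<inter> C = {}" unfolding B'_def C_def by auto
  then have cB': "card B = card B' + card C" using fin by (simp add: card_Un_disjoint)
  show ?thesis
  proof (cases "A = {}")
    case True
    then have "opposite E u a = {}" unfolding opposite_def A_def by auto
    then show ?thesis by simp
  next
    case False
    let ?I = "{f \<in> E. f \<subseteq> A \<and> f \<inter> C \<noteq> {}}"
    let ?O = "\<Union>p\<in>A. (\<lambda>q. {p, q}) ` (N p \<inter> B')"
    have sub: "opposite E u a \<subseteq> ?O \<union> ?I"
    proof
      fix f assume "f \<in> opposite E u a"
      then obtain p q where pq: "f = {p, q}" "p \<in> A" "q \<in> B" "f \<in> E"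
        unfolding opposite_def A_def B_def by blast
      show "f \<in> ?O \<union> ?I"
      proof (cases "q \<in> A")
        case True
        then show ?thesis using pq unfolding C_def by simp
      next
        case False
        then have "q \<in> N p \<inter> B'" using pq unfolding B'_def neighbors_def by simp
        then show ?thesis using pq by blast
      qed
    qed
    have "card (opposite E u a) \<le> card (?O \<union> ?I)"
      by (rule card_mono[OF _ sub]) (use fin finE finN in auto)
    also have "\<dots> \<le> card ?O + card ?I" by (rule card_Un_le)
    finally have 1: "card (opposite E u a) \<le> card ?O + card ?I" .
    have "card ?O \<le> (\<Sum>p\<in>A. card (N p \<inter> B'))"
      by (rule card_UN_image_le[OF fin(1) _ subset_refl]) (use fin in simp)
    moreover have "(\<Sum>p\<in>A. card (N p \<inter> B')) + 1 \<le> card A + card B'"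
      by (rule two_apex_bound[OF e]) (use False in \<open>auto simp: A_def B'_def B_def\<close>)
    ultimately have 2: "card ?O + 1 \<le> card A + card B'" by linarith
    have "card ?I \<le> (\<Sum>p\<in>C. card (A - {p}))"
    proof (rule card_UN_image_le)
      show "?I \<subseteq> (\<Union>p\<in>C. (\<lambda>q. {p, q}) ` (A - {p}))"
      proof
        fix f assume f: "f \<in> ?I"
        then obtain p where p: "p \<in> f" "p \<in> C" by blast
        obtain q where q: "f = {p, q}" "q \<in> N p" using edge_at[of f p] f p by blast
        then have "q \<in> A - {p}" using f N_irrefl by auto
        then show "f \<in> (\<Union>p\<in>C. (\<lambda>q. {p, q}) ` (A - {p}))" using q p by blast
      qed
    qed (use fin in auto)
    also have "\<dots> \<le> (\<Sum>p\<in>C. 3)"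
      by (rule sum_mono) (use cA in \<open>auto simp: C_def card_Diff_singleton\<close>)
    finally have 3: "card ?I \<le> 3 * card C" by simp
    have 4: "card ?I \<le> 5"
    proof (cases "card A \<le> 1")
      case True
      have "?I = {}"
      proof (rule ccontr)
        assume "?I \<noteq> {}"
        then obtain f where "f \<in> E" "f \<subseteq> A" by blast
        then have "2 \<le> card A" using edge2 card_mono[OF fin(1)] by metis
        then show False using True by simp
      qed
      then have "card ?I = 0" by (simp only: card.empty)
      then show ?thesis by linarith
    next
      case False
      have uA: "u \<notin> A" unfolding A_def using N_irrefl by simp
      have SV: "insert u A \<subseteq> V" unfolding A_def using N_V edgeV[OF e] by auto
      have star: "(\<lambda>p. {u, p}) ` A \<inter> ?I = {}" using uA by auto
      have "card (?I \<union> (\<lambda>p. {u, p}) ` A) + 6 \<le> 3 * card (insert u A)"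
        by (rule planar_edges(2)[OF SV])
          (use False uA fin in \<open>auto simp: A_def neighbors_def\<close>)
      moreover have "card (?I \<union> (\<lambda>p. {u, p}) ` A) = card ?I + card ((\<lambda>p. {u, p}) ` A)"
        by (rule card_Un_disjoint) (use star fin finE in auto)
      moreover have "card ((\<lambda>p. {u, p}) ` A) = card A"
        by (rule card_image, rule inj_onI) (auto simp: doubleton_eq_iff)
      ultimately show ?thesis using uA fin cA by simp
    qed
    show ?thesis
    proof (cases "card C = 0")
      case True
      then show ?thesis using 1 2 3 cA cB cB' by linarith
    next
      case False
      show ?thesis
      proof (cases "card C = 1")
        case True
        then show ?thesis using 1 2 3 cA cB cB' by linarith
      next
        case False
        then have "2 \<le> card C" using \<open>card C \<noteq> 0\<close> by linarith
        then show ?thesis using 1 2 4 cA cB cB' by linarith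
      qed
    qed
  qed
qed

lemma opposite_small_degrees:
  assumes e: "{x, y} \<in> E"
  shows "card (opposite E x y) \<le> 2 * (card (N x - {y}) + card (N y - {x})) - 1"
proof -
  define A where "A = N x - {y}"
  define B where "B = N y - {x}"
  have fin: "finite A" "finite B" unfolding A_def B_def using finN by auto
  have xy: "x \<noteq> y" by (rule edge_neq[OF e])
  have nin: "x \<notin> A \<union> B" "y \<notin> A \<union> B" unfolding A_def B_def using N_irrefl by auto
  show ?thesis
  proof (cases "A = {}")
    case True
    then have "opposite E x y = {}" unfolding opposite_def A_def by auto
    then show ?thesis by simp
  next
    case False
    let ?S = "{x, y} \<union> (A \<union> B)"
    let ?X = "(\<lambda>p. {x, p}) ` A" and ?Y = "(\<lambda>p. {y, p}) ` B"
    have oA: "f \<subseteq> A \<union> B \<and> f \<in> E" if "f \<in> opposite E x y" for f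
      using that unfolding opposite_def A_def B_def by blast
    have SV: "?S \<subseteq> V" unfolding A_def B_def using N_V edgeV[OF e] by auto
    have cS: "card ?S = 2 + card (A \<union> B)"
      using nin fin xy by (subst card_Un_disjoint) auto
    have "card (A \<union> B) \<ge> 1" using False fin by (simp add: Suc_le_eq card_gt_0_iff)
    then have c3: "card ?S \<ge> 3" using cS by simp
    let ?O = "insert {x, y} (opposite E x y)"
    have fO: "finite (opposite E x y)" by (rule finite_subset[OF _ finE]) (use oA in blast)
    have "{x, y} \<notin> opposite E x y" using oA[of "{x, y}"] nin by blast
    then have cO: "card ?O = card (opposite E x y) + 1" using fO by simp
    have "?O \<union> (?X \<union> ?Y) \<subseteq> {e \<in> E. e \<subseteq> ?S}"
      using oA e unfolding A_def B_def neighbors_def by auto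
    then have "card (?O \<union> (?X \<union> ?Y)) + 6 \<le> 3 * card ?S"
      by (rule planar_edges(2)[OF SV _ c3])
    moreover have "card (?O \<union> (?X \<union> ?Y)) = card ?O + card (?X \<union> ?Y)"
    proof (rule card_Un_disjoint)
      show "?O \<inter> (?X \<union> ?Y) = {}" using oA nin by (fastforce simp: doubleton_eq_iff)
    qed (use fin fO in auto)
    moreover have "card (?X \<union> ?Y) = card ?X + card ?Y"
      by (rule card_Un_disjoint) (use fin nin xy in \<open>auto simp: doubleton_eq_iff\<close>)
    moreover have "card ?X = card A" "card ?Y = card B"
      by (rule card_image, rule inj_onI, auto simp: doubleton_eq_iff)+
    moreover have "card (A \<union> B) \<le> card A + card B" by (rule card_Un_le)
    ultimately have "card (opposite E x y) + 1 \<le> 2 * (card A + card B)"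
      using cS cO by presburger
    then have "card (opposite E x y) \<le> 2 * (card A + card B) - 1" by simp
    then show ?thesis unfolding A_def B_def .
  qed
qed

text \<open>Delete a vertex of degree at most five. Each of its edges has at most \<open>2 * D + 8\<close> conflicts,
  which is less than \<open>D + s\<close> in the given range.\<close>

lemma coloring_exists_step_small_degree:
  assumes IH: "\<And>E'. E' \<subset> E \<Longrightarrow> \<exists>c. coloring E' E' (D + s) c" and D: "D \<le> 25" and s: "34 \<le> s"
  shows "\<exists>c. coloring E E (D + s) c"
proof (cases "E = {}")
  case True
  then show ?thesis unfolding coloring_def by auto
next
  case False
  obtain u where u: "N u \<noteq> {}" "card (N u) \<le> 5" using low_degree_vertex[OF False] by blast
  let ?F = "delete E {u}" and ?M = "{e \<in> E. u \<in> e}"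
  have "?M \<noteq> {}" using u(1) unfolding neighbors_def by blast
  then have "?F \<subset> E" unfolding delete_def by blast
  then obtain c where c: "coloring ?F ?F (D + s) c" using IH by blast
  have EFM: "?F \<union> ?M = E" unfolding delete_def by blast
  have "\<exists>c'. coloring E (?F \<union> ?M) (D + s) c'"
  proof (rule coloring_greedy_set[OF coloring_delete[OF c] _ _ finE edge2])
    fix e assume e: "e \<in> ?M"
    then obtain a where a': "e = {u, a}" using edge_at by blast
    then have a: "e = {u, a}" "{u, a} \<in> E" using e by auto
    have "card {f \<in> E. conflict E e f} \<le>
        card {f \<in> E. u \<in> f \<and> f \<noteq> {u, a}} + card {f \<in> E. a \<in> f \<and> f \<noteq> {u, a}} + card (E \<inter> opposite E u a)"
      unfolding a(1) by (rule conflict_card[OF subset_refl a(2)])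
    moreover have "card {f \<in> E. u \<in> f \<and> f \<noteq> {u, a}} \<le> card (N u) - 1"
      by (rule card_star_full[OF subset_refl a(2)])
    moreover have "card {f \<in> E. a \<in> f \<and> f \<noteq> {u, a}} \<le> card (N a) - 1"
      using card_star_full[OF subset_refl, of a u] a(2) by (simp add: insert_commute)
    moreover have "E \<inter> opposite E u a = opposite E u a" unfolding opposite_def by blast
    moreover have "card (opposite E u a) \<le> D + 5" by (rule opposite_low_degree[OF a(2) u(2)])
    moreover have "card (N a) \<le> D" by (rule deg)
    ultimately have "card {f \<in> E. conflict E e f} \<le> 4 + (D - 1) + (D + 5)" using u(2) by simp
    also have "\<dots> < D + s" using D s by simp
    finally show "card {f \<in> ?F \<union> ?M. conflict E e f} < D + s" unfolding EFM .
  qed (use EFM in \<open>auto simp: delete_def\<close>)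
  then show ?thesis unfolding EFM .
qed

end

section \<open>Many common neighbors: stars at vertices of large degree\<close>

lemma coloringD:
  "coloring E F k c \<Longrightarrow> e \<in> F \<Longrightarrow> f \<in> F \<Longrightarrow> conflict E e f \<Longrightarrow> c e \<noteq> c f"
  unfolding coloring_def by simp

lemma coloring_unique_at:
  assumes "coloring E F k c" "{v, w} \<in> F" "{v', w} \<in> F" "c {v, w} = c {v', w}"
  shows "v = v'"
proof (rule ccontr)
  assume "v \<noteq> v'"
  then have "{v, w} \<noteq> {v', w}" by (auto simp: doubleton_eq_iff)
  then have "conflict E {v, w} {v', w}" unfolding conflict_def by blast
  then show False using coloringD[OF assms(1-3)] assms(4) by blast
qed

text \<open>The product \<open>q * (24 - m)\<close> with \<open>m = \<rho>' + \<theta> + q\<close> is at least 20: either the second factor is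
  at least 4, or \<open>q\<close> is at least 10 while the second factor is at least 2. But
  \<open>2 * \<rho> - 4\<close> is at most 18.\<close>

lemma charge_arith:
  fixes q \<rho> \<rho>' \<theta> S :: nat
  assumes "5 \<le> q" "q + \<rho>' \<le> 2 * \<rho>" "\<rho>' \<le> \<rho>" "\<rho> + \<theta> \<le> 11"
    "35 * q \<le> q * (\<rho>' + \<theta> + q) + S" "S + 4 \<le> 11 * q + 2 * \<rho>"
  shows False
proof -
  let ?m = "\<rho>' + \<theta> + q"
  have m: "?m \<le> 22" using assms(2-4) by linarith
  then have "q * ?m + q * (24 - ?m) = q * 24" by (simp flip: distrib_left)
  then have *: "q * (24 - ?m) + 4 \<le> 2 * \<rho>" using assms(5,6) by linarith
  show False
  proof (cases "?m \<le> 20")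
    case True
    then have "q * 4 \<le> q * (24 - ?m)" by (intro mult_le_mono2) linarith
    then show False using * assms(1,4) by linarith
  next
    case False
    then have "10 \<le> q" using assms(3,4) by linarith
    moreover have "q * 2 \<le> q * (24 - ?m)" by (rule mult_le_mono2) (use m in linarith)
    ultimately show False using * assms(4) by linarith
  qed
qed

lemma charge_pointwise:
  fixes y w :: nat
  assumes "1 \<le> y" "y \<le> 2" "1 \<le> w"
  shows "y * w + 4 \<le> 3 * y + 2 * w"
proof -
  have "y = 1 \<or> y = 2" using assms by linarith
  then show ?thesis using assms(3) by (elim disjE) simp_all
qed

context bounded_graph
begin

lemma double_count:
  assumes "finite A" "finite B"
  shows "(\<Sum>a\<in>A. card (N a \<inter> B)) = (\<Sum>b\<in>B. card (N b \<inter> A))"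
proof -
  have 1: "card (N a \<inter> B) = (\<Sum>b\<in>B. if b \<in> N a then 1 else 0)" if "finite B" for a B
  proof -
    have "N a \<inter> B = {b \<in> B. b \<in> N a}" by blast
    then show ?thesis using that by (simp add: sum_if_card)
  qed
  have "(\<Sum>a\<in>A. card (N a \<inter> B)) = (\<Sum>a\<in>A. \<Sum>b\<in>B. if b \<in> N a then 1 else 0)"
    by (simp only: 1[OF assms(2)])
  also have "\<dots> = (\<Sum>b\<in>B. \<Sum>a\<in>A. if b \<in> N a then 1 else 0)" by (rule sum.swap)
  also have "\<dots> = (\<Sum>b\<in>B. \<Sum>a\<in>A. if a \<in> N b then 1 else 0)"
    by (simp only: neighbors_sym)
  also have "\<dots> = (\<Sum>b\<in>B. card (N b \<inter> A))" by (simp only: 1[OF assms(1)])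
  finally show ?thesis .
qed

lemma degree_sum_bound:
  assumes S: "S \<subseteq> V" "S \<noteq> {}"
  shows "(\<Sum>v\<in>S. card (N v \<inter> S)) + 6 \<le> 6 * card S"
proof -
  let ?F = "{e \<in> E. e \<subseteq> S}"
  have fS: "finite S" by (rule finite_subset[OF S(1) finV])
  have fF: "finite ?F" using finE by simp
  have F2: "card e = 2" if "e \<in> ?F" for e using that edge2 by simp
  have c: "card (N v \<inter> S) = card {e \<in> ?F. v \<in> e}" if "v \<in> S" for v
  proof -
    have "neighbors ?F v = N v \<inter> S" using that unfolding neighbors_def by auto
    then show ?thesis using edges_at_vertex(2)[of ?F v] F2 by simp
  qed
  have US: "\<Union>?F \<subseteq> S" by blast
  have "(\<Sum>v\<in>S. card (N v \<inter> S)) = (\<Sum>v\<in>S. card {e \<in> ?F. v \<in> e})" using c by simp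
  also have "\<dots> = (\<Sum>v\<in>\<Union>?F. card {e \<in> ?F. v \<in> e})"
  proof (rule sum.mono_neutral_right[OF fS US], rule ballI)
    fix v assume "v \<in> S - \<Union>?F"
    then have "{e \<in> ?F. v \<in> e} = {}" by blast
    then show "card {e \<in> ?F. v \<in> e} = 0" by (simp only: card.empty)
  qed
  also have "\<dots> = 2 * card ?F" by (rule handshake[OF fF F2])
  finally have "(\<Sum>v\<in>S. card (N v \<inter> S)) = 2 * card ?F" .
  moreover have "card ?F + 3 \<le> 3 * card S" by (rule planar_edges(1)[OF S(1) subset_refl S(2)])
  ultimately show ?thesis by linarith
qed

lemma three_common:
  assumes "p \<noteq> q" "p \<noteq> r" "q \<noteq> r"
  shows "card (N p \<inter> N q \<inter> N r) \<le> 2"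
proof (rule ccontr)
  assume "\<not> ?thesis"
  then have c: "card (N p \<inter> N q \<inter> N r) \<ge> 3" by simp
  have "N p \<inter> N q \<inter> N r \<noteq> {}" using c by (metis card.empty not_numeral_le_zero)
  then have V: "{p, q, r} \<subseteq> V" using N_V[of] N_sym by blast
  have V': "N p \<inter> N q \<inter> N r \<subseteq> V" using N_V by blast
  have dis: "{p, q, r} \<inter> (N p \<inter> N q \<inter> N r) = {}" using N_irrefl by blast
  have "card {p, q, r} \<ge> 3" using assms by simp
  from no_K33[OF V V' dis this c] show False unfolding neighbors_def by blast
qed

text \<open>The threshold 12 leaves eleven neighbors to all other vertices, so that an edge between two of
  these has at most 59 conflicts.\<close>

definition big :: "'a set" where "big = {v \<in> V. 12 \<le> card (N v)}"

definition heavy :: "'a set" where "heavy = {v \<in> V - big. 3 \<le> card (N v \<inter> big)}"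

text \<open>The edge that joins such a vertex to one of its two big neighbors may have too many opposite
  edges; these vertices are left colored when their neighbor's star is recolored.\<close>

definition loaded :: "'a set" where
  "loaded = {y \<in> V - big. card (N y \<inter> big) = 2 \<and> 24 \<le> (\<Sum>v\<in>N y - big. card (N v \<inter> big))}"

lemma big_V: "big \<subseteq> V" and heavy_V: "heavy \<subseteq> V" and loaded_V: "loaded \<subseteq> V"
  unfolding big_def heavy_def loaded_def by auto

lemma finite_classes: "finite big" "finite heavy" "finite loaded"
  using finite_subset[OF big_V finV] finite_subset[OF heavy_V finV] finite_subset[OF loaded_V finV]
  by simp_all

lemma classes_disjoint: "big \<inter> heavy = {}" "big \<inter> loaded = {}" "heavy \<inter> loaded = {}"
  unfolding heavy_def loaded_def by auto

lemma small_degree: "v \<in> V \<Longrightarrow> v \<notin> big \<Longrightarrow> card (N v) \<le> 11"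
  unfolding big_def by auto

lemma card_split_big: "card (N v) = card (N v \<inter> big) + card (N v - big)"
proof -
  have "card ((N v \<inter> big) \<union> (N v - big)) = card (N v \<inter> big) + card (N v - big)"
    by (rule card_Un_disjoint) (use finN in auto)
  moreover have "(N v \<inter> big) \<union> (N v - big) = N v" by blast
  ultimately show ?thesis by simp
qed

text \<open>At most nine neighbors of \<open>y\<close> are not big. Those outside \<open>heavy\<close> contribute at most two each to
  the sum, which is at least 24.\<close>

lemma loaded_neighbors:
  assumes y: "y \<in> loaded"
  shows "1 \<le> card (N y \<inter> heavy)"
    and "card (N y \<inter> heavy) = 1 \<Longrightarrow> v \<in> N y \<inter> heavy \<Longrightarrow> 8 \<le> card (N v \<inter> big)"
proof -
  let ?\<beta> = "\<lambda>v. card (N v \<inter> big)"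
  have y': "y \<in> V" "y \<notin> big" "?\<beta> y = 2" "24 \<le> (\<Sum>v\<in>N y - big. ?\<beta> v)"
    using y unfolding loaded_def by auto
  have nine: "card (N y - big) \<le> 9" using small_degree[OF y'(1,2)] card_split_big[of y] y'(3) by linarith
  have fin: "finite (N y - big)" using finN by simp
  have sub: "N y \<inter> heavy \<subseteq> N y - big" using classes_disjoint by blast
  have rest: "(\<Sum>v\<in>(N y - big) - (N y \<inter> heavy). ?\<beta> v) \<le> 2 * card ((N y - big) - (N y \<inter> heavy))"
  proof -
    have "?\<beta> v \<le> 2" if v: "v \<in> (N y - big) - (N y \<inter> heavy)" for v
    proof -
      have "v \<in> V" using v N_V by blast
      then show ?thesis using v unfolding heavy_def by auto
    qed
    then have "(\<Sum>v\<in>(N y - big) - (N y \<inter> heavy). ?\<beta> v) \<le> (\<Sum>v\<in>(N y - big) - (N y \<inter> heavy). 2)"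
      by (rule sum_mono)
    then show ?thesis by simp
  qed
  have split: "(\<Sum>v\<in>N y - big. ?\<beta> v) = (\<Sum>v\<in>(N y - big) - (N y \<inter> heavy). ?\<beta> v) + (\<Sum>v\<in>N y \<inter> heavy. ?\<beta> v)"
    by (rule sum.subset_diff[OF sub fin])
  have cs: "card ((N y - big) - (N y \<inter> heavy)) = card (N y - big) - card (N y \<inter> heavy)"
    by (rule card_Diff_subset) (use sub fin finite_subset in auto)
  show "1 \<le> card (N y \<inter> heavy)"
  proof (rule ccontr)
    assume "\<not> ?thesis"
    then have "card (N y \<inter> heavy) = 0" by simp
    then have "N y \<inter> heavy = {}" using finN by simp
    then have "(\<Sum>v\<in>N y \<inter> heavy. ?\<beta> v) = 0" by (simp only: sum.empty)
    then show False using rest split cs y'(4) nine by linarith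
  qed
  assume one: "card (N y \<inter> heavy) = 1" and v: "v \<in> N y \<inter> heavy"
  have "N y \<inter> heavy = {v}" using one v by (metis card_1_singletonE singletonD)
  then have "(\<Sum>v\<in>N y \<inter> heavy. ?\<beta> v) = ?\<beta> v" by simp
  then show "8 \<le> ?\<beta> v" using rest split cs y'(4) nine one by linarith
qed

text \<open>On average a big vertex has fewer than twelve neighbors in the three classes. The planar bound
  for the union of the classes pays three for every vertex. A heavy vertex brings at least three edges
  to big vertices. A loaded vertex brings two such edges and at least one edge to a heavy vertex; if
  it brings only one, that heavy vertex has at least eight big neighbors and hence at most three others,
  and its surplus pays for all loaded vertices charged to it.\<close>

lemma exists_sparse_big:
  assumes "big \<noteq> {}"
  shows "\<exists>a\<in>big. card (N a \<inter> big) + card (N a \<inter> heavy) + card (N a \<inter> loaded) \<le> 11"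
proof (rule ccontr)
  assume no: "\<not> ?thesis"
  let ?\<beta> = "\<lambda>v. card (N v \<inter> big)"
  note fin = finite_classes
  define h where "h = (\<Sum>a\<in>big. card (N a \<inter> big))"
  define B where "B = (\<Sum>v\<in>heavy. ?\<beta> v)"
  define t where "t = (\<Sum>y\<in>loaded. card (N y \<inter> heavy))"
  define L1 where "L1 = {y \<in> loaded. card (N y \<inter> heavy) = 1}"
  have fL1: "finite L1" unfolding L1_def using fin by simp
  have HT: "(\<Sum>a\<in>big. card (N a \<inter> heavy)) = B" unfolding B_def by (rule double_count[OF fin(1,2)])
  have HL: "(\<Sum>a\<in>big. card (N a \<inter> loaded)) = 2 * card loaded"
  proof -
    have "(\<Sum>a\<in>big. card (N a \<inter> loaded)) = (\<Sum>y\<in>loaded. ?\<beta> y)" by (rule double_count[OF fin(1,3)])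
    also have "\<dots> = (\<Sum>y\<in>loaded. 2)" by (rule sum.cong[OF refl]) (simp add: loaded_def)
    finally show ?thesis by simp
  qed
  have TL: "(\<Sum>v\<in>heavy. card (N v \<inter> loaded)) = t" unfolding t_def by (rule double_count[OF fin(2,3)])
  \<comment> \<open>The surplus of the heavy vertices pays for the loaded vertices with one heavy neighbor.\<close>
  have B3: "3 * card heavy + card L1 \<le> B"
  proof -
    have "(\<Sum>v\<in>heavy. 3 + card (N v \<inter> L1)) \<le> B"
      unfolding B_def
    proof (rule sum_mono)
      fix v assume v: "v \<in> heavy"
      then have v': "v \<in> V" "v \<notin> big" "3 \<le> ?\<beta> v" unfolding heavy_def by auto
      show "3 + card (N v \<inter> L1) \<le> ?\<beta> v"
      proof (cases "N v \<inter> L1 = {}")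
        case True
        then show ?thesis using v'(3) by (simp only: card.empty)
      next
        case False
        then obtain y where y: "y \<in> N v" "y \<in> L1" by blast
        have "y \<in> loaded" "card (N y \<inter> heavy) = 1" using y(2) unfolding L1_def by auto
        moreover have "v \<in> N y \<inter> heavy" using N_sym[OF y(1)] v by blast
        ultimately have "8 \<le> ?\<beta> v" by (rule loaded_neighbors(2))
        moreover have "card (N v \<inter> L1) \<le> card (N v - big)"
          by (rule card_mono) (use finN in \<open>auto simp: L1_def loaded_def\<close>)
        ultimately show ?thesis using small_degree[OF v'(1,2)] card_split_big[of v] by linarith
      qed
    qed
    moreover have "(\<Sum>v\<in>heavy. 3 + card (N v \<inter> L1)) = 3 * card heavy + (\<Sum>v\<in>heavy. card (N v \<inter> L1))"
      by (simp add: sum.distrib)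
    moreover have "(\<Sum>v\<in>heavy. card (N v \<inter> L1)) = (\<Sum>y\<in>L1. card (N y \<inter> heavy))"
      by (rule double_count[OF fin(2) fL1])
    moreover have "(\<Sum>y\<in>L1. card (N y \<inter> heavy)) = (\<Sum>y\<in>L1. 1)"
      by (rule sum.cong[OF refl]) (simp add: L1_def)
    ultimately show ?thesis by simp
  qed
  have t2: "2 * card loaded \<le> t + card L1"
  proof -
    have "(\<Sum>y\<in>loaded. 2) \<le> (\<Sum>y\<in>loaded. card (N y \<inter> heavy) + (if card (N y \<inter> heavy) = 1 then 1 else 0))"
    proof (rule sum_mono)
      fix y assume "y \<in> loaded"
      then show "2 \<le> card (N y \<inter> heavy) + (if card (N y \<inter> heavy) = 1 then 1 else 0)"
        using loaded_neighbors(1)[of y] by simp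
    qed
    also have "\<dots> = t + card L1"
      unfolding t_def L1_def using fin by (simp add: sum.distrib sum_if_card)
    finally show ?thesis by simp
  qed
  let ?S = "big \<union> heavy \<union> loaded"
  have cap: "card (N v \<inter> ?S) = ?\<beta> v + card (N v \<inter> heavy) + card (N v \<inter> loaded)" for v
  proof -
    have "N v \<inter> ?S = ((N v \<inter> big) \<union> (N v \<inter> heavy)) \<union> (N v \<inter> loaded)" by blast
    moreover have "card (((N v \<inter> big) \<union> (N v \<inter> heavy)) \<union> (N v \<inter> loaded)) =
      card ((N v \<inter> big) \<union> (N v \<inter> heavy)) + card (N v \<inter> loaded)"
      by (rule card_Un_disjoint) (use finN classes_disjoint in auto)
    moreover have "card ((N v \<inter> big) \<union> (N v \<inter> heavy)) = card (N v \<inter> big) + card (N v \<inter> heavy)"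
      by (rule card_Un_disjoint) (use finN classes_disjoint in auto)
    ultimately show ?thesis by simp
  qed
  have sumS: "(\<Sum>v\<in>?S. f v) = (\<Sum>v\<in>big. f v) + (\<Sum>v\<in>heavy. f v) + (\<Sum>v\<in>loaded. f v)" for f :: "'a \<Rightarrow> nat"
  proof -
    have "(\<Sum>v\<in>?S. f v) = (\<Sum>v\<in>big \<union> heavy. f v) + (\<Sum>v\<in>loaded. f v)"
      by (rule sum.union_disjoint) (use fin classes_disjoint in auto)
    moreover have "(\<Sum>v\<in>big \<union> heavy. f v) = (\<Sum>v\<in>big. f v) + (\<Sum>v\<in>heavy. f v)"
      by (rule sum.union_disjoint) (use fin classes_disjoint in auto)
    ultimately show ?thesis by simp
  qed
  have "(\<Sum>v\<in>?S. card (N v \<inter> ?S)) + 6 \<le> 6 * card ?S"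
    by (rule degree_sum_bound) (use big_V heavy_V loaded_V assms in auto)
  moreover have "card ?S = card big + card heavy + card loaded"
    using sumS[of "\<lambda>_. 1"] by simp
  moreover have "(\<Sum>v\<in>big. card (N v \<inter> ?S)) = h + B + 2 * card loaded"
    unfolding cap sum.distrib h_def[symmetric] HT HL by (rule refl)
  moreover have "(\<Sum>v\<in>heavy. card (N v \<inter> ?S)) \<ge> B + t"
    unfolding cap sum.distrib B_def[symmetric] TL by simp
  moreover have "(\<Sum>v\<in>loaded. card (N v \<inter> ?S)) \<ge> 2 * card loaded + t"
  proof -
    have "(\<Sum>y\<in>loaded. ?\<beta> y) = (\<Sum>y\<in>loaded. 2)" by (rule sum.cong[OF refl]) (simp add: loaded_def)
    then show ?thesis unfolding cap sum.distrib t_def[symmetric] by simp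
  qed
  ultimately have hb: "h + 2 * card loaded + 6 \<le> 6 * card big"
    using sumS[of "\<lambda>v. card (N v \<inter> ?S)"] B3 t2 by linarith
  have "(\<Sum>v\<in>heavy. ?\<beta> v) + 2 \<le> 2 * (card heavy + card big)"
    by (rule planar_bipartite(1)) (use heavy_V big_V classes_disjoint assms in auto)
  then have Bb: "B + 6 \<le> 6 * card big" using B3 unfolding B_def[symmetric] by presburger
  have "(\<Sum>a\<in>big. 12) \<le> (\<Sum>a\<in>big. card (N a \<inter> big) + card (N a \<inter> heavy) + card (N a \<inter> loaded))"
    by (rule sum_mono) (use no in \<open>auto simp: not_le\<close>)
  also have "\<dots> = h + B + 2 * card loaded"
    unfolding sum.distrib h_def[symmetric] HT HL by (rule refl)
  finally have "12 * card big \<le> h + B + 2 * card loaded" by simp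
  then show False using hb Bb by linarith
qed

text \<open>Edges between two vertices that are not big have at most ten plus ten incident and 39 opposite
  edges, fewer than the number of colors. They can be colored after all others.\<close>

lemma small_edges_last:
  assumes c: "coloring E F (D + s) c" and F: "F \<subseteq> E" "E \<subseteq> F \<union> delete E big"
    and D: "26 \<le> D" and s: "34 \<le> s"
  shows "\<exists>c. coloring E E (D + s) c"
proof -
  have dE: "delete E big \<subseteq> E" unfolding delete_def by blast
  have EF: "F \<union> delete E big = E" using F dE by blast
  have "\<exists>c'. coloring E (F \<union> delete E big) (D + s) c'"
  proof (rule coloring_greedy_set[OF c F(1) dE finE edge2])
    fix e assume e: "e \<in> delete E big"
    then have "card e = 2" using edge2 dE by blast
    then obtain x y where xy: "e = {x, y}" by (meson card_2_iff)
    have xyE: "{x, y} \<in> E" and nb: "x \<notin> big" "y \<notin> big" using e xy unfolding delete_def by auto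
    have xyV: "x \<in> V" "y \<in> V" using edgeV[OF xyE] by auto
    have d: "card (N x) \<le> 11" "card (N y) \<le> 11" using small_degree nb xyV by auto
    have d': "card (N x - {y}) \<le> 10" "card (N y - {x}) \<le> 10"
      using d xyE finN by (auto simp: neighbors_def insert_commute)
    have "card {f \<in> E. conflict E {x, y} f} \<le>
        card {f \<in> E. x \<in> f \<and> f \<noteq> {x, y}} + card {f \<in> E. y \<in> f \<and> f \<noteq> {x, y}} + card (E \<inter> opposite E x y)"
      by (rule conflict_card[OF subset_refl xyE])
    moreover have "card {f \<in> E. x \<in> f \<and> f \<noteq> {x, y}} \<le> card (N x) - 1"
      by (rule card_star_full[OF subset_refl xyE])
    moreover have "card {f \<in> E. y \<in> f \<and> f \<noteq> {x, y}} \<le> card (N y) - 1"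
      using card_star_full[OF subset_refl, of y x] xyE by (simp add: insert_commute)
    moreover have "E \<inter> opposite E x y = opposite E x y" unfolding opposite_def by blast
    moreover have "card (opposite E x y) \<le> 2 * (card (N x - {y}) + card (N y - {x})) - 1"
      by (rule opposite_small_degrees[OF xyE])
    ultimately have "card {f \<in> E. conflict E e f} \<le> 10 + 10 + 39" using d d' xy by simp
    then show "card {f \<in> F \<union> delete E big. conflict E e f} < D + s" unfolding EF using D s by simp
  qed
  then show ?thesis unfolding EF .
qed

text \<open>Suppose the star of edges from \<open>a\<close> to \<open>Y\<close> cannot be colored because of \<open>I\<close>. At most as many
  colors occur at \<open>a\<close> as there are colored edges at \<open>a\<close>, hence many other colors \<open>C\<close> are forbidden for all of \<open>I\<close>. None
  of them occurs at \<open>a\<close>, so each is forbidden for each \<open>y\<close> by an edge at \<open>y\<close> or by an opposite edge.\<close>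

lemma hall_violation:
  assumes F: "F \<subseteq> E" "\<forall>w. {a, w} \<in> F \<longrightarrow> w \<notin> Y" and Y: "Y \<subseteq> N a" and I: "I \<subseteq> Y"
    and contra: "\<not> card {x. x < k \<and> (\<forall>y\<in>I. \<exists>f\<in>F. conflict E {a, y} f \<and> c f = x)} + card I \<le> k"
  shows "\<exists>C. finite C \<and> k + card Y < card C + card I + card (N a) \<and>
    (\<forall>x\<in>C. \<forall>y\<in>I. \<exists>f\<in>F. c f = x \<and> a \<notin> f \<and> (y \<in> f \<or> f \<in> opposite E a y))"
proof -
  define C where "C = {x. x < k \<and> (\<forall>y\<in>I. \<exists>f\<in>F. conflict E {a, y} f \<and> c f = x)}"
  define Ca where "Ca = c ` {f \<in> F. a \<in> f \<and> f \<noteq> {a}}"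
  have fF: "finite F" by (rule finite_subset[OF F(1) finE])
  have fY: "finite Y" by (rule finite_subset[OF Y finN])
  have fC: "finite C" unfolding C_def by simp
  have cCa: "card Ca + card Y \<le> card (N a)"
  proof -
    have "card Ca \<le> card {f \<in> F. a \<in> f \<and> f \<noteq> {a}}" unfolding Ca_def by (rule card_image_le) (use fF in simp)
    also have "\<dots> = card {f \<in> F. a \<in> f \<and> f \<noteq> {a, a}}" by simp
    also have "\<dots> \<le> card (N a - Y)"
    proof (rule card_star_le[OF F(1)])
      fix w assume "{a, w} \<in> F"
      then show "w \<in> N a - Y" using F unfolding neighbors_def by blast
    qed (use finN in simp)
    also have "\<dots> = card (N a) - card Y" by (rule card_Diff_subset[OF fY Y])
    finally show ?thesis using card_mono[OF finN Y] by linarith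
  qed
  have "card C \<le> card ((C - Ca) \<union> Ca)" by (rule card_mono) (use fC fF in \<open>auto simp: Ca_def\<close>)
  then have "card C \<le> card (C - Ca) + card Ca" using card_Un_le[of "C - Ca" Ca] by linarith
  then have 1: "k + card Y < card (C - Ca) + card I + card (N a)"
    using contra cCa unfolding C_def[symmetric] by linarith
  have 2: "\<exists>f\<in>F. c f = x \<and> a \<notin> f \<and> (y \<in> f \<or> f \<in> opposite E a y)"
    if x: "x \<in> C - Ca" and y: "y \<in> I" for x y
  proof -
    obtain f where f: "f \<in> F" "conflict E {a, y} f" "c f = x" using x y unfolding C_def by blast
    have "f \<in> E" using f(1) F(1) by blast
    then have "f \<noteq> {a}" using edge2 by force
    then have "a \<notin> f" using x f(1,3) unfolding Ca_def by blast
    then show ?thesis using f unfolding conflict_edge by blast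
  qed
  show ?thesis using fC 1 2 by (intro exI[of _ "C - Ca"]) simp
qed

text \<open>Let \<open>I\<close> violate Hall's condition, and let \<open>C'\<close> be the colors seen by all of \<open>I\<close>. Every \<open>y\<close> in
  \<open>I\<close> has at most two big neighbors, one of them \<open>a\<close>.

  If \<open>a\<close> is the only one, the colors of \<open>C'\<close> reach \<open>y\<close> through vertices \<open>v\<close> that are not big along edges
  from \<open>v\<close> to the set \<open>W\<close> of big neighbors of \<open>a\<close>. There are too few such edges.

  Otherwise \<open>y\<close> has a second big neighbor \<open>b\<close>. Let \<open>J\<close> consist of all members of \<open>I\<close> with this
  neighbor, so that \<open>{a, b}\<close> is their common set of big neighbors. Colors of edges
  from \<open>b\<close> to common neighbors of \<open>a\<close> and \<open>b\<close> form the set \<open>\<Phi>\<close>; all other colors of \<open>C'\<close> must reach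
  every member of \<open>J\<close> through edges counted by \<open>g\<close>. One such color \<open>\<gamma>\<close> occurs at most once at each
  vertex of \<open>W\<close>, and a third vertex has at most two common neighbors with \<open>a\<close> and \<open>b\<close>; this bounds
  \<open>J\<close> from above. If \<open>J\<close> is small, the bound for a single \<open>g y\<close> suffices. If it is large, the sum of
  \<open>g\<close> over \<open>J\<close> is bounded by the planar bound for the bipartite graph between \<open>J \<union> W\<close> and the
  intermediate vertices.\<close>

lemma hall_condition_big:
  assumes s: "34 \<le> s" and a: "a \<in> big"
    and sparse: "card (N a \<inter> big) + card (N a \<inter> heavy) + card (N a \<inter> loaded) \<le> 11"
    and Y: "Y = N a - big - heavy - loaded"
    and F: "F \<subseteq> E" "\<And>f. f \<in> F \<Longrightarrow> f \<inter> big \<noteq> {}" "\<And>w. {a, w} \<in> F \<Longrightarrow> w \<notin> Y"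
    and c: "coloring E F (D + s) c" and I: "I \<subseteq> Y" "I \<noteq> {}"
  shows "card {x. x < D + s \<and> (\<forall>y\<in>I. \<exists>f\<in>F. conflict E {a, y} f \<and> c f = x)} + card I \<le> D + s"
proof (rule ccontr)
  assume contra: "\<not> ?thesis"
  define W where "W = N a \<inter> big"
  have YN: "Y \<subseteq> N a" and Ynb: "Y \<inter> big = {}" unfolding Y by auto
  have fY: "finite Y" by (rule finite_subset[OF YN finN])
  have fI: "finite I" by (rule finite_subset[OF I(1) fY])
  have cI: "card I \<le> card Y" by (rule card_mono[OF fY I(1)])
  have YV: "y \<in> V" "y \<notin> big" "y \<notin> heavy" "y \<notin> loaded" if "y \<in> Y" for y
    using that N_V unfolding Y by blast+
  have aY: "a \<notin> Y" using a Ynb by blast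
  have Fa: "\<forall>w. {a, w} \<in> F \<longrightarrow> w \<notin> Y" using F(3) by blast
  obtain C' where C': "finite C'" "D + s + card Y < card C' + card I + card (N a)"
    "\<forall>x\<in>C'. \<forall>y\<in>I. \<exists>f\<in>F. c f = x \<and> a \<notin> f \<and> (y \<in> f \<or> f \<in> opposite E a y)"
    using hall_violation[OF F(1) Fa YN I(1) contra] by (elim exE conjE)
  note fC' = C'(1)
  have cC': "s + 1 + card Y \<le> card C' + card I" using C'(2) deg[of a] by linarith
  \<comment> \<open>A color seen by \<open>y\<close> lies either on an edge from a second big neighbor \<open>b\<close> of \<open>y\<close> to a common
     neighbor of \<open>a\<close> and \<open>b\<close> (possibly \<open>y\<close> itself), or on an edge from a neighbor \<open>v\<close> of \<open>y\<close> to \<open>W\<close>.\<close>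
  have seen: "(\<exists>b w. b \<in> N y \<inter> big - {a} \<and> w \<in> N a \<inter> N b \<and> {b, w} \<in> F \<and> c {b, w} = x) \<or>
      (\<exists>v w. v \<in> N y - big \<and> w \<in> W \<inter> N v \<and> {v, w} \<in> F \<and> c {v, w} = x)"
    if y: "y \<in> I" and x: "x \<in> C'" for x y
  proof -
    have yY: "y \<in> Y" using y I(1) by blast
    obtain f where f: "f \<in> F" "c f = x" "a \<notin> f" "y \<in> f \<or> f \<in> opposite E a y"
      using C'(3) x y by blast
    have fE: "f \<in> E" using f(1) F(1) by blast
    consider "y \<in> f" | "f \<in> opposite E a y" using f(4) by blast
    then show ?thesis
    proof cases
      case 1
      obtain b where b: "f = {y, b}" "b \<in> N y" using edge_at[OF fE 1] by blast
      have "b \<in> big" using F(2)[OF f(1)] b(1) YV(2)[OF yY] by auto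
      moreover have "b \<noteq> a" using f(3) b(1) by blast
      moreover have "y \<in> N a \<inter> N b" using yY YN N_sym[OF b(2)] by blast
      moreover have "{b, y} \<in> F" "c {b, y} = x" using f b(1) by (simp_all add: insert_commute)
      ultimately show ?thesis using b(2) by blast
    next
      case 2
      then obtain w v where wv: "f = {w, v}" "w \<in> N a" "w \<noteq> y" "v \<in> N y" "v \<noteq> a"
        unfolding opposite_def by blast
      have vF: "{v, w} \<in> F" "c {v, w} = x" using f wv(1) by (simp_all add: insert_commute)
      then have wv': "w \<in> N v" using F(1) unfolding neighbors_def by blast
      show ?thesis
      proof (cases "v \<in> big")
        case True
        then show ?thesis using wv vF wv' by blast
      next
        case False
        then have "w \<in> big" using F(2)[OF vF(1)] by auto
        then show ?thesis using wv vF wv' False unfolding W_def by blast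
      qed
    qed
  qed
  have cW: "card W + card (N a \<inter> heavy) + card (N a \<inter> loaded) \<le> 11" using sparse unfolding W_def .
  have fW: "finite W" and WN: "W \<subseteq> N a" and Wb: "W \<subseteq> big" unfolding W_def using finN by auto
  have aW: "a \<notin> W" using WN N_irrefl by blast
  have ay: "{y, a} \<in> E" if "y \<in> Y" for y using that YN by (auto simp: neighbors_def insert_commute)
  have apex: "(\<Sum>v\<in>N y - big. card (N v \<inter> W)) \<le> card (N y - big) + card W - 1" if y: "y \<in> Y" for y
  proof (cases "N y - big = {}")
    case True
    then show ?thesis by (simp only: sum.empty)
  next
    case False
    have "(\<Sum>v\<in>N y - big. card (N v \<inter> W)) + 1 \<le> card (N y - big) + card W"
      by (rule two_apex_bound[OF ay[OF y] _ WN]) (use False a YV(2)[OF y] Wb in auto)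
    then show ?thesis by linarith
  qed
  have beta: "1 \<le> card (N y \<inter> big)" "card (N y \<inter> big) \<le> 2" "a \<in> N y" if y: "y \<in> Y" for y
  proof -
    show an: "a \<in> N y" using ay[OF y] by (simp add: neighbors_def)
    then have "N y \<inter> big \<noteq> {}" using a by blast
    then show "1 \<le> card (N y \<inter> big)" using finN by (simp add: Suc_le_eq card_gt_0_iff)
    show "card (N y \<inter> big) \<le> 2" using YV[OF y] unfolding heavy_def by auto
  qed
  have "\<exists>b. b \<noteq> a \<and> N y \<inter> big = {a, b}" if y: "y \<in> I" for y
  proof (rule ccontr)
    assume none: "\<not> ?thesis"
    have yY: "y \<in> Y" using y I(1) by blast
    have only: "N y \<inter> big = {a}"
    proof (rule ccontr)
      assume "N y \<inter> big \<noteq> {a}"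
      then obtain b where b: "b \<in> N y \<inter> big" "b \<noteq> a" using beta(3)[OF yY] a by blast
      have "{a, b} \<subseteq> N y \<inter> big" using b beta(3)[OF yY] a by blast
      moreover have "card {a, b} = 2" using b(2) by simp
      moreover have "finite (N y \<inter> big)" using finN by simp
      ultimately have "{a, b} = N y \<inter> big" using beta(2)[OF yY] by (intro card_seteq) simp_all
      then show False using none b(2) by blast
    qed
    have "card C' \<le> (\<Sum>v\<in>N y - big. card (N v \<inter> W))"
    proof (rule card_UN_image_le[where h = "\<lambda>v w. c {v, w}"])
      show "C' \<subseteq> (\<Union>v\<in>N y - big. (\<lambda>w. c {v, w}) ` (N v \<inter> W))"
      proof
        fix x assume x: "x \<in> C'"
        have "N y \<inter> big - {a} = {}" using only by blast
        then obtain v w where "v \<in> N y - big" "w \<in> W \<inter> N v" "c {v, w} = x" using seen[OF y x] by blast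
        then show "x \<in> (\<Union>v\<in>N y - big. (\<lambda>w. c {v, w}) ` (N v \<inter> W))" by blast
      qed
    qed (use finN in auto)
    also have "\<dots> \<le> card (N y - big) + card W - 1" by (rule apex[OF yY])
    finally have "card C' \<le> card (N y - big) + card W - 1" .
    moreover have "card (N y - big) \<le> 10"
      using small_degree[of y] YV[OF yY] card_split_big[of y] beta(1)[OF yY] by linarith
    ultimately show False using cC' cI cW s by linarith
  qed
  then obtain y0 b where y0: "y0 \<in> I" "b \<noteq> a" "N y0 \<inter> big = {a, b}" using I(2) by blast
  have ex2: "\<exists>b. b \<noteq> a \<and> N y \<inter> big = {a, b}" if "y \<in> I" for y
    using \<open>\<And>y. y \<in> I \<Longrightarrow> \<exists>b. b \<noteq> a \<and> N y \<inter> big = {a, b}\<close> that .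
  have bb: "b \<in> big" using y0(3) by blast
  define J where "J = {y \<in> I. b \<in> N y}"
  have J: "N y \<inter> big = {a, b}" if y: "y \<in> J" for y
  proof -
    have "y \<in> I" "b \<in> N y" using y unfolding J_def by auto
    then obtain b' where "N y \<inter> big = {a, b'}" using ex2 by blast
    then show ?thesis using \<open>b \<in> N y\<close> bb y0(2) by blast
  qed
  have y0J: "y0 \<in> J" using y0 unfolding J_def by blast
  have fJ: "finite J" and JI: "J \<subseteq> I" unfolding J_def using fI by auto
  have JY: "J \<subseteq> Y" using JI I(1) by blast
  have J1: "1 \<le> card J" using y0J fJ by (auto simp: Suc_le_eq card_gt_0_iff)
  define \<Phi> where "\<Phi> = c ` ((\<lambda>w. {b, w}) ` {w \<in> N a \<inter> N b. {b, w} \<in> F})"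
  \<comment> \<open>Edges from \<open>b\<close> to common neighbors of \<open>a\<close> and \<open>b\<close> are excluded, since their colors are in \<open>\<Phi>\<close>.\<close>
  define R where "R v = {w \<in> W \<inter> N v. \<not> (w = b \<and> v \<in> N a)}" for v
  define g where "g y = (\<Sum>v\<in>N y - big. card (R v))" for y
  have fR: "finite (R v)" for v unfolding R_def using fW by simp
  have fPhi: "finite \<Phi>" unfolding \<Phi>_def using finN by simp
  have far: "\<exists>v w. v \<in> N y - big \<and> w \<in> R v \<and> {v, w} \<in> F \<and> c {v, w} = x"
    if y: "y \<in> J" and x: "x \<in> C' - \<Phi>" for x y
  proof -
    have yI: "y \<in> I" using y JI by blast
    have notPhi: "\<not> (w \<in> N a \<inter> N b \<and> {b, w} \<in> F \<and> c {b, w} = x)" for w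
      using x unfolding \<Phi>_def by blast
    have nob: "\<not> (\<exists>b' w. b' \<in> N y \<inter> big - {a} \<and> w \<in> N a \<inter> N b' \<and> {b', w} \<in> F \<and> c {b', w} = x)"
      using notPhi J[OF y] by auto
    obtain v w where vw: "v \<in> N y - big" "w \<in> W \<inter> N v" "{v, w} \<in> F" "c {v, w} = x"
      using seen[OF yI, of x] x nob by blast
    have "\<not> (w = b \<and> v \<in> N a)"
    proof
      assume wb: "w = b \<and> v \<in> N a"
      then have "v \<in> N a \<inter> N b" using vw(2) N_sym by blast
      moreover have "{b, v} = {v, w}" using wb by (simp add: insert_commute)
      ultimately show False using notPhi[of v] vw(3,4) by simp
    qed
    then show ?thesis using vw unfolding R_def by blast
  qed
  have cg: "card (C' - \<Phi>) \<le> g y" if y: "y \<in> J" for y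
    unfolding g_def
  proof (rule card_UN_image_le[where h = "\<lambda>v w. c {v, w}"])
    show "C' - \<Phi> \<subseteq> (\<Union>v\<in>N y - big. (\<lambda>w. c {v, w}) ` R v)"
    proof
      fix x assume x: "x \<in> C' - \<Phi>"
      obtain v w where "v \<in> N y - big" "w \<in> R v" "c {v, w} = x" using far[OF y x] by blast
      then show "x \<in> (\<Union>v\<in>N y - big. (\<lambda>w. c {v, w}) ` R v)" by blast
    qed
  qed (use finN fR in auto)
  have cPhi0: "card \<Phi> \<le> card (N a \<inter> N b)"
  proof -
    have "card \<Phi> \<le> card ((\<lambda>w. {b, w}) ` {w \<in> N a \<inter> N b. {b, w} \<in> F})"
      unfolding \<Phi>_def by (rule card_image_le) (use finN in simp)
    also have "\<dots> \<le> card {w \<in> N a \<inter> N b. {b, w} \<in> F}" by (rule card_image_le) (use finN in simp)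
    also have "\<dots> \<le> card (N a \<inter> N b)" by (rule card_mono) (use finN in auto)
    finally show ?thesis .
  qed
  define \<rho>' where "\<rho>' = card (W \<inter> N b)"
  define \<theta> where "\<theta> = card (N a \<inter> heavy) + card (N a \<inter> loaded)"
  \<comment> \<open>A common neighbor of \<open>a\<close> and \<open>b\<close> in \<open>I\<close> belongs to \<open>J\<close>; the members of \<open>Y\<close> outside \<open>I\<close> are
     compensated by the number of colors in \<open>C'\<close>.\<close>
  have cPhi: "card \<Phi> \<le> \<rho>' + \<theta> + card J + (card Y - card I)"
  proof -
    have "N a \<inter> N b \<subseteq> (W \<inter> N b) \<union> ((N a \<inter> heavy) \<union> (N a \<inter> loaded)) \<union> (J \<union> (Y - I))"
      using N_sym unfolding Y W_def J_def by blast
    then have "card (N a \<inter> N b) \<le> card ((W \<inter> N b) \<union> ((N a \<inter> heavy) \<union> (N a \<inter> loaded)) \<union> (J \<union> (Y - I)))"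
      by (rule card_mono[rotated]) (use fW finN fJ fY in auto)
    also have "\<dots> \<le> card (W \<inter> N b) + (card (N a \<inter> heavy) + card (N a \<inter> loaded)) + (card J + card (Y - I))"
      by (intro order_trans[OF card_Un_le] add_mono order_refl)
    also have "card (Y - I) = card Y - card I" by (rule card_Diff_subset[OF fI I(1)])
    finally show ?thesis using cPhi0 unfolding \<rho>'_def \<theta>_def by linarith
  qed
  have Cl: "card C' \<le> card \<Phi> + card (C' - \<Phi>)"
  proof -
    have "card C' \<le> card (\<Phi> \<union> (C' - \<Phi>))" by (rule card_mono) (use fPhi fC' in auto)
    then show ?thesis using card_Un_le[of \<Phi> "C' - \<Phi>"] by linarith
  qed
  have "card \<Phi> \<le> s" using cPhi0 codeg[of a b] y0(2) by simp
  then have "1 \<le> card (C' - \<Phi>)" using Cl cC' cI by linarith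
  then obtain \<gamma> where \<gamma>: "\<gamma> \<in> C' - \<Phi>" by (metis card.empty ex_in_conv not_one_le_zero)
  have main: "s + 1 \<le> \<rho>' + \<theta> + card J + g y" if y: "y \<in> J" for y
    using cPhi Cl cC' cI cg[OF y] by linarith
  have nine: "card (N y - big) \<le> 9" if y: "y \<in> J" for y
  proof -
    have yY: "y \<in> Y" using y JY by blast
    have "card (N y \<inter> big) = 2" using J[OF y] y0(2) by simp
    then show ?thesis using small_degree[of y] YV[OF yY] card_split_big[of y] by linarith
  qed
  have gbound: "g y \<le> 8 + card W" if y: "y \<in> J" for y
  proof -
    have yY: "y \<in> Y" using y JY by blast
    have "g y \<le> (\<Sum>v\<in>N y - big. card (N v \<inter> W))"
      unfolding g_def by (intro sum_mono card_mono) (use fW in \<open>auto simp: R_def\<close>)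
    then show ?thesis using apex[OF yY] nine[OF y] by linarith
  qed
  have rho': "\<rho>' \<le> card W" unfolding \<rho>'_def by (rule card_mono) (use fW in auto)
  have rt: "card W + \<theta> \<le> 11" using cW unfolding \<theta>_def by linarith
  have q5: "5 \<le> card J"
  proof (rule ccontr)
    assume "\<not> ?thesis"
    then show False using main[OF y0J] gbound[OF y0J] rho' rt s by linarith
  qed
  have qr: "card J + \<rho>' \<le> 2 * card W"
  proof -
    define Q where "Q w = {y \<in> J. \<exists>v\<in>N y - big. w \<in> R v \<and> {v, w} \<in> F \<and> c {v, w} = \<gamma>}" for w
    have fQ: "finite (Q w)" for w unfolding Q_def using fJ by simp
    \<comment> \<open>The members of \<open>Q w\<close> share the neighbors \<open>a\<close>, \<open>b\<close> and the unique \<open>v\<close> whose edge to \<open>w\<close> has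
       color \<open>\<gamma>\<close>; if \<open>w\<close> is adjacent to \<open>b\<close>, it is one more common neighbor of these three.\<close>
    have Qw: "card (Q w) + (if w \<in> N b then 1 else 0) \<le> 2" if w: "w \<in> W" for w
    proof (cases "Q w = {}")
      case True
      then have "card (Q w) = 0" by (simp only: card.empty)
      then show ?thesis by simp
    next
      case False
      then obtain y1 v where v: "v \<in> N y1 - big" "w \<in> R v" "{v, w} \<in> F" "c {v, w} = \<gamma>"
        unfolding Q_def by blast
      have vb: "v \<noteq> a" "v \<noteq> b" using v(1) a bb by auto
      have "y \<in> N a \<inter> N b \<inter> N v" if y: "y \<in> Q w" for y
      proof -
        obtain v' where v': "v' \<in> N y - big" "{v', w} \<in> F" "c {v', w} = \<gamma>" "y \<in> J"
          using y unfolding Q_def by blast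
        have "v' = v" by (rule coloring_unique_at[OF c v'(2) v(3)]) (use v(4) v'(3) in simp)
        moreover have "a \<in> N y" "b \<in> N y" using J[OF v'(4)] by auto
        ultimately show ?thesis using v'(1) N_sym by blast
      qed
      then have QN: "Q w \<subseteq> N a \<inter> N b \<inter> N v" by blast
      have three: "card (N a \<inter> N b \<inter> N v) \<le> 2" by (rule three_common) (use vb y0(2) in auto)
      show ?thesis
      proof (cases "w \<in> N b")
        case True
        have "w \<in> N a \<inter> N b \<inter> N v" using True v(2) WN unfolding R_def by blast
        moreover have "w \<notin> Q w"
          using w Wb JY Ynb unfolding Q_def by blast
        moreover have "card (insert w (Q w)) \<le> card (N a \<inter> N b \<inter> N v)"
          by (rule card_mono) (use finN QN calculation(1) in auto)
        ultimately show ?thesis using fQ three True by simp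
      next
        case False
        have "card (Q w) \<le> card (N a \<inter> N b \<inter> N v)" by (rule card_mono) (use finN QN in auto)
        then show ?thesis using three False by simp
      qed
    qed
    have "J \<subseteq> (\<Union>w\<in>W. Q w)"
    proof
      fix y assume y: "y \<in> J"
      obtain v w where "v \<in> N y - big" "w \<in> R v" "{v, w} \<in> F" "c {v, w} = \<gamma>" using far[OF y \<gamma>] by blast
      then have "w \<in> W" "y \<in> Q w" using y unfolding Q_def R_def by blast+
      then show "y \<in> (\<Union>w\<in>W. Q w)" by blast
    qed
    then have "card J \<le> card (\<Union>w\<in>W. Q w)" by (rule card_mono[rotated]) (use fW fQ in auto)
    also have "\<dots> \<le> (\<Sum>w\<in>W. card (Q w))" by (rule card_UN_le[OF fW])
    finally have "card J \<le> (\<Sum>w\<in>W. card (Q w))" .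
    moreover have "(\<Sum>w\<in>W. card (Q w) + (if w \<in> N b then 1 else 0)) \<le> (\<Sum>w\<in>W. 2)"
      by (rule sum_mono) (rule Qw)
    moreover have "(\<Sum>w\<in>W. if w \<in> N b then 1 else 0) = \<rho>'"
    proof -
      have "W \<inter> N b = {w \<in> W. w \<in> N b}" by blast
      then show ?thesis unfolding \<rho>'_def using fW by (simp add: sum_if_card)
    qed
    ultimately show ?thesis by (simp add: sum.distrib)
  qed
  have gsum: "(\<Sum>y\<in>J. g y) + 4 \<le> 11 * card J + 2 * card W"
  proof -
    define U where "U = {v \<in> V - big. N v \<inter> J \<noteq> {} \<and> R v \<noteq> {}}"
    have UV: "U \<subseteq> V" "U \<inter> big = {}" unfolding U_def by auto
    have fU: "finite U" by (rule finite_subset[OF UV(1) finV])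
    have "(\<Sum>y\<in>J. g y) \<le> (\<Sum>v\<in>U. card (N v \<inter> J) * card (R v))"
    proof -
      have "g y = (\<Sum>v\<in>U. if v \<in> N y then card (R v) else 0)" if y: "y \<in> J" for y
      proof -
        have "g y = (\<Sum>v\<in>U \<inter> N y. card (R v))"
          unfolding g_def
        proof (rule sum.mono_neutral_right)
          show "finite (N y - big)" using finN by simp
          show "U \<inter> N y \<subseteq> N y - big" using UV by blast
          show "\<forall>v\<in>(N y - big) - U \<inter> N y. card (R v) = 0"
          proof
            fix v assume v: "v \<in> (N y - big) - U \<inter> N y"
            have "v \<in> V - big" "N v \<inter> J \<noteq> {}" using v N_V N_sym y by blast+
            then have "R v = {}" using v unfolding U_def by blast
            then show "card (R v) = 0" by (simp only: card.empty)
          qed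
        qed
        also have "\<dots> = (\<Sum>v\<in>U. if v \<in> N y then card (R v) else 0)"
          by (rule sum.inter_restrict[OF fU])
        finally show ?thesis .
      qed
      then have "(\<Sum>y\<in>J. g y) = (\<Sum>y\<in>J. \<Sum>v\<in>U. if v \<in> N y then card (R v) else 0)" by simp
      also have "\<dots> = (\<Sum>v\<in>U. \<Sum>y\<in>J. if v \<in> N y then card (R v) else 0)" by (rule sum.swap)
      also have "\<dots> = (\<Sum>v\<in>U. card (N v \<inter> J) * card (R v))"
      proof (rule sum.cong[OF refl])
        fix v
        have "(\<Sum>y\<in>J. if v \<in> N y then card (R v) else 0) = (\<Sum>y\<in>J \<inter> N v. card (R v))"
          unfolding neighbors_sym[of v] by (rule sum.inter_restrict[OF fJ, symmetric])
        then show "(\<Sum>y\<in>J. if v \<in> N y then card (R v) else 0) = card (N v \<inter> J) * card (R v)"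
          by (simp add: Int_commute)
      qed
      finally show ?thesis by simp
    qed
    moreover have "(\<Sum>v\<in>U. card (N v \<inter> J) * card (R v) + 4) \<le>
        (\<Sum>v\<in>U. 3 * card (N v \<inter> J) + 2 * card (R v))"
    proof (rule sum_mono)
      fix v assume v: "v \<in> U"
      have v1: "1 \<le> card (N v \<inter> J)" "1 \<le> card (R v)"
        using v finN fR unfolding U_def by (auto simp: Suc_le_eq card_gt_0_iff)
      have "N v \<inter> J \<subseteq> N a \<inter> N b \<inter> N v" using J N_sym by blast
      then have "card (N v \<inter> J) \<le> card (N a \<inter> N b \<inter> N v)" by (rule card_mono[rotated]) (use finN in simp)
      also have "\<dots> \<le> 2" by (rule three_common) (use v UV a bb y0(2) in auto)
      finally show "card (N v \<inter> J) * card (R v) + 4 \<le> 3 * card (N v \<inter> J) + 2 * card (R v)"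
        by (rule charge_pointwise[OF v1(1) _ v1(2)])
    qed
    moreover have "(\<Sum>v\<in>U. card (N v \<inter> J) * card (R v) + 4) = (\<Sum>v\<in>U. card (N v \<inter> J) * card (R v)) + 4 * card U"
      by (simp add: sum.distrib)
    moreover have "(\<Sum>v\<in>U. 3 * card (N v \<inter> J) + 2 * card (R v)) =
      3 * (\<Sum>v\<in>U. card (N v \<inter> J)) + 2 * (\<Sum>v\<in>U. card (R v))"
      by (simp add: sum.distrib sum_distrib_left)
    ultimately have 1: "(\<Sum>y\<in>J. g y) + 4 * card U \<le> 3 * (\<Sum>v\<in>U. card (N v \<inter> J)) + 2 * (\<Sum>v\<in>U. card (R v))"
      by linarith
    have 2: "(\<Sum>v\<in>U. card (N v \<inter> J)) \<le> 9 * card J"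
    proof -
      have "(\<Sum>v\<in>U. card (N v \<inter> J)) = (\<Sum>y\<in>J. card (N y \<inter> U))" by (rule double_count[OF fU fJ])
      also have "\<dots> \<le> (\<Sum>y\<in>J. 9)"
      proof (rule sum_mono)
        fix y assume y: "y \<in> J"
        have "card (N y \<inter> U) \<le> card (N y - big)" by (rule card_mono) (use finN UV in auto)
        then show "card (N y \<inter> U) \<le> 9" using nine[OF y] by linarith
      qed
      finally show ?thesis by simp
    qed
    show ?thesis
    proof (cases "U = {}")
      case True
      then have "(\<Sum>y\<in>J. g y) = 0" using 1 by (simp add: True)
      then show ?thesis using q5 by linarith
    next
      case False
      have JW: "J \<inter> W = {}" using JY Ynb Wb by blast
      \<comment> \<open>A member of \<open>J\<close> has only \<open>b\<close> as a candidate in \<open>R\<close>, and there the exclusion applies.\<close>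
      have UJ: "U \<inter> J = {}"
      proof (rule ccontr)
        assume "U \<inter> J \<noteq> {}"
        then obtain v where v: "v \<in> U" "v \<in> J" by blast
        then obtain w where w: "w \<in> R v" unfolding U_def by blast
        then have "w \<in> {a, b}" using J[OF v(2)] Wb unfolding R_def by blast
        moreover have "w \<noteq> a" using w aW unfolding R_def by blast
        moreover have "v \<in> N a" using v(2) JY YN by blast
        ultimately show False using w unfolding R_def by blast
      qed
      have aU: "a \<notin> U" using UV a by blast
      have "(\<Sum>p\<in>insert a U. card (N p \<inter> (J \<union> W))) + 4 \<le> 2 * (card (insert a U) + card (J \<union> W))"
      proof (rule planar_bipartite(2))
        show "insert a U \<subseteq> V" using UV a big_V by blast
        show "J \<union> W \<subseteq> V" using JY YV(1) Wb big_V by blast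
        show "insert a U \<inter> (J \<union> W) = {}" using UJ UV Wb aW JY Ynb a by blast
        have "card (J \<union> W) \<ge> card J" by (rule card_mono) (use fJ fW in auto)
        then show "3 \<le> card (insert a U) + card (J \<union> W)" using q5 by linarith
      qed
      moreover have "(\<Sum>p\<in>insert a U. card (N p \<inter> (J \<union> W))) =
          card (N a \<inter> (J \<union> W)) + (\<Sum>p\<in>U. card (N p \<inter> (J \<union> W)))"
        by (rule sum.insert[OF fU aU])
      moreover have "card (N a \<inter> (J \<union> W)) = card (J \<union> W)"
      proof -
        have "N a \<inter> (J \<union> W) = J \<union> W" using JY YN WN by blast
        then show ?thesis by (simp only:)
      qed
      moreover have "card (J \<union> W) = card J + card W" by (rule card_Un_disjoint[OF fJ fW JW])
      moreover have "card (insert a U) = card U + 1" using fU aU by simp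
      moreover have "(\<Sum>v\<in>U. card (N v \<inter> J)) + (\<Sum>v\<in>U. card (R v)) \<le> (\<Sum>p\<in>U. card (N p \<inter> (J \<union> W)))"
        unfolding sum.distrib[symmetric]
      proof (rule sum_mono)
        fix v
        have "card (N v \<inter> J) + card (R v) = card ((N v \<inter> J) \<union> R v)"
          by (rule card_Un_disjoint[symmetric]) (use finN fR JW in \<open>auto simp: R_def\<close>)
        also have "\<dots> \<le> card (N v \<inter> (J \<union> W))" by (rule card_mono) (use finN in \<open>auto simp: R_def\<close>)
        finally show "card (N v \<inter> J) + card (R v) \<le> card (N v \<inter> (J \<union> W))" .
      qed
      ultimately have "(\<Sum>v\<in>U. card (N v \<inter> J)) + (\<Sum>v\<in>U. card (R v)) + 2 \<le> 2 * card U + card J + card W"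
        by presburger
      then show ?thesis using 1 2 by linarith
    qed
  qed
  have "(\<Sum>y\<in>J. s + 1) \<le> (\<Sum>y\<in>J. (\<rho>' + \<theta> + card J) + g y)"
    by (rule sum_mono) (rule main)
  then have "card J * (s + 1) \<le> card J * (\<rho>' + \<theta> + card J) + (\<Sum>y\<in>J. g y)"
    by (simp only: sum.distrib[of "\<lambda>_. \<rho>' + \<theta> + card J"] sum_constant of_nat_id)
  moreover have "35 * card J \<le> card J * (s + 1)" using mult_le_mono2[of 35 "s + 1" "card J"] s by simp
  ultimately have "35 * card J \<le> card J * (\<rho>' + \<theta> + card J) + (\<Sum>y\<in>J. g y)" by linarith
  then show False by (rule charge_arith[OF q5 qr rho' rt _ gsum])
qed

text \<open>The deleted vertices are the neighbors \<open>Y\<close> of a sparse big vertex \<open>a\<close> that are in none of the three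
  classes. Their edges to big vertices other than \<open>a\<close> are colored greedily, then the star at
  \<open>a\<close> by Hall's theorem, and finally the edges between vertices that are not big.\<close>

lemma coloring_exists_step_large_degree:
  assumes IH: "\<And>E'. E' \<subset> E \<Longrightarrow> \<exists>c. coloring E' E' (D + s) c" and D: "26 \<le> D" and s: "34 \<le> s"
  shows "\<exists>c. coloring E E (D + s) c"
proof (cases "big = {}")
  case True
  have "coloring E {} (D + s) (\<lambda>_. 0)" unfolding coloring_def by simp
  then show ?thesis
    by (rule small_edges_last) (use D s True in \<open>auto simp: delete_def\<close>)
next
  case False
  obtain a where a: "a \<in> big"
    and sparse: "card (N a \<inter> big) + card (N a \<inter> heavy) + card (N a \<inter> loaded) \<le> 11"
    using exists_sparse_big[OF False] by blast
  define Y where "Y = N a - big - heavy - loaded"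
  define Z where "Z = N a \<inter> (big \<union> heavy \<union> loaded)"
  have YN: "Y \<subseteq> N a" and Ynb: "Y \<inter> big = {}" unfolding Y_def by auto
  have fY: "finite Y" by (rule finite_subset[OF YN finN])
  have cZ: "card Z \<le> 11"
  proof -
    have "Z = (N a \<inter> big) \<union> (N a \<inter> heavy) \<union> (N a \<inter> loaded)" unfolding Z_def by blast
    then have "card Z \<le> card ((N a \<inter> big) \<union> (N a \<inter> heavy)) + card (N a \<inter> loaded)"
      by (simp only: card_Un_le)
    then show ?thesis using card_Un_le[of "N a \<inter> big" "N a \<inter> heavy"] sparse by linarith
  qed
  have "Y \<noteq> {}"
  proof
    assume "Y = {}"
    then have "N a = Z" unfolding Y_def Z_def by blast
    then show False using cZ a unfolding big_def by simp
  qed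
  have aY: "a \<notin> Y" using a Ynb by blast
  have Ya: "{a, y} \<in> E" if "y \<in> Y" for y using that YN unfolding neighbors_def by blast
  have YV: "y \<in> V" "y \<notin> big" "y \<notin> heavy" "y \<notin> loaded" if "y \<in> Y" for y
    using that N_V unfolding Y_def by blast+
  have "delete E Y \<subset> E" using \<open>Y \<noteq> {}\<close> Ya unfolding delete_def by blast
  then obtain c0 where c0: "coloring (delete E Y) (delete E Y) (D + s) c0" using IH by blast
  define F0 where "F0 = {e \<in> E. e \<inter> Y = {} \<and> e \<inter> big \<noteq> {}}"
  define M where "M = {{y, b} | y b. y \<in> Y \<and> b \<in> N y \<inter> big \<and> b \<noteq> a}"
  have F0E: "F0 \<subseteq> E" unfolding F0_def by blast
  have ME: "M \<subseteq> E" unfolding M_def neighbors_def by blast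
  have c0': "coloring E F0 (D + s) c0"
    by (rule coloring_subset[OF coloring_delete[OF c0]]) (auto simp: F0_def delete_def)
  have Fbig: "f \<inter> big \<noteq> {}" if "f \<in> F0 \<union> M" for f using that unfolding F0_def M_def by blast
  have FY: "b \<noteq> a \<and> b \<in> big \<and> b \<in> N y" if f: "{y, b} \<in> F0 \<union> M" and y: "y \<in> Y" for y b
  proof -
    have "{y, b} \<in> M" using f y unfolding F0_def by blast
    then obtain y' b' where yb: "{y, b} = {y', b'}" "y' \<in> Y" "b' \<in> N y' \<inter> big" "b' \<noteq> a" unfolding M_def by blast
    have "y \<noteq> b'" using y yb(3) Ynb by blast
    then have "y = y' \<and> b = b'" using yb(1) by (auto simp: doubleton_eq_iff)
    then show ?thesis using yb by blast
  qed
  have Fa: "w \<notin> Y" if "{a, w} \<in> F0 \<union> M" for w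
  proof
    assume "w \<in> Y"
    moreover have "{w, a} \<in> F0 \<union> M" using that by (simp add: insert_commute)
    ultimately show False using FY by blast
  qed
  have "\<exists>c1. coloring E (F0 \<union> M) (D + s) c1"
  proof (rule coloring_greedy_set[OF c0' F0E ME finE edge2])
    fix e assume "e \<in> M"
    then obtain y b where e: "e = {y, b}" "y \<in> Y" "b \<in> N y \<inter> big" "b \<noteq> a" unfolding M_def by blast
    have ybE: "{y, b} \<in> E" using e(3) unfolding neighbors_def by blast
    have FE: "F0 \<union> M \<subseteq> E" using F0E ME by blast
    have an: "a \<in> N y" using YN e(2) N_sym by blast
    have two: "card (N y \<inter> big) \<le> 2" using YV[OF e(2)] unfolding heavy_def by auto
    have yb2: "N y \<inter> big = {a, b}"
    proof -
      have "{a, b} \<subseteq> N y \<inter> big" using an a e(3) by blast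
      moreover have "card {a, b} = 2" using e(4) by simp
      moreover have "finite (N y \<inter> big)" using finN by simp
      ultimately show ?thesis using two card_seteq[of "N y \<inter> big" "{a, b}"] by simp
    qed
    have "card {f \<in> F0 \<union> M. conflict E {y, b} f} \<le> card {f \<in> F0 \<union> M. y \<in> f \<and> f \<noteq> {y, b}} +
        card {f \<in> F0 \<union> M. b \<in> f \<and> f \<noteq> {y, b}} + card ((F0 \<union> M) \<inter> opposite E y b)"
      by (rule conflict_card[OF FE ybE])
    moreover have "card {f \<in> F0 \<union> M. y \<in> f \<and> f \<noteq> {y, b}} \<le> card ({} :: 'a set)"
    proof (rule card_star_le[OF FE])
      fix w assume w: "{y, w} \<in> F0 \<union> M" "w \<noteq> b"
      then have "w \<in> N y \<inter> big" "w \<noteq> a" using FY[OF w(1) e(2)] by auto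
      then show "w \<in> {}" using yb2 w(2) by blast
    qed simp
    moreover have "card {f \<in> F0 \<union> M. b \<in> f \<and> f \<noteq> {y, b}} \<le> card (N b) - 1"
      using card_star_full[OF FE, of b y] ybE by (simp add: insert_commute)
    \<comment> \<open>Opposite edges at \<open>a\<close> lead to one of the at most eleven neighbors of \<open>a\<close> in the three classes;
       the others lead from a neighbor of \<open>y\<close> to a big vertex, at most 23 since \<open>y\<close> is not loaded.\<close>
    moreover have "card ((F0 \<union> M) \<inter> opposite E y b) \<le> 34"
    proof -
      let ?B = "\<lambda>x. if x = a then Z else N x \<inter> big"
      have "card ((F0 \<union> M) \<inter> opposite E y b) \<le> (\<Sum>x\<in>insert a (N y - big). card (?B x))"
      proof (rule card_UN_image_le)
        show "(F0 \<union> M) \<inter> opposite E y b \<subseteq> (\<Union>x\<in>insert a (N y - big). (\<lambda>w. {x, w}) ` ?B x)"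
        proof (rule opposite_subset[OF FE])
          fix x w assume xw: "{x, w} \<in> F0 \<union> M" "x \<in> N y - {b}" "w \<in> N b - {y}"
          have wx: "w \<in> N x" using xw(1) FE unfolding neighbors_def by blast
          show "x \<in> insert a (N y - big) \<and> w \<in> ?B x"
          proof (cases "x \<in> big")
            case True
            then have xa: "x = a" using yb2 xw(2) by blast
            then have "w \<notin> Y" using Fa xw(1) by blast
            then have "w \<in> Z" using wx xa unfolding Y_def Z_def by blast
            then show ?thesis using xa by simp
          next
            case False
            then have "w \<in> big" using Fbig[OF xw(1)] by auto
            then show ?thesis using False xw(2) wx a by auto
          qed
        qed
      qed (use finN in \<open>auto simp: Z_def\<close>)
      also have "\<dots> = card Z + (\<Sum>x\<in>N y - big. card (N x \<inter> big))"
      proof -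
        have "(\<Sum>x\<in>insert a (N y - big). card (?B x)) = card (?B a) + (\<Sum>x\<in>N y - big. card (?B x))"
          by (rule sum.insert) (use finN a in auto)
        moreover have "(\<Sum>x\<in>N y - big. card (?B x)) = (\<Sum>x\<in>N y - big. card (N x \<inter> big))"
          by (rule sum.cong[OF refl]) (use a in auto)
        ultimately show ?thesis by simp
      qed
      also have "\<dots> \<le> 11 + 23"
      proof -
        have "card (N y \<inter> big) = 2" using yb2 e(4) by simp
        then have "\<not> 24 \<le> (\<Sum>x\<in>N y - big. card (N x \<inter> big))" using YV[OF e(2)] unfolding loaded_def by blast
        then show ?thesis using cZ by linarith
      qed
      finally show ?thesis by simp
    qed
    moreover have "card (N b) \<le> D" by (rule deg)
    ultimately have "card {f \<in> F0 \<union> M. conflict E {y, b} f} \<le> (D - 1) + 34" unfolding card.empty by linarith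
    then show "card {f \<in> F0 \<union> M. conflict E e f} < D + s" unfolding e(1) using D s by linarith
  qed
  then obtain c1 where c1: "coloring E (F0 \<union> M) (D + s) c1" by blast
  have FE: "F0 \<union> M \<subseteq> E" using F0E ME by blast
  have "\<exists>c2. coloring E ((F0 \<union> M) \<union> (\<lambda>y. {a, y}) ` Y) (D + s) c2"
  proof (rule coloring_star[OF c1 FE finE edge2 fY Ya])
    show "{a, y} \<notin> F0 \<union> M" if "y \<in> Y" for y using Fa that by blast
    show "card {x. x < D + s \<and> (\<forall>y\<in>I. \<exists>f\<in>F0 \<union> M. conflict E {a, y} f \<and> c1 f = x)} + card I \<le> D + s"
      if "I \<subseteq> Y" "I \<noteq> {}" for I
      by (rule hall_condition_big[OF s a sparse Y_def FE Fbig Fa c1 that])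
  qed
  then obtain c2 where c2: "coloring E ((F0 \<union> M) \<union> (\<lambda>y. {a, y}) ` Y) (D + s) c2" by blast
  show ?thesis
  proof (rule small_edges_last[OF c2 _ _ D s])
    show "F0 \<union> M \<union> (\<lambda>y. {a, y}) ` Y \<subseteq> E" using FE Ya by blast
    show "E \<subseteq> F0 \<union> M \<union> (\<lambda>y. {a, y}) ` Y \<union> delete E big"
    proof
      fix e assume e: "e \<in> E"
      show "e \<in> F0 \<union> M \<union> (\<lambda>y. {a, y}) ` Y \<union> delete E big"
      proof (cases "e \<inter> big = {} \<or> e \<inter> Y = {}")
        case True
        then show ?thesis using e unfolding F0_def delete_def by blast
      next
        case False
        then obtain y where y: "y \<in> e" "y \<in> Y" by blast
        obtain b where b: "e = {y, b}" "b \<in> N y" using edge_at[OF e y(1)] by blast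
        have "b \<in> big" using False b(1) y(2) Ynb by blast
        then show ?thesis using b y(2) unfolding M_def by (cases "b = a") (auto simp: insert_commute)
      qed
    qed
  qed
qed

end

theorem coloring_exists_large_codegree:
  assumes "34 \<le> s" "bounded_graph V E D s"
  shows "\<exists>c. coloring E E (D + s) c"
proof -
  interpret g: bounded_graph V E D s by (rule assms(2))
  show ?thesis
    using g.finE assms(2)
  proof (induction E rule: finite_psubset_induct)
    case (psubset E)
    interpret bounded_graph V E D s by (rule psubset.prems)
    have IH: "\<exists>c. coloring E' E' (D + s) c" if "E' \<subset> E" for E'
      by (rule psubset.IH[OF that]) (use subgraph that in blast)
    show ?case
    proof (cases "D \<le> 25")
      case True
      show ?thesis by (rule coloring_exists_step_small_degree[OF IH True assms(1)])
    next
      case False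
      then have "26 \<le> D" by simp
      show ?thesis by (rule coloring_exists_step_large_degree[OF IH \<open>26 \<le> D\<close> assms(1)])
    qed
  qed
qed

context bounded_graph
begin

section \<open>Large maximum degree: peeling and clusters\<close>

lemma codeg_minus:
  assumes "u \<noteq> v" "z \<in> N u" "z \<in> N v"
  shows "card (N u \<inter> N v - {z}) \<le> s - 1"
proof -
  have "card (N u \<inter> N v - {z}) = card (N u \<inter> N v) - 1"
    using assms finN by simp
  then show ?thesis using codeg[OF assms(1)] by linarith
qed

text \<open>Vertices outside \<open>H\<close> that have at most five neighbors left are removed one after the other. The
  number \<open>pos\<close> decreases along the removal, so the neighbors left when \<open>x\<close> is removed are those in
  the remaining core \<open>K\<close> and those with a smaller number.\<close>

lemma peeling:
  assumes "finite S"
  shows "\<exists>K pos. K \<subseteq> S \<and> inj_on pos (S - K) \<and>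
    (\<forall>x\<in>S - K. x \<notin> H \<and> pos x \<le> card S \<and> card (N x \<inter> (K \<union> {x' \<in> S - K. pos x' < pos x})) \<le> 5) \<and>
    (\<forall>v\<in>K. v \<notin> H \<longrightarrow> 6 \<le> card (N v \<inter> K))"
  using assms
proof (induction "card S" arbitrary: S rule: less_induct)
  case less
  show ?case
  proof (cases "\<exists>v\<in>S. v \<notin> H \<and> card (N v \<inter> S) \<le> 5")
    case False
    then show ?thesis by (intro exI[of _ S] exI[of _ "\<lambda>_. 0"]) (auto simp: not_le)
  next
    case True
    then obtain v where v: "v \<in> S" "v \<notin> H" "card (N v \<inter> S) \<le> 5" by blast
    have lt: "card (S - {v}) < card S" by (rule card_Diff1_less[OF less.prems v(1)])
    have "finite (S - {v})" using less.prems by simp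
    from less.hyps[OF lt this] obtain K pos where K: "K \<subseteq> S - {v}" "inj_on pos (S - {v} - K)"
      "\<forall>x\<in>S - {v} - K. x \<notin> H \<and> pos x \<le> card (S - {v}) \<and>
        card (N x \<inter> (K \<union> {x' \<in> S - {v} - K. pos x' < pos x})) \<le> 5"
      "\<forall>v\<in>K. v \<notin> H \<longrightarrow> 6 \<le> card (N v \<inter> K)" by (elim exE conjE)
    define pos' where "pos' = pos(v := card S)"
    have vK: "v \<notin> K" using K(1) by blast
    have old: "pos' x = pos x" if "x \<noteq> v" for x using that unfolding pos'_def by simp
    have new: "pos' v = card S" unfolding pos'_def by simp
    have small: "pos x < card S" if "x \<in> S - {v} - K" for x
    proof -
      have "pos x \<le> card (S - {v})" using K(3) that by blast
      then show ?thesis using lt by linarith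
    qed
    have SK: "S - K = insert v (S - {v} - K)" using v(1) vK by blast
    have inj: "inj_on pos' (S - K)"
    proof (rule inj_onI)
      fix x y assume xy: "x \<in> S - K" "y \<in> S - K" "pos' x = pos' y"
      show "x = y"
      proof (cases "x = v \<or> y = v")
        case True
        then show ?thesis using xy small[of x] small[of y] old[of x] old[of y] new by fastforce
      next
        case False
        then show ?thesis using xy old inj_onD[OF K(2), of x y] by simp
      qed
    qed
    have "x \<notin> H \<and> pos' x \<le> card S \<and> card (N x \<inter> (K \<union> {x' \<in> S - K. pos' x' < pos' x})) \<le> 5"
      if x: "x \<in> S - K" for x
    proof (cases "x = v")
      case True
      have "card (N v \<inter> (K \<union> {x' \<in> S - K. pos' x' < pos' v})) \<le> card (N v \<inter> S)"
        by (rule card_mono) (use finN K(1) in auto)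
      then show ?thesis using True v(2,3) new by simp
    next
      case False
      then have x': "x \<in> S - {v} - K" using x by blast
      have "{x' \<in> S - K. pos' x' < pos' x} = {x' \<in> S - {v} - K. pos x' < pos x}"
      proof (intro equalityI subsetI)
        fix z assume z: "z \<in> {x' \<in> S - K. pos' x' < pos' x}"
        then have "z \<noteq> v" using new old[OF False] small[OF x'] by auto
        then show "z \<in> {x' \<in> S - {v} - K. pos x' < pos x}" using z old False by simp
      next
        fix z assume "z \<in> {x' \<in> S - {v} - K. pos x' < pos x}"
        then show "z \<in> {x' \<in> S - K. pos' x' < pos' x}" using old False by simp
      qed
      then show ?thesis using K(3) x' old[OF False] small[OF x'] by simp
    qed
    then show ?thesis using K(1,4) inj by (intro exI[of _ K] exI[of _ pos']) blast
  qed
qed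

text \<open>Edges outside the core are colored in the reverse order of the removal of their first removed
  endpoint \<open>x\<close>. At that moment \<open>x\<close> has at most four other colored edges, and the other
  endpoint has degree at most \<open>D - 8 * s + 5\<close>. A colored opposite edge starts at one of the at most
  four other neighbors of \<open>x\<close> that were left when it was removed, or ends at one of the at most five core neighbors of the other
  endpoint; in both cases the codegree leaves \<open>s - 1\<close> possibilities.\<close>

lemma peeled_edges_last:
  fixes pos :: "'a \<Rightarrow> nat"
  assumes inj: "inj_on pos (V - K)"
    and peel: "\<And>x. x \<in> V - K \<Longrightarrow> card (N x \<inter> (K \<union> {x' \<in> V - K. pos x' < pos x})) \<le> 5"
    and degx: "\<And>x. x \<in> V - K \<Longrightarrow> card (N x) + 8 * s \<le> D + 5" and s: "1 \<le> s"
    and c: "coloring E {e \<in> E. e \<inter> K \<noteq> {}} (D + s) c"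
  shows "\<exists>c. coloring E E (D + s) c"
proof -
  let ?F = "{e \<in> E. e \<inter> K \<noteq> {}}" and ?M = "{e \<in> E. e \<inter> K = {}}"
  define R where "R x = N x \<inter> (K \<union> {x' \<in> V - K. pos x' < pos x})" for x
  define rank where "rank e = Max (pos ` e)" for e
  have EFM: "?F \<union> ?M = E" by blast
  have fR: "finite (R x)" for x unfolding R_def using finN by simp
  have "\<exists>c'. coloring E (?F \<union> ?M) (D + s) c'"
  proof (rule coloring_greedy_ranked[where rank = rank, OF c _ _ finE edge2])
    fix e assume e: "e \<in> ?M"
    have "\<exists>x x'. e = {x, x'} \<and> pos x' < pos x"
    proof -
      obtain p q where pq: "e = {p, q}" "p \<noteq> q" using edge2 e by (metis (no_types, lifting) card_2_iff mem_Collect_eq)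
      have "p \<in> V - K" "q \<in> V - K" using e pq edgeV by auto
      then have "pos p \<noteq> pos q" using inj_onD[OF inj] pq(2) by blast
      then have "pos q < pos p \<or> pos p < pos q" by linarith
      then show ?thesis using pq(1) by (metis insert_commute)
    qed
    then obtain x x' where x: "e = {x, x'}" "pos x' < pos x" by blast
    have xE: "{x, x'} \<in> E" using e x(1) by blast
    have xx: "x \<noteq> x'" using x(2) by auto
    have XV: "x \<in> V - K" "x' \<in> V - K" using e x(1) edgeV by auto
    have rk: "rank e = pos x" unfolding rank_def x(1) using x(2) by simp
    define G where "G = {f \<in> ?F \<union> ?M. f \<in> ?F \<or> rank f \<le> rank e}"
    have GE: "G \<subseteq> E" unfolding G_def by blast
    have x'R: "x' \<in> R x" using xE XV(2) x(2) unfolding R_def neighbors_def by simp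
    \<comment> \<open>If a neighbor of \<open>x\<close> was removed before \<open>x\<close>, its colored edges lead to the core.\<close>
    have low: "q \<in> R x \<or> q = x \<or> p \<in> K" if f: "{p, q} \<in> G" "q \<in> N x" for p q
    proof (cases "{p, q} \<inter> K = {}")
      case False
      then show ?thesis using f(2) unfolding R_def by auto
    next
      case True
      have fE: "{p, q} \<in> E" using f(1) GE by blast
      then have qV: "q \<in> V - K" using edgeV True by auto
      have "rank {p, q} \<le> pos x" using f(1) True rk unfolding G_def by simp
      then have "pos q \<le> pos x" unfolding rank_def by simp
      then have "q = x \<or> pos q < pos x" using inj_onD[OF inj _ qV XV(1)] by fastforce
      then show ?thesis using f(2) qV unfolding R_def by blast
    qed
    have "card {f \<in> G. conflict E {x, x'} f} \<le> card {f \<in> G. x \<in> f \<and> f \<noteq> {x, x'}} +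
        card {f \<in> G. x' \<in> f \<and> f \<noteq> {x, x'}} + card (G \<inter> opposite E x x')"
      by (rule conflict_card[OF GE xE])
    moreover have "card {f \<in> G. x \<in> f \<and> f \<noteq> {x, x'}} \<le> card (R x - {x'})"
    proof (rule card_star_le[OF GE])
      fix w assume w: "{x, w} \<in> G" "w \<noteq> x'"
      have wx: "w \<in> N x" using w(1) GE unfolding neighbors_def by blast
      then have "w \<noteq> x" using N_irrefl by blast
      then have "w \<in> R x" using low[OF w(1) wx] XV(1) by blast
      then show "w \<in> R x - {x'}" using w(2) by blast
    qed (use fR in simp)
    moreover have R4: "card (R x - {x'}) \<le> 4"
      using peel[OF XV(1)] x'R fR unfolding R_def by simp
    moreover have "card {f \<in> G. x' \<in> f \<and> f \<noteq> {x, x'}} \<le> card (N x') - 1"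
      using card_star_full[OF GE, of x' x] xE by (simp add: insert_commute)
    moreover have "card (N x') + 8 * s \<le> D + 5" by (rule degx[OF XV(2)])
    moreover have "card (N x') \<ge> 1"
    proof -
      have "x \<in> N x'" using xE by (simp add: neighbors_def insert_commute)
      then show ?thesis using finN by (auto simp: Suc_le_eq card_gt_0_iff)
    qed
    moreover have "card (G \<inter> opposite E x x') \<le> 4 * (s - 1) + 5 * (s - 1)"
    proof -
      let ?O1 = "\<Union>p\<in>R x - {x'}. (\<lambda>q. {p, q}) ` (N p \<inter> N x' - {x})"
      let ?O2 = "\<Union>q\<in>N x' \<inter> K. (\<lambda>p. {q, p}) ` (N q \<inter> N x - {x'})"
      have fin: "finite ?O1" "finite ?O2" using fR finN by auto
      have sub: "G \<inter> opposite E x x' \<subseteq> ?O1 \<union> ?O2"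
      proof
        fix f assume f: "f \<in> G \<inter> opposite E x x'"
        then have "f \<in> opposite E x x'" by blast
        then obtain p q where pq: "f = {p, q}" "{x, p} \<in> E" "{x', q} \<in> E" "{p, q} \<in> E" "p \<noteq> x'" "q \<noteq> x"
          using oppositeD[of f E x x'] by blast
        have pN: "p \<in> N x" "q \<in> N x'" "q \<in> N p" "p \<in> N q"
          using pq by (simp_all add: neighbors_def insert_commute)
        have "p \<noteq> x" using pN(1) N_irrefl by blast
        moreover have "{q, p} \<in> G" using f pq(1) by (simp add: insert_commute)
        ultimately have "p \<in> R x \<or> q \<in> K" using low[of q p] pN(1) by blast
        then show "f \<in> ?O1 \<union> ?O2"
        proof
          assume "p \<in> R x"
          then have "f \<in> ?O1" using pq pN by blast
          then show ?thesis by blast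
        next
          assume "q \<in> K"
          moreover have "f = {q, p}" using pq(1) by (simp add: insert_commute)
          ultimately have "f \<in> ?O2" using pq(5) pN by blast
          then show ?thesis by blast
        qed
      qed
      have "card ?O1 \<le> (\<Sum>p\<in>R x - {x'}. card (N p \<inter> N x' - {x}))"
        by (rule card_UN_image_le[OF _ _ subset_refl]) (use fR finN in auto)
      also have "\<dots> \<le> (\<Sum>p\<in>R x - {x'}. s - 1)"
      proof (rule sum_mono)
        fix p assume p: "p \<in> R x - {x'}"
        show "card (N p \<inter> N x' - {x}) \<le> s - 1"
        proof (rule codeg_minus)
          show "p \<noteq> x'" using p by blast
          show "x \<in> N p" using p N_sym unfolding R_def by blast
          show "x \<in> N x'" using xE by (simp add: neighbors_def insert_commute)
        qed
      qed
      also have "\<dots> \<le> 4 * (s - 1)" using mult_le_mono1[OF R4, of "s - 1"] by simp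
      finally have 1: "card ?O1 \<le> 4 * (s - 1)" .
      have "card ?O2 \<le> (\<Sum>q\<in>N x' \<inter> K. card (N q \<inter> N x - {x'}))"
        by (rule card_UN_image_le[OF _ _ subset_refl]) (use finN in auto)
      also have "\<dots> \<le> (\<Sum>q\<in>N x' \<inter> K. s - 1)"
      proof (rule sum_mono)
        fix q assume q: "q \<in> N x' \<inter> K"
        show "card (N q \<inter> N x - {x'}) \<le> s - 1"
        proof (rule codeg_minus)
          show "q \<noteq> x" using q XV(1) by blast
          show "x' \<in> N q" using q N_sym by blast
          show "x' \<in> N x" using xE by (simp add: neighbors_def)
        qed
      qed
      also have "\<dots> \<le> 5 * (s - 1)"
      proof -
        have "card (N x' \<inter> K) \<le> card (R x')" by (rule card_mono[OF fR]) (auto simp: R_def)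
        also have "\<dots> \<le> 5" unfolding R_def by (rule peel[OF XV(2)])
        finally show ?thesis using mult_le_mono1[of "card (N x' \<inter> K)" 5 "s - 1"] by simp
      qed
      finally have 2: "card ?O2 \<le> 5 * (s - 1)" .
      have "card (G \<inter> opposite E x x') \<le> card (?O1 \<union> ?O2)"
        by (rule card_mono[OF _ sub]) (use fin in simp)
      also have "\<dots> \<le> card ?O1 + card ?O2" by (rule card_Un_le)
      finally show ?thesis using 1 2 by linarith
    qed
    ultimately have "card {f \<in> G. conflict E {x, x'} f} < D + s" using s by linarith
    moreover have "{f \<in> ?F \<union> ?M. conflict E e f \<and> (f \<in> ?F \<or> rank f \<le> rank e)} = {f \<in> G. conflict E {x, x'} f}"
      unfolding G_def x(1) by blast
    ultimately show "card {f \<in> ?F \<union> ?M. conflict E e f \<and> (f \<in> ?F \<or> rank f \<le> rank e)} < D + s"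
      by (simp only:)
  qed auto
  then show ?thesis unfolding EFM .
qed

text \<open>Contract every peeled vertex with a core neighbor onto one of its core neighbors. The contracted
  graph on the core is planar, so some \<open>a\<close> has at most five neighbors \<open>Q\<close> in it. A peeled neighbor
  of \<open>a\<close> with another core neighbor is adjacent to a member of \<open>Q\<close>: its own cluster if that is not the
  cluster of \<open>a\<close>, and otherwise the other core neighbor.\<close>

lemma center_few_clusters:
  assumes K: "K \<subseteq> V" "K \<noteq> {}"
  shows "\<exists>a\<in>K. \<exists>Q. card Q \<le> 5 \<and> finite Q \<and> a \<notin> Q \<and> N a \<inter> K \<subseteq> Q \<and>
    (\<forall>x\<in>N a - K. N x \<inter> K \<noteq> {a} \<longrightarrow> (\<exists>w\<in>Q. x \<in> N w))"
proof -
  define S where "S = {u \<in> V. u \<in> K \<or> N u \<inter> K \<noteq> {}}"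
  define r where "r u = (if u \<in> K then u else SOME w. w \<in> N u \<inter> K)" for u
  have fK: "finite K" by (rule finite_subset[OF K(1) finV])
  have rK: "r u = u" if "u \<in> K" for u using that unfolding r_def by simp
  have rN: "r u \<in> N u \<inter> K" if "u \<notin> K" "N u \<inter> K \<noteq> {}" for u
    using that someI_ex[of "\<lambda>w. w \<in> N u \<inter> K"] unfolding r_def by auto
  have KS: "K \<subseteq> S" using K(1) unfolding S_def by blast
  have rS: "r u \<in> K" if "u \<in> S" for u using that rK rN unfolding S_def by (cases "u \<in> K") auto
  have img: "r ` S = K"
  proof
    show "r ` S \<subseteq> K" using rS by blast
    show "K \<subseteq> r ` S" using KS rK by force
  qed
  define P where "P = {q. card q = 2 \<and> (\<exists>l\<in>E. l \<subseteq> S \<and> r ` l = q)}"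
  have "P \<subseteq> (`) r ` E" unfolding P_def by blast
  then have fP: "finite P" using finE by (meson finite_imageI finite_subset)
  have P2: "card q = 2" if "q \<in> P" for q using that unfolding P_def by blast
  have "card P + 3 \<le> 3 * card (r ` S)"
  proof (rule contraction_edges(1))
    show "S \<subseteq> V" unfolding S_def by blast
    show "r x \<in> S \<and> r (r x) = r x \<and> (r x = x \<or> {x, r x} \<in> E)" if x: "x \<in> S" for x
    proof (cases "x \<in> K")
      case True
      then show ?thesis using rK x by simp
    next
      case False
      then have "r x \<in> N x \<inter> K" using rN x unfolding S_def by blast
      then show ?thesis using KS rK unfolding neighbors_def by auto
    qed
    show "card q = 2 \<and> (\<exists>l\<in>E. l \<subseteq> S \<and> r ` l = q)" if "q \<in> P" for q using that unfolding P_def by simp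
    show "1 \<le> card (r ` S)" unfolding img using K(2) fK by (simp add: Suc_le_eq card_gt_0_iff)
  qed
  then have cP: "card P + 3 \<le> 3 * card K" unfolding img .
  have PK: "\<Union>P \<subseteq> K"
  proof
    fix v assume "v \<in> \<Union>P"
    then obtain q l where "v \<in> q" "l \<subseteq> S" "r ` l = q" unfolding P_def by blast
    then have "v \<in> r ` S" by (metis image_mono subsetD)
    then show "v \<in> K" using img by simp
  qed
  have "\<exists>a\<in>K. card {q \<in> P. a \<in> q} \<le> 5"
  proof (rule ccontr)
    assume no: "\<not> ?thesis"
    have six: "6 \<le> card {q \<in> P. a \<in> q}" if "a \<in> K" for a using no that by force
    have "K \<subseteq> \<Union>P"
    proof
      fix a assume "a \<in> K"
      then have "{q \<in> P. a \<in> q} \<noteq> {}" using six by (metis card.empty not_numeral_le_zero)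
      then show "a \<in> \<Union>P" by blast
    qed
    then have eq: "\<Union>P = K" using PK by blast
    have "(\<Sum>a\<in>K. 6) \<le> (\<Sum>a\<in>K. card {q \<in> P. a \<in> q})" by (rule sum_mono) (rule six)
    also have "\<dots> = 2 * card P" using handshake[OF fP P2] unfolding eq by simp
    finally show False using cP by simp
  qed
  then obtain a where a: "a \<in> K" "card {q \<in> P. a \<in> q} \<le> 5" by blast
  define Q where "Q = {w. w \<noteq> a \<and> {a, w} \<in> P}"
  have QK: "Q \<subseteq> K" using PK unfolding Q_def by blast
  have fQ: "finite Q" by (rule finite_subset[OF QK fK])
  have "card Q \<le> card {q \<in> P. a \<in> q}"
  proof (rule card_inj_on_le)
    show "inj_on (\<lambda>w. {a, w}) Q" by (rule inj_onI) (auto simp: doubleton_eq_iff)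
    show "(\<lambda>w. {a, w}) ` Q \<subseteq> {q \<in> P. a \<in> q}" unfolding Q_def by blast
  qed (use fP in simp)
  then have cQ: "card Q \<le> 5" using a(2) by linarith
  have link: "r v \<in> Q" if uv: "{u, v} \<in> E" "u \<in> S" "v \<in> S" "r u = a" "r v \<noteq> a" for u v
  proof -
    have "r ` {u, v} = {a, r v}" using uv(4) by simp
    moreover have "card {a, r v} = 2" using uv(5) by simp
    moreover have "{u, v} \<subseteq> S" using uv(2,3) by simp
    ultimately have "{a, r v} \<in> P" using uv(1) unfolding P_def by (intro CollectI conjI bexI[of _ "{u, v}"])
    then show ?thesis using uv(5) unfolding Q_def by simp
  qed
  have aS: "a \<in> S" using a(1) KS by blast
  have NQ: "N a \<inter> K \<subseteq> Q"
  proof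
    fix w assume w: "w \<in> N a \<inter> K"
    then have wa: "w \<noteq> a" using N_irrefl by blast
    have "r w \<in> Q" by (rule link[of a]) (use w wa a(1) aS KS rK in \<open>auto simp: neighbors_def\<close>)
    then show "w \<in> Q" using rK w by simp
  qed
  have "\<exists>w\<in>Q. x \<in> N w" if x: "x \<in> N a - K" "N x \<inter> K \<noteq> {a}" for x
  proof -
    have ax: "{a, x} \<in> E" using x(1) unfolding neighbors_def by blast
    have aNx: "a \<in> N x" using x(1) N_sym by blast
    have xS: "x \<in> S" using x(1) aNx a(1) N_V unfolding S_def by blast
    have rx: "r x \<in> N x \<inter> K" by (rule rN) (use x(1) aNx a(1) in auto)
    show ?thesis
    proof (cases "r x = a")
      case False
      have "r x \<in> Q" by (rule link[OF ax aS xS rK[OF a(1)] False])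
      then show ?thesis using rx N_sym by blast
    next
      case True
      obtain w where w: "w \<in> N x \<inter> K" "w \<noteq> a" using x(2) aNx a(1) by blast
      have "r w \<in> Q"
        by (rule link[of x]) (use w xS KS True rK in \<open>auto simp: neighbors_def\<close>)
      then have "w \<in> Q" using rK w by simp
      then show ?thesis using w N_sym by blast
    qed
  qed
  then show ?thesis using a(1) cQ fQ NQ unfolding Q_def by (intro bexI[of _ a] exI[of _ Q]) (auto simp: Q_def)
qed

text \<open>The members of \<open>Y\<close> have no core neighbor besides \<open>a\<close>. A color of \<open>C'\<close> therefore reaches \<open>y\<close> along an
  edge from a peeled neighbor \<open>v\<close> of \<open>y\<close> to one of the at most five core neighbors \<open>w\<close> of \<open>a\<close>. The
  codegree bounds both \<open>C'\<close> and \<open>I\<close> by \<open>5 * (s - 1)\<close>, while together they have at least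
  \<open>9 * s - 4\<close> elements; so both are large. Contract each vertex \<open>v\<close> onto one of its neighbors in
  \<open>W\<close>. If every member of \<open>I\<close> met two of the clusters, it would have, with \<open>a\<close>, three neighbors
  in a bipartite planar graph whose other side has at most six vertices, and \<open>I\<close> would be too small.
  So some \<open>y\<close> meets at most one cluster, and only \<open>s - 1\<close> vertices \<open>v\<close> remain for it. To
  see all colors of \<open>C'\<close>, two of these would have to be adjacent to the same five vertices of \<open>W\<close>, like
  \<open>a\<close>, which planarity excludes.\<close>

lemma hall_condition_leaves:
  assumes s: "2 \<le> s" and D: "13 * s \<le> D" and K: "K \<subseteq> V" and a: "a \<in> K" and aK: "card (N a \<inter> K) \<le> 5"
    and Y: "Y = {y \<in> N a - K. N y \<inter> K = {a}}" and many: "card (N a) \<le> card Y + 5 * s + 5"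
    and F: "F \<subseteq> E" "\<And>f. f \<in> F \<Longrightarrow> f \<inter> K \<noteq> {}" "\<And>f. f \<in> F \<Longrightarrow> f \<inter> Y = {}"
    and c: "coloring E F (D + s) c" and I: "I \<subseteq> Y" "I \<noteq> {}"
  shows "card {x. x < D + s \<and> (\<forall>y\<in>I. \<exists>f\<in>F. conflict E {a, y} f \<and> c f = x)} + card I \<le> D + s"
proof (rule ccontr)
  assume contra: "\<not> ?thesis"
  define W where "W = N a \<inter> K"
  have YN: "Y \<subseteq> N a" unfolding Y by blast
  have fY: "finite Y" by (rule finite_subset[OF YN finN])
  have fI: "finite I" by (rule finite_subset[OF I(1) fY])
  have cI: "card I \<le> card Y" by (rule card_mono[OF fY I(1)])
  have fW: "finite W" and WN: "W \<subseteq> N a" and WK: "W \<subseteq> K" unfolding W_def using finN by auto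
  have aW: "a \<notin> W" using WN N_irrefl by blast
  have W5: "card W \<le> 5" using aK unfolding W_def .
  have YK: "y \<notin> K" "N y \<inter> K = {a}" "y \<in> N a" "a \<in> N y" if "y \<in> Y" for y
    using that N_sym unfolding Y by blast+
  have Fa: "\<forall>w. {a, w} \<in> F \<longrightarrow> w \<notin> Y" using F(3) by blast
  obtain C' where C': "finite C'" "D + s + card Y < card C' + card I + card (N a)"
    "\<forall>x\<in>C'. \<forall>y\<in>I. \<exists>f\<in>F. c f = x \<and> a \<notin> f \<and> (y \<in> f \<or> f \<in> opposite E a y)"
    using hall_violation[OF F(1) Fa YN I(1) contra] by (elim exE conjE)
  have sum9: "9 * s \<le> card C' + card I + 4" using C'(2) many D by linarith
  have ne: "s + 1 \<le> card C'" using C'(2) deg[of a] cI by linarith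
  have seen: "\<exists>v w. v \<in> N y - K \<and> w \<in> W \<and> w \<in> N v \<and> {v, w} \<in> F \<and> c {v, w} = x"
    if y: "y \<in> I" and x: "x \<in> C'" for x y
  proof -
    have yY: "y \<in> Y" using y I(1) by blast
    obtain f where f: "f \<in> F" "c f = x" "y \<in> f \<or> f \<in> opposite E a y" using C'(3) x y by blast
    have "y \<notin> f" using F(3)[OF f(1)] yY by blast
    then have "f \<in> opposite E a y" using f(3) by blast
    then obtain w v where wv: "f = {w, v}" "w \<in> N a" "w \<noteq> y" "v \<in> N y" "v \<noteq> a"
      unfolding opposite_def by blast
    have vF: "{v, w} \<in> F" "c {v, w} = x" using f wv(1) by (simp_all add: insert_commute)
    then have wv': "w \<in> N v" using F(1) unfolding neighbors_def by blast
    have vK: "v \<notin> K" using YK(2)[OF yY] wv(4,5) by blast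
    then have "w \<in> K" using F(2)[OF vF(1)] by auto
    then show ?thesis using wv vF wv' vK unfolding W_def by blast
  qed
  have C5: "card C' \<le> 5 * (s - 1)"
  proof -
    obtain y where y: "y \<in> I" using I(2) by blast
    have yY: "y \<in> Y" using y I(1) by blast
    have "card C' \<le> (\<Sum>w\<in>W. card (N y \<inter> N w - {a}))"
    proof (rule card_UN_image_le[where h = "\<lambda>w v. c {w, v}"])
      show "C' \<subseteq> (\<Union>w\<in>W. (\<lambda>v. c {w, v}) ` (N y \<inter> N w - {a}))"
      proof
        fix x assume x: "x \<in> C'"
        obtain v w where vw: "v \<in> N y - K" "w \<in> W" "w \<in> N v" "c {v, w} = x" using seen[OF y x] by blast
        have "v \<in> N y \<inter> N w - {a}" using vw a N_sym by blast
        moreover have "x = c {w, v}" using vw(4) by (simp add: insert_commute)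
        ultimately show "x \<in> (\<Union>w\<in>W. (\<lambda>v. c {w, v}) ` (N y \<inter> N w - {a}))" using vw(2) by blast
      qed
    qed (use fW finN in auto)
    also have "\<dots> \<le> (\<Sum>w\<in>W. s - 1)"
    proof (rule sum_mono)
      fix w assume w: "w \<in> W"
      show "card (N y \<inter> N w - {a}) \<le> s - 1"
      proof (rule codeg_minus)
        show "y \<noteq> w" using w WK YK(1)[OF yY] by blast
        show "a \<in> N y" by (rule YK(4)[OF yY])
        show "a \<in> N w" using w WN N_sym by blast
      qed
    qed
    also have "\<dots> \<le> 5 * (s - 1)" using mult_le_mono1[OF W5, of "s - 1"] by simp
    finally show ?thesis .
  qed
  \<comment> \<open>One color \<open>\<gamma>\<close> of \<open>C'\<close> lies on at most one edge at each \<open>w\<close>, and its other end \<open>v\<close> has at most \<open>s\<close>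
     common neighbors with \<open>a\<close>, among them \<open>w\<close>.\<close>
  have I5: "card I \<le> 5 * (s - 1)"
  proof -
    obtain \<gamma> where \<gamma>: "\<gamma> \<in> C'" using ne by (metis card.empty ex_in_conv le_zero_eq add_is_0 one_neq_zero)
    define Z where "Z w = {y \<in> I. \<exists>v\<in>N y - K. w \<in> N v \<and> {v, w} \<in> F \<and> c {v, w} = \<gamma>}" for w
    have Zw: "card (Z w) \<le> s - 1" if w: "w \<in> W" for w
    proof (cases "Z w = {}")
      case True
      then have "card (Z w) = 0" by (simp only: card.empty)
      then show ?thesis by simp
    next
      case False
      then obtain y1 v where v: "v \<in> N y1 - K" "w \<in> N v" "{v, w} \<in> F" "c {v, w} = \<gamma>"
        unfolding Z_def by blast
      have va: "v \<noteq> a" using v(1) a by blast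
      have "Z w \<subseteq> N a \<inter> N v - {w}"
      proof
        fix y assume y: "y \<in> Z w"
        then obtain v' where v': "v' \<in> N y - K" "{v', w} \<in> F" "c {v', w} = \<gamma>" "y \<in> I"
          unfolding Z_def by blast
        have "v' = v" by (rule coloring_unique_at[OF c v'(2) v(3)]) (use v(4) v'(3) in simp)
        moreover have "y \<in> N a" "y \<noteq> w" using v'(4) I(1) YK w WK by blast+
        ultimately show "y \<in> N a \<inter> N v - {w}" using v'(1) N_sym by blast
      qed
      then have "card (Z w) \<le> card (N a \<inter> N v - {w})" by (rule card_mono[rotated]) (use finN in simp)
      also have "\<dots> \<le> s - 1" by (rule codeg_minus) (use va v(2) w WN in auto)
      finally show ?thesis .
    qed
    have "I \<subseteq> (\<Union>w\<in>W. Z w)"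
    proof
      fix y assume y: "y \<in> I"
      obtain v w where "v \<in> N y - K" "w \<in> W" "w \<in> N v" "{v, w} \<in> F" "c {v, w} = \<gamma>"
        using seen[OF y \<gamma>] by blast
      then show "y \<in> (\<Union>w\<in>W. Z w)" using y unfolding Z_def by blast
    qed
    then have "card I \<le> card (\<Union>w\<in>W. Z w)"
      by (rule card_mono[rotated]) (use fW fI in \<open>auto simp: Z_def\<close>)
    also have "\<dots> \<le> (\<Sum>w\<in>W. card (Z w))" by (rule card_UN_le[OF fW])
    also have "\<dots> \<le> (\<Sum>w\<in>W. s - 1)" by (rule sum_mono) (rule Zw)
    also have "\<dots> \<le> 5 * (s - 1)" using mult_le_mono1[OF W5, of "s - 1"] by simp
    finally show ?thesis .
  qed
  have C4: "4 * s + 1 \<le> card C'" and I9: "9 \<le> card I" using sum9 C5 I5 s by linarith+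
  define U where "U = {v \<in> V - K. N v \<inter> W \<noteq> {}}"
  define r where "r v = (if v \<in> U then SOME w. w \<in> N v \<inter> W else v)" for v
  have rU: "r v \<in> N v \<inter> W" if "v \<in> U" for v
    using that someI_ex[of "\<lambda>w. w \<in> N v \<inter> W"] unfolding r_def U_def by auto
  have rid: "r v = v" if "v \<notin> U" for v using that unfolding r_def by simp
  have KU: "v \<notin> U" if "v \<in> K" for v using that unfolding U_def by blast
  have IU: "y \<notin> U" if "y \<in> I" for y
  proof -
    have "y \<in> Y" using that I(1) by blast
    then have eq: "N y \<inter> K = {a}" by (rule YK(2))
    show ?thesis
    proof
      assume "y \<in> U"
      then obtain w where w: "w \<in> N y" "w \<in> W" unfolding U_def by blast
      then have "w \<in> N y \<inter> K" using WK by blast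
      then have "w = a" unfolding eq by simp
      then show False using aW w(2) by simp
    qed
  qed
  have "\<exists>y\<in>I. card (r ` (N y \<inter> U)) \<le> 1"
  proof (rule ccontr)
    assume no: "\<not> ?thesis"
    define R where "R = Sigma I (\<lambda>y. insert a (r ` (N y \<inter> U)))"
    let ?S = "I \<union> insert a W \<union> U"
    have "card R + 4 \<le> 2 * (card I + card (insert a W))"
    proof (rule contraction_bipartite(2))
      show "?S \<subseteq> V" using I(1) YN N_V WK a K unfolding U_def by blast
      show "r x \<in> ?S \<and> r (r x) = r x \<and> (r x = x \<or> {x, r x} \<in> E)" if "x \<in> ?S" for x
      proof (cases "x \<in> U")
        case True
        have "r x \<in> N x \<inter> W" by (rule rU[OF True])
        moreover have "r (r x) = r x" by (rule rid) (use calculation WK KU in blast)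
        ultimately show ?thesis unfolding neighbors_def by blast
      next
        case False
        then show ?thesis using rid that by simp
      qed
      show "I \<inter> insert a W = {}" using I(1) YK(1) WK a by blast
      show "finite I" "finite (insert a W)" using fI fW by auto
      show "y \<in> I \<and> w \<in> insert a W \<and> (\<exists>u\<in>?S. \<exists>v\<in>?S. {u, v} \<in> E \<and> r u = y \<and> r v = w)"
        if yw: "(y, w) \<in> R" for y w
      proof -
        have y: "y \<in> I" and w: "w \<in> insert a (r ` (N y \<inter> U))" using yw unfolding R_def by auto
        from w show ?thesis
        proof
          assume wa: "w = a"
          have "{y, a} \<in> E" using YK(4) y I(1) unfolding neighbors_def by blast
          moreover have "r y = y" "r a = a" using rid IU[OF y] KU[OF a] by auto
          ultimately show ?thesis using y wa by blast
        next
          assume "w \<in> r ` (N y \<inter> U)"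
          then obtain v where v: "v \<in> N y" "v \<in> U" "w = r v" by blast
          have "{y, v} \<in> E" using v(1) unfolding neighbors_def by blast
          moreover have "r y = y" using rid IU[OF y] by auto
          moreover have "w \<in> W" using rU[OF v(2)] v(3) by blast
          ultimately show ?thesis using y v by blast
        qed
      qed
      show "3 \<le> card I + card (insert a W)" using I9 by linarith
    qed
    moreover have "card (insert a W) \<le> 6" using W5 aW fW by simp
    moreover have "3 * card I \<le> card R"
    proof -
      have fin: "finite (N y \<inter> U)" for y using finN by simp
      have "(\<Sum>y\<in>I. 3) \<le> (\<Sum>y\<in>I. card (insert a (r ` (N y \<inter> U))))"
      proof (rule sum_mono)
        fix y assume y: "y \<in> I"
        have "a \<notin> r ` (N y \<inter> U)" using rU aW by fastforce
        moreover have "2 \<le> card (r ` (N y \<inter> U))" using no y by force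
        ultimately show "3 \<le> card (insert a (r ` (N y \<inter> U)))" using fin by simp
      qed
      also have "\<dots> = card R" unfolding R_def by (rule card_SigmaI[symmetric]) (use fI fin in auto)
      finally show ?thesis by simp
    qed
    ultimately show False using I9 by presburger
  qed
  then obtain y where y: "y \<in> I" "card (r ` (N y \<inter> U)) \<le> 1" by blast
  have yY: "y \<in> Y" using y(1) I(1) by blast
  let ?U = "N y \<inter> U"
  have fU: "finite ?U" using finN by simp
  have U1: "card ?U \<le> s - 1"
  proof (cases "?U = {}")
    case True
    then have "card ?U = 0" by (simp only: card.empty)
    then show ?thesis by simp
  next
    case False
    then obtain v0 where v0: "v0 \<in> ?U" by blast
    have same: "r v = r v0" if "v \<in> ?U" for v
    proof (rule ccontr)
      assume ne: "r v \<noteq> r v0"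
      have "{r v, r v0} \<subseteq> r ` ?U" using that v0 by blast
      then have "card {r v, r v0} \<le> card (r ` ?U)" by (rule card_mono[rotated]) (use fU in simp)
      then show False using ne y(2) by simp
    qed
    have rv0: "r v0 \<in> W" using rU v0 by blast
    have "?U \<subseteq> N y \<inter> N (r v0) - {a}"
    proof
      fix v assume v: "v \<in> ?U"
      have "r v0 \<in> N v" using rU[of v] v same[OF v] by auto
      moreover have "v \<noteq> a" using v KU[OF a] by blast
      ultimately show "v \<in> N y \<inter> N (r v0) - {a}" using v N_sym by blast
    qed
    then have "card ?U \<le> card (N y \<inter> N (r v0) - {a})" by (rule card_mono[rotated]) (use finN in simp)
    also have "\<dots> \<le> s - 1"
    proof (rule codeg_minus)
      show "y \<noteq> r v0" using rv0 WK YK(1)[OF yY] by blast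
      show "a \<in> N y" by (rule YK(4)[OF yY])
      show "a \<in> N (r v0)" using rv0 WN N_sym by blast
    qed
    finally show ?thesis .
  qed
  have "card C' \<le> (\<Sum>v\<in>?U. card (N v \<inter> W))"
  proof (rule card_UN_image_le[where h = "\<lambda>v w. c {v, w}"])
    show "C' \<subseteq> (\<Union>v\<in>?U. (\<lambda>w. c {v, w}) ` (N v \<inter> W))"
    proof
      fix x assume x: "x \<in> C'"
      obtain v w where vw: "v \<in> N y - K" "w \<in> W" "w \<in> N v" "c {v, w} = x" using seen[OF y(1) x] by blast
      have "v \<in> ?U" using vw N_V unfolding U_def by blast
      then show "x \<in> (\<Union>v\<in>?U. (\<lambda>w. c {v, w}) ` (N v \<inter> W))" using vw by blast
    qed
  qed (use fU finN in auto)
  also have "\<dots> \<le> (\<Sum>v\<in>?U. 4 + (if 5 \<le> card (N v \<inter> W) then 1 else 0))"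
  proof (rule sum_mono)
    fix v
    have "card (N v \<inter> W) \<le> card W" by (rule card_mono[OF fW]) blast
    then show "card (N v \<inter> W) \<le> 4 + (if 5 \<le> card (N v \<inter> W) then 1 else 0)" using W5 by simp
  qed
  also have "\<dots> = 4 * card ?U + card {v \<in> ?U. 5 \<le> card (N v \<inter> W)}"
    using fU by (simp add: sum.distrib sum_if_card)
  also have "\<dots> \<le> 4 * (s - 1) + 1"
  proof -
    have "card {v \<in> ?U. 5 \<le> card (N v \<inter> W)} \<le> 1"
    proof (rule ccontr)
      let ?T = "{v \<in> ?U. 5 \<le> card (N v \<inter> W)}"
      assume two: "\<not> card ?T \<le> 1"
      have fT: "finite ?T" by (rule finite_subset[OF _ fU]) blast
      have "\<not> (\<forall>v1\<in>?T. \<forall>v2\<in>?T. v1 = v2)"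
        using two unfolding One_nat_def card_le_Suc0_iff_eq[OF fT] .
      then obtain v1 v2 where v: "v1 \<in> ?U" "v2 \<in> ?U" "5 \<le> card (N v1 \<inter> W)" "5 \<le> card (N v2 \<inter> W)" "v1 \<noteq> v2"
        by blast
      have full: "N v \<inter> W = W" if "5 \<le> card (N v \<inter> W)" for v
        by (rule card_seteq[OF fW]) (use that W5 in auto)
      have "W \<subseteq> N v1 \<inter> N v2 \<inter> N a" using full[OF v(3)] full[OF v(4)] WN by blast
      then have "card W \<le> card (N v1 \<inter> N v2 \<inter> N a)" by (rule card_mono[rotated]) (use finN in simp)
      also have "\<dots> \<le> 2" by (rule three_common) (use v KU[OF a] in auto)
      finally show False using v(3) full[OF v(3)] by simp
    qed
    then show ?thesis using mult_le_mono2[OF U1, of 4] by linarith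
  qed
  finally show False using C4 s by linarith
qed

text \<open>The center \<open>a\<close> has at most five core neighbors, so it belongs to \<open>H\<close>. At most \<open>5 * s\<close> of its
  peeled neighbors have another core neighbor; since its degree is at least \<open>5 * s + 6\<close>, some peeled
  neighbors have \<open>a\<close> as their only core neighbor. These are deleted, and their edges to \<open>a\<close>
  are restored by Hall's theorem.\<close>

lemma coloring_exists_step_huge_degree:
  assumes IH: "\<And>E'. E' \<subset> E \<Longrightarrow> \<exists>c. coloring E' E' (D + s) c" and s: "2 \<le> s" and D: "13 * s \<le> D"
  shows "\<exists>c. coloring E E (D + s) c"
proof -
  define H where "H = {v. D + 6 \<le> card (N v) + 8 * s}"
  obtain K and pos :: "'a \<Rightarrow> nat" where K: "K \<subseteq> V" "inj_on pos (V - K)"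
    "\<forall>x\<in>V - K. x \<notin> H \<and> pos x \<le> card V \<and> card (N x \<inter> (K \<union> {x' \<in> V - K. pos x' < pos x})) \<le> 5"
    "\<forall>v\<in>K. v \<notin> H \<longrightarrow> 6 \<le> card (N v \<inter> K)"
    using peeling[OF finV, of H] by (elim exE conjE)
  have finish: "\<exists>c. coloring E E (D + s) c" if c: "coloring E {e \<in> E. e \<inter> K \<noteq> {}} (D + s) c" for c
  proof (rule peeled_edges_last[OF K(2) _ _ _ c])
    show "card (N x \<inter> (K \<union> {x' \<in> V - K. pos x' < pos x})) \<le> 5" if "x \<in> V - K" for x using K(3) that by blast
    show "card (N x) + 8 * s \<le> D + 5" if "x \<in> V - K" for x
    proof -
      have "x \<notin> H" using K(3) that by blast
      then show ?thesis unfolding H_def by simp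
    qed
    show "1 \<le> s" using s by simp
  qed
  show ?thesis
  proof (cases "K = {}")
    case True
    show ?thesis by (rule finish[of "\<lambda>_. 0"]) (simp add: True coloring_def)
  next
    case False
    obtain a Q where a: "a \<in> K" "card Q \<le> 5" "finite Q" "a \<notin> Q" "N a \<inter> K \<subseteq> Q"
      "\<forall>x\<in>N a - K. N x \<inter> K \<noteq> {a} \<longrightarrow> (\<exists>w\<in>Q. x \<in> N w)"
      using center_few_clusters[OF K(1) False] by (elim bexE exE conjE)
    have aK: "card (N a \<inter> K) \<le> 5" using card_mono[OF a(3,5)] a(2) by linarith
    have "a \<in> H"
    proof (rule ccontr)
      assume "a \<notin> H"
      then have "6 \<le> card (N a \<inter> K)" using K(4) a(1) by blast
      then show False using aK by linarith
    qed
    then have da: "D + 6 \<le> card (N a) + 8 * s" unfolding H_def by simp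
    define Y where "Y = {y \<in> N a - K. N y \<inter> K = {a}}"
    have YN: "Y \<subseteq> N a" unfolding Y_def by blast
    have fY: "finite Y" by (rule finite_subset[OF YN finN])
    have many: "card (N a) \<le> card Y + 5 * s + 5"
    proof -
      have "N a \<subseteq> Y \<union> (\<Union>w\<in>Q. N a \<inter> N w) \<union> (N a \<inter> K)" using a(6) unfolding Y_def by blast
      then have "card (N a) \<le> card (Y \<union> (\<Union>w\<in>Q. N a \<inter> N w) \<union> (N a \<inter> K))"
        by (rule card_mono[rotated]) (use fY a(3) finN in auto)
      also have "\<dots> \<le> card Y + card (\<Union>w\<in>Q. N a \<inter> N w) + card (N a \<inter> K)"
        by (intro order_trans[OF card_Un_le] add_mono order_refl)
      also have "card (\<Union>w\<in>Q. N a \<inter> N w) \<le> (\<Sum>w\<in>Q. card (N a \<inter> N w))" by (rule card_UN_le[OF a(3)])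
      also have "(\<Sum>w\<in>Q. card (N a \<inter> N w)) \<le> (\<Sum>w\<in>Q. s)"
        by (rule sum_mono, rule codeg) (use a(4) in blast)
      also have "(\<Sum>w\<in>Q. s) \<le> 5 * s" using mult_le_mono1[OF a(2), of s] by simp
      finally show ?thesis using aK by linarith
    qed
    have "Y \<noteq> {}"
    proof
      assume "Y = {}"
      then have "card Y = 0" by (simp only: card.empty)
      then show False using many da D by linarith
    qed
    have Ya: "{a, y} \<in> E" if "y \<in> Y" for y using that YN unfolding neighbors_def by blast
    have "delete E Y \<subset> E" using \<open>Y \<noteq> {}\<close> Ya unfolding delete_def by blast
    then obtain c0 where c0: "coloring (delete E Y) (delete E Y) (D + s) c0" using IH by blast
    define F where "F = {e \<in> E. e \<inter> Y = {} \<and> e \<inter> K \<noteq> {}}"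
    have FE: "F \<subseteq> E" and FK: "f \<in> F \<Longrightarrow> f \<inter> K \<noteq> {}" and FY: "f \<in> F \<Longrightarrow> f \<inter> Y = {}" for f
      unfolding F_def by auto
    have c1: "coloring E F (D + s) c0"
      by (rule coloring_subset[OF coloring_delete[OF c0]]) (auto simp: F_def delete_def)
    have "\<exists>c2. coloring E (F \<union> (\<lambda>y. {a, y}) ` Y) (D + s) c2"
    proof (rule coloring_star[OF c1 FE finE edge2 fY Ya])
      show "{a, y} \<notin> F" if "y \<in> Y" for y using FY that by blast
      show "card {x. x < D + s \<and> (\<forall>y\<in>I. \<exists>f\<in>F. conflict E {a, y} f \<and> c0 f = x)} + card I \<le> D + s"
        if "I \<subseteq> Y" "I \<noteq> {}" for I
        by (rule hall_condition_leaves[OF s D K(1) a(1) aK Y_def many FE FK FY c1 that])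
    qed
    then obtain c2 where c2: "coloring E (F \<union> (\<lambda>y. {a, y}) ` Y) (D + s) c2" by blast
    show ?thesis
    proof (rule finish[of c2], rule coloring_subset[OF c2], rule subsetI)
      fix e assume e: "e \<in> {e \<in> E. e \<inter> K \<noteq> {}}"
      show "e \<in> F \<union> (\<lambda>y. {a, y}) ` Y"
      proof (cases "e \<inter> Y = {}")
        case True
        then show ?thesis using e unfolding F_def by blast
      next
        case False
        then obtain y where y: "y \<in> e" "y \<in> Y" by blast
        have "e \<in> E" using e by blast
        then obtain w where w: "e = {y, w}" "w \<in> N y" using edge_at y(1) by blast
        have "y \<notin> K" "N y \<inter> K = {a}" using y(2) unfolding Y_def by auto
        then have "w = a" using e w by blast
        then show ?thesis using w(1) y(2) by (auto simp: insert_commute)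
      qed
    qed
  qed
qed

end

theorem coloring_exists_large_degree:
  assumes "2 \<le> s" "13 * s \<le> D" "bounded_graph V E D s"
  shows "\<exists>c. coloring E E (D + s) c"
proof -
  interpret g: bounded_graph V E D s by (rule assms(3))
  show ?thesis
    using g.finE assms(3)
  proof (induction E rule: finite_psubset_induct)
    case (psubset E)
    interpret bounded_graph V E D s by (rule psubset.prems)
    have IH: "\<exists>c. coloring E' E' (D + s) c" if "E' \<subset> E" for E'
      by (rule psubset.IH[OF that]) (use subgraph that in blast)
    show ?case by (rule coloring_exists_step_huge_degree[OF IH assms(1,2)])
  qed
qed

lemma bounded_graph_max_degree:
  assumes "simple_graph V E" "planar V E" "K2t_free t V E"
  shows "bounded_graph V E (max_degree V E) (t - 1)"
proof
  show "simple_graph V E" "planar V E" by fact+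
  have EV: "e \<subseteq> V" if "e \<in> E" for e using assms(1) that unfolding simple_graph_def by blast
  have fV: "finite V" using assms(1) unfolding simple_graph_def by blast
  have out: "neighbors E v = {}" if "v \<notin> V" for v using EV that unfolding neighbors_def by blast
  show "card (neighbors E v) \<le> max_degree V E" for v
  proof (cases "v \<in> V")
    case True
    then show ?thesis
      using fV unfolding max_degree_def vertex_degree_def by (intro Max_ge) auto
  qed (simp add: out)
  show "card (neighbors E u \<inter> neighbors E v) \<le> t - 1" if "u \<noteq> v" for u v
  proof (cases "u \<in> V \<and> v \<in> V")
    case True
    then show ?thesis using assms(3) that unfolding K2t_free_def by simp
  next
    case False
    then have "neighbors E u \<inter> neighbors E v = {}" using out by blast
    then show ?thesis by simp
  qed
qed

theorem theorem3p1:
  fixes V :: "'a set" and E :: "'a set set" and t :: nat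
  assumes "t \<ge> 2"
    and "simple_graph V E"
    and "planar V E"
    and "K2t_free t V E"
    and "t = 2 \<or> t \<ge> 35 \<or> (3 \<le> t \<and> t \<le> 34 \<and> max_degree V E \<ge> 13 * (t - 1))"
  shows "B_coloring_number E \<le> max_degree V E + t - 1"
proof -
  have g: "bounded_graph V E (max_degree V E) (t - 1)" by (rule bounded_graph_max_degree[OF assms(2-4)])
  have "\<exists>c. coloring E E (max_degree V E + (t - 1)) c"
    using assms(5)
  proof (elim disjE conjE)
    assume t: "t = 2"
    interpret bounded_graph V E "max_degree V E" "t - 1" by (rule g)
    have "\<exists>c. coloring E E (max_degree V E + 1) c"
      by (rule coloring_no_four_cycle[OF assms(2) deg]) (use codeg t in auto)
    then show ?thesis using t by simp
  next
    assume "t \<ge> 35"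
    then show ?thesis by (intro coloring_exists_large_codegree[OF _ g]) simp
  next
    assume "3 \<le> t" "max_degree V E \<ge> 13 * (t - 1)"
    then show ?thesis by (intro coloring_exists_large_degree[OF _ _ g]) simp_all
  qed
  then obtain c where c: "coloring E E (max_degree V E + (t - 1)) c" by blast
  have "B_coloring_number E \<le> max_degree V E + (t - 1)" by (rule coloring_B_coloring[OF c assms(2)])
  then show ?thesis using assms(1) by simp
qed

end
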